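(* Let $\mathbb{F}$ be a subfield of $\mathbb{C}$ such that $\bar x\in\mathbb{F}$ for all $x\in\mathbb{F}$ and $\sqrt{y}\in\mathbb{F}$ for all $y\in\mathbb{F}$ with $y>0$. Let $d\ge2$ and $r\ge1$ be integers. Input: an orthogonal $d$-band filter $a_0$ with multiplicity $r$ and coefficients in $\mathbb{F}$, having symmetry $$a_0(z)=\mathrm{diag}(\varepsilon_1z^{dc_1},\ldots,\varepsilon_rz^{dc_r})\,a_0(1/z)\,\mathrm{diag}(\varepsilon_1z^{-c_1},\ldots,\varepsilon_rz^{-c_r})$$ for some $\varepsilon_1,\ldots,\varepsilon_r\in\{-1,1\}$ and $c_1,\ldots,c_r\in\mathbb{R}$ with $dc_\ell-c_j\in\mathbb{Z}$ for all $\ell,j=1,\ldots,r$. (1) Construct the $dr\times dr$ paraunitary matrix $U$ described in the context, such that $P:=P_{a_0}U$, where $P_{a_0}:=[a_{0;0},\ldots,a_{0;d-1}]$, has compatible symmetry: $\mathcal{S}P=[\varepsilon_1z^{k_1},\ldots,\varepsilon_rz^{k_r}]^T\mathcal{S}\theta$ for some $k_1,\ldots,k_r\in\mathbb{Z}$ and some $1\times dr$ row vector $\theta$ of Laurent polynomials with symmetry. (2) Derive from $P$, by the matrix extension algorithm outlined in the context, a $dr\times dr$ matrix $P_e$ of Laurent polynomials with coefficients in $\mathbb{F}$ such that: the first $r$ rows of $P_e$ form $P$; $P_eP_e^*=I_{dr}$; the symmetry of $P_e$ is compatible; and $|\mathrm{coeffsupp}([P_e]_{j,k})|\le\max_{1\le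 n\le r}|\mathrm{coeffsupp}([P]_{n,k})|$ for all $1\le j,k\le dr$. (3) Let $\mathcal{P}:=P_eU^*=:(a_{m;\gamma})_{0\le m,\gamma\le d-1}$ (with $r\times r$ blocks $a_{m;\gamma}$ in block row $m$ and block column $\gamma$). Define high-pass filters $$a_m(z):=\frac1{\sqrt d}\sum_{\gamma=0}^{d-1}a_{m;\gamma}(z^d)z^\gamma,\qquad m=1,\ldots,d-1.$$ Then the output $\{a_0,a_1,\ldots,a_{d-1}\}$ is a symmetric filter bank with the perfect reconstruction property; that is, the polyphase matrix $\mathcal{P}=(a_{m;\gamma})_{0\le m,\gamma\le d-1}$ is paraunitary and all filters $a_m$, $m=1,\ldots,d-1$, have symmetry $$a_m(z)=\mathrm{diag}(\varepsilon_1^mz^{dc_1^m},\ldots,\varepsilon_r^mz^{dc_r^m})\,a_m(1/z)\,\mathrm{diag}(\varepsilon_1z^{-c_1},\ldots,\varepsilon_rz^{-c_r}),$$ where $c^m_\ell:=(k^m_\ell-k_\ell)+c_\ell\in\mathbb{R}$ and all $\varepsilon^m_\ell\in\{-1,1\}$, $k^m_\ell\in\mathbb{Z}$, for $\ell=1,\ldots,r$ and $m=1,\ldots,d-1$, are determined by the symmetry pattern of $P_e$ as follows: $$[\varepsilon_1z^{k_1},\ldots,\varepsilon_rz^{k_r},\ \varepsilon^1_1z^{k^1_1},\ldots,\varepsilon^1_rz^{k^1_r},\ \ldots,\ \varepsilon^{d-1}_1z^{k^{d-1}_1},\ldots,\varepsilon^{d-1}_rz^{k^{d-1}_r}]^T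\,\mathcal{S}\theta:=\mathcal{S}P_e.$$
   Context: Filters: a filter with multiplicity $r$ is a finitely supported sequence $\mathsf{a}:\mathbb{Z}\to\mathbb{F}^{r\times r}$, identified with its symbol $a(z):=\sum_{k\in\mathbb{Z}}\mathsf{a}(k)z^k$. For a filter $\mathsf{a}_m$ with symbol $a_m$, the $d$-band subsymbols are $a_{m;\gamma}(z):=\sqrt{d}\sum_{k\in\mathbb{Z}}\mathsf{a}_m(\gamma+dk)z^k$, $\gamma\in\mathbb{Z}$. The filter $a_0$ is $d$-band orthogonal if $\sum_{\gamma=0}^{d-1}a_{0;\gamma}(z)a_{0;\gamma}^*(z)=I_r$ for all $z\in\mathbb{C}\setminus\{0\}$. For a matrix $P(z)=\sum_kP_kz^k$ of Laurent polynomials, $P^*(z):=\sum_k\overline{P_k}^{T}z^{-k}$; a square $P$ is paraunitary if $P(z)P^*(z)=I$ for all $z\in\mathbb{C}\setminus\{0\}$. $[P]_{j,k}$ is the $(j,k)$-entry and $[P]_{:,j}$ the $j$th column. For $P$ with $P_k=\mathbf{0}$ for $k\notin[m,n]$, $P_m\ne\mathbf{0}$, $P_n\neq\mathbf{0}$, $\mathrm{coeffsupp}(P):=[m,n]$ and $|\mathrm{coeffsupp}(P)|:=n-m$; $|\mathrm{coeffsupp}(\mathbf{0})|:=-\infty$. Symmetry: a Laurent polynomial $p=\sum_kp_kz^k$ has symmetry if $p_{c-k}=\varepsilon p_k$ for all $k$, for some $\varepsilon\in\{-1,1\}$, $c\in\mathbb{Z}$; for $p\ne0$ this means $\mathcal{S}p(z):=p(z)/p(1/z)=\varepsilon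 z^c$. $\mathcal{S}0$ is understood to take an appropriate choice of $\varepsilon z^c$ so that the identity in which it occurs holds; $\mathcal{S}$ acts entrywise on matrices. A matrix $P$ has compatible symmetry if $\mathcal{S}P=(\mathcal{S}\theta_1)^*\mathcal{S}\theta_2$ for some row vectors $\theta_1,\theta_2$ of Laurent polynomials with symmetry. The matrix $U$ in step (1): for $\gamma\in\{0,\ldots,d-1\}$ and $\ell,j=1,\ldots,r$, let $R^\gamma_{\ell,j}\in\mathbb{Z}$ and $Q^\gamma_{\ell,j}\in\{0,\ldots,d-1\}$ be uniquely determined by $dc_\ell-c_j-\gamma=dR^\gamma_{\ell,j}+Q^\gamma_{\ell,j}$; then $Q^\gamma_{\ell,j}$ is independent of $\ell$. Let $\kappa_{j,\gamma}\in\mathbb{Z}$ be an integer such that $|\mathrm{coeffsupp}([a_{0;\gamma}]_{:,j}+z^{\kappa_{j,\gamma}}[a_{0;Q^\gamma_{\ell,j}}]_{:,j})|$ is as small as possible. Define $r\times r$ matrices $b_{0;\gamma}$ columnwise by $[b_{0;\gamma}]_{:,j}:=[a_{0;\gamma}]_{:,j}$ if $\gamma=Q^\gamma_{\ell,j}$; $[b_{0;\gamma}]_{:,j}:=\frac1{\sqrt2}([a_{0;\gamma}]_{:,j}+z^{\kappa_{j,\gamma}}[a_{0;Q^\gamma_{\ell,j}}]_{:,j})$ if $\gamma<Q^\gamma_{\ell,j}$; and $[b_{0;\gamma}]_{:,j}:=\frac1{\sqrt2}([a_{0;\gamma}]_{:,j}-z^{\kappa_{j,\gamma}}[a_{0;Q^\gamma_{\ell,j}}]_{:,j})$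 if $\gamma>Q^\gamma_{\ell,j}$. $U$ is the transform matrix corresponding to these column operations, so that $[b_{0;0},\ldots,b_{0;d-1}]=[a_{0;0},\ldots,a_{0;d-1}]U$. Outline of the matrix extension algorithm in step (2), applied to an $r\times s$ matrix $P$ (here $s=dr$) with $PP^*=I_r$ and $\mathcal{S}P=(\mathcal{S}\theta_1)^*\mathcal{S}\theta_2$: first pass to $Q:=U_{\mathcal{S}\theta_1}^*PU_{\mathcal{S}\theta_2}$, where $U_{\mathcal{S}\theta_1},U_{\mathcal{S}\theta_2}$ are products of a diagonal matrix of monomials and a permutation matrix bringing the symmetry pattern of $Q$ to a standard form; then, while $|\mathrm{coeffsupp}(Q)|>0$, multiply $Q$ on the right by explicitly constructed $s\times s$ paraunitary matrices $A_1,A_2,\ldots$ with compatible symmetry and coefficient support in $[-1,1]$, each shortening the coefficient support of $Q$; when $Q$ has become constant, choose a constant unitary matrix $V$ over $\mathbb{F}$ with $QV=[I_r,\mathbf{0}]$. Then $P_e:=\mathrm{diag}(U_{\mathcal{S}\theta_1},I_{s-r})\,V^*\cdots A_2^*A_1^*\,U_{\mathcal{S}\theta_2}^*$.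
   Formalization: In (2) the bound is max(0, max_n |coeffsupp([P]_{n,k})|), since a zero column of P (Haar: P=[1,0]) makes the stated bound impossible; the minimizing κ are chosen with κ_{j,Q}=-κ_{j,γ} for γ≠Q, without which U is not paraunitary. *)

theory Defs
  imports
    "HOL-Analysis.Complex_Transcendental"
    "HOL-Library.Poly_Mapping"
    "HOL-Library.Extended_Real"
    "HOL-Combinatorics.Permutations"
    "Jordan_Normal_Form.Matrix"
begin

text \<open>
  A finitely supported sequence is identified with its symbol: multiplication on
  \<^typ>\<open>int \<Rightarrow>\<^sub>0 complex\<close> is convolution of coefficients. Likewise a filter of multiplicity \<open>r\<close>
  is an \<open>r \<times> r\<close> matrix over this ring.
\<close>

type_synonym laurent = "int \<Rightarrow>\<^sub>0 complex"

abbreviation lmonom :: "complex \<Rightarrow> int \<Rightarrow> laurent" where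
  "lmonom a n \<equiv> Poly_Mapping.single n a"

definition leval :: "laurent \<Rightarrow> complex \<Rightarrow> complex" where
  "leval p z = (\<Sum>k\<in>Poly_Mapping.keys p. Poly_Mapping.lookup p k * z powi k)"

definition lstar :: "laurent \<Rightarrow> laurent" where
  "lstar p = Abs_poly_mapping (\<lambda>k. cnj (Poly_Mapping.lookup p (- k)))"

lemma lookup_lstar: "Poly_Mapping.lookup (lstar p) k = cnj (Poly_Mapping.lookup p (- k))"
proof -
  have "{k. cnj (Poly_Mapping.lookup p (- k)) \<noteq> 0} \<subseteq> uminus ` Poly_Mapping.keys p"
    by (force simp: in_keys_iff image_iff)
  then have "finite {k. cnj (Poly_Mapping.lookup p (- k)) \<noteq> 0}"
    using finite_surj[OF finite_keys] by blast
  then show ?thesis by (simp add: lstar_def)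
qed

definition dilate :: "nat \<Rightarrow> laurent \<Rightarrow> laurent" where
  "dilate d p = (\<Sum>k\<in>Poly_Mapping.keys p. lmonom (Poly_Mapping.lookup p k) (int d * k))"

definition meval :: "laurent mat \<Rightarrow> complex \<Rightarrow> complex mat" where
  "meval P z = map_mat (\<lambda>p. leval p z) P"

definition mstar :: "laurent mat \<Rightarrow> laurent mat" where
  "mstar P = map_mat lstar (transpose_mat P)"

definition paraunitary :: "nat \<Rightarrow> laurent mat \<Rightarrow> bool" where
  "paraunitary n P \<longleftrightarrow>
     P \<in> carrier_mat n n \<and> (\<forall>z. z \<noteq> 0 \<longrightarrow> meval P z * meval (mstar P) z = 1\<^sub>m n)"

definition coeffs_in :: "complex set \<Rightarrow> laurent mat \<Rightarrow> bool" where
  "coeffs_in F P \<longleftrightarrow> (\<forall>i<dim_row P. \<forall>j<dim_col P. \<forall>k. Poly_Mapping.lookup (P $$ (i, j)) k \<in> F)"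

definition is_complex_subfield :: "complex set \<Rightarrow> bool" where
  "is_complex_subfield F \<longleftrightarrow> 0 \<in> F \<and> 1 \<in> F \<and>
     (\<forall>x\<in>F. \<forall>y\<in>F. x + y \<in> F \<and> x - y \<in> F \<and> x * y \<in> F) \<and> (\<forall>x\<in>F. inverse x \<in> F)"

definition mkeys :: "laurent mat \<Rightarrow> int set" where
  "mkeys P = (\<Union>i<dim_row P. \<Union>j<dim_col P. Poly_Mapping.keys (P $$ (i, j)))"

definition support_length :: "int set \<Rightarrow> ereal" where
  "support_length K = (if K = {} then - \<infinity> else ereal (real_of_int (Max K - Min K)))"

abbreviation clen :: "laurent \<Rightarrow> ereal" where
  "clen p \<equiv> support_length (Poly_Mapping.keys p)"

abbreviation mclen :: "laurent mat \<Rightarrow> ereal" where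
  "mclen P \<equiv> support_length (mkeys P)"

text \<open>
  \<open>has_S p s\<close> says that \<open>s\<close>, a monomial \<open>\<epsilon> z\<^sup>c\<close>, is an admissible value of \<open>\<S> p\<close>. For
  \<open>p \<noteq> 0\<close> there is at most one such \<open>s\<close>; for \<open>p = 0\<close> every \<open>\<epsilon> z\<^sup>c\<close> is admissible, which renders
  the convention on \<open>\<S> 0\<close>.
\<close>

definition has_S :: "laurent \<Rightarrow> laurent \<Rightarrow> bool" where
  "has_S p s \<longleftrightarrow> (\<exists>\<epsilon>\<in>{1, -1}. \<exists>c. s = lmonom \<epsilon> c \<and> (\<forall>k. Poly_Mapping.lookup p (c - k) = \<epsilon> * Poly_Mapping.lookup p k))"

definition mhas_S :: "laurent mat \<Rightarrow> laurent mat \<Rightarrow> bool" where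
  "mhas_S P M \<longleftrightarrow> M \<in> carrier_mat (dim_row P) (dim_col P) \<and>
     (\<forall>i<dim_row P. \<forall>j<dim_col P. has_S (P $$ (i, j)) (M $$ (i, j)))"

definition compatible_symmetry :: "laurent mat \<Rightarrow> bool" where
  "compatible_symmetry P \<longleftrightarrow> (\<exists>\<theta>1 \<theta>2 S1 S2.
     \<theta>1 \<in> carrier_mat 1 (dim_row P) \<and> \<theta>2 \<in> carrier_mat 1 (dim_col P) \<and>
     mhas_S \<theta>1 S1 \<and> mhas_S \<theta>2 S2 \<and> mhas_S P (mstar S1 * S2))"

text \<open>
  The identity \<open>a(z) = diag(\<delta>\<^sub>\<ell> z\<^bsup>d e\<^sub>\<ell>\<^esup>) a(1/z) diag(\<epsilon>\<^sub>\<ell> z\<^bsup>-c\<^sub>\<ell>\<^esup>)\<close> with real \<open>e\<^sub>\<ell>\<close>, \<open>c\<^sub>\<ell>\<close>.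
  Each power is taken with the principal branch; whenever all \<open>d e\<^sub>\<ell> - c\<^sub>j\<close> are integers, as in all
  uses below, the branch cancels in every entry of the product.
\<close>

definition filter_symmetry ::
  "nat \<Rightarrow> nat \<Rightarrow> laurent mat \<Rightarrow> (nat \<Rightarrow> complex) \<Rightarrow> (nat \<Rightarrow> real) \<Rightarrow>
     (nat \<Rightarrow> complex) \<Rightarrow> (nat \<Rightarrow> real) \<Rightarrow> bool" where
  "filter_symmetry d r a \<delta> e \<epsilon> c \<longleftrightarrow> (\<forall>z. z \<noteq> 0 \<longrightarrow>
     meval a z =
       mat_diag r (\<lambda>l. \<delta> l * z powr complex_of_real (real d * e l)) *
       meval a (1 / z) *
       mat_diag r (\<lambda>l. \<epsilon> l * z powr complex_of_real (- c l)))"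

definition subsymbol :: "nat \<Rightarrow> int \<Rightarrow> laurent \<Rightarrow> laurent" where
  "subsymbol d \<gamma> p =
     Abs_poly_mapping (\<lambda>k. complex_of_real (sqrt (real d)) * Poly_Mapping.lookup p (\<gamma> + int d * k))"

lemma lookup_subsymbol:
  assumes "d > 0"
  shows "Poly_Mapping.lookup (subsymbol d \<gamma> p) k
    = complex_of_real (sqrt (real d)) * Poly_Mapping.lookup p (\<gamma> + int d * k)"
proof -
  have "(\<lambda>k. \<gamma> + int d * k) ` {k. complex_of_real (sqrt (real d)) * Poly_Mapping.lookup p (\<gamma> + int d * k) \<noteq> 0}
      \<subseteq> Poly_Mapping.keys p"
    by (auto simp: in_keys_iff)
  moreover have "inj (\<lambda>k. \<gamma> + int d * k)"
    using assms by (auto simp: inj_def)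
  ultimately have "finite {k. complex_of_real (sqrt (real d)) * Poly_Mapping.lookup p (\<gamma> + int d * k) \<noteq> 0}"
    by (meson finite_imageD finite_keys finite_subset inj_on_subset subset_UNIV)
  then show ?thesis by (simp add: subsymbol_def)
qed

definition msubsymbol :: "nat \<Rightarrow> int \<Rightarrow> laurent mat \<Rightarrow> laurent mat" where
  "msubsymbol d \<gamma> a = map_mat (subsymbol d \<gamma>) a"

definition band_orthogonal :: "nat \<Rightarrow> nat \<Rightarrow> laurent mat \<Rightarrow> bool" where
  "band_orthogonal d r a \<longleftrightarrow> (\<forall>z. z \<noteq> 0 \<longrightarrow> (\<forall>i<r. \<forall>j<r.
     (\<Sum>\<gamma><d. (meval (msubsymbol d (int \<gamma>) a) z * meval (mstar (msubsymbol d (int \<gamma>) a)) z) $$ (i, j))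
       = 1\<^sub>m r $$ (i, j)))"

text \<open>Row and column \<open>m r + \<ell>\<close> of a matrix of \<open>r \<times> r\<close> blocks is number \<open>\<ell>\<close> of block \<open>m\<close>.\<close>

definition block_row :: "nat \<Rightarrow> nat \<Rightarrow> (nat \<Rightarrow> laurent mat) \<Rightarrow> laurent mat" where
  "block_row d r B = Matrix.mat r (d * r) (\<lambda>(l, q). B (q div r) $$ (l, q mod r))"

definition polyphase_row :: "nat \<Rightarrow> nat \<Rightarrow> laurent mat \<Rightarrow> laurent mat" where
  "polyphase_row d r a = block_row d r (\<lambda>\<gamma>. msubsymbol d (int \<gamma>) a)"

definition polyphase_matrix :: "nat \<Rightarrow> nat \<Rightarrow> (nat \<Rightarrow> laurent mat) \<Rightarrow> laurent mat" where
  "polyphase_matrix d r a = Matrix.mat (d * r) (d * r)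
     (\<lambda>(p, q). msubsymbol d (int (q div r)) (a (p div r)) $$ (p mod r, q mod r))"

definition filter_of_polyphase :: "nat \<Rightarrow> nat \<Rightarrow> laurent mat \<Rightarrow> nat \<Rightarrow> laurent mat" where
  "filter_of_polyphase d r PP m = Matrix.mat r r (\<lambda>(l, j).
     lmonom (1 / complex_of_real (sqrt (real d))) 0 *
       (\<Sum>\<gamma><d. dilate d (PP $$ (m * r + l, \<gamma> * r + j)) * lmonom 1 (int \<gamma>)))"

definition Qidx :: "nat \<Rightarrow> (nat \<Rightarrow> real) \<Rightarrow> nat \<Rightarrow> nat \<Rightarrow> nat \<Rightarrow> nat" where
  "Qidx d c \<gamma> l j = nat ((\<lfloor>real d * c l - c j\<rfloor> - int \<gamma>) mod int d)"

lemma Qidx_indep: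
  assumes int: "\<And>l j. l < r \<Longrightarrow> j < r \<Longrightarrow> real d * c l - c j \<in> \<int>"
    and "l < r" "l' < r" "j < r"
  shows "Qidx d c \<gamma> l j = Qidx d c \<gamma> l' j"
proof -
  obtain m where m: "real d * c l - c l = of_int m" using int[OF assms(2) assms(2)] by (rule Ints_cases)
  obtain n where n: "real d * c l - c l' = of_int n" using int[OF assms(2) assms(3)] by (rule Ints_cases)
  have "c l = c l' + of_int (n - m)" using m n by simp
  then have "real d * c l = real d * (c l' + of_int (n - m))"
    by (simp only:)
  then have "real d * c l - c j = (real d * c l' - c j) + of_int (int d * (n - m))"
    by (simp add: ring_distribs)
  then have "\<lfloor>real d * c l - c j\<rfloor> = \<lfloor>real d * c l' - c j\<rfloor> + int d * (n - m)"
    by (simp only: floor_add_int[symmetric])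
  then have "\<lfloor>real d * c l - c j\<rfloor> - int \<gamma>
      = (\<lfloor>real d * c l' - c j\<rfloor> - int \<gamma>) + int d * (n - m)"
    by linarith
  then have "(\<lfloor>real d * c l - c j\<rfloor> - int \<gamma>) mod int d = (\<lfloor>real d * c l' - c j\<rfloor> - int \<gamma>) mod int d"
    by (simp only: mod_mult_self2)
  then show ?thesis by (simp add: Qidx_def)
qed

text \<open>By the preceding lemma \<open>Q\<close> does not depend on \<open>\<ell>\<close>; the row index is fixed to the first row from now on.\<close>

definition Qcol :: "nat \<Rightarrow> (nat \<Rightarrow> real) \<Rightarrow> nat \<Rightarrow> nat \<Rightarrow> nat" where
  "Qcol d c \<gamma> j = Qidx d c \<gamma> 0 j"

definition poly_col :: "nat \<Rightarrow> nat \<Rightarrow> laurent mat \<Rightarrow> nat \<Rightarrow> nat \<Rightarrow> laurent mat" where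
  "poly_col d r a \<gamma> j = Matrix.mat r 1 (\<lambda>(l, _). msubsymbol d (int \<gamma>) a $$ (l, j))"

text \<open>
  The minimising exponents \<open>\<kappa>\<^bsub>j,\<gamma>\<^esub>\<close> need not be unique. The two members \<open>\<gamma> \<noteq> Q\<close> of a pair have
  opposite sets of minimisers, and the last conjunct asks that the two choices be made
  consistently; without it the transform matrix need not be paraunitary.
\<close>

definition admissible_shift ::
  "nat \<Rightarrow> nat \<Rightarrow> (nat \<Rightarrow> real) \<Rightarrow> laurent mat \<Rightarrow> (nat \<Rightarrow> nat \<Rightarrow> int) \<Rightarrow> bool" where
  "admissible_shift d r c a \<kappa> \<longleftrightarrow> (\<forall>j<r. \<forall>\<gamma><d.
     (\<forall>n. mclen (poly_col d r a \<gamma> j + lmonom 1 (\<kappa> j \<gamma>) \<cdot>\<^sub>m poly_col d r a (Qcol d c \<gamma> j) j)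
        \<le> mclen (poly_col d r a \<gamma> j + lmonom 1 n \<cdot>\<^sub>m poly_col d r a (Qcol d c \<gamma> j) j)) \<and>
     (\<gamma> \<noteq> Qcol d c \<gamma> j \<longrightarrow> \<kappa> j (Qcol d c \<gamma> j) = - \<kappa> j \<gamma>))"

definition b_block ::
  "nat \<Rightarrow> nat \<Rightarrow> (nat \<Rightarrow> real) \<Rightarrow> laurent mat \<Rightarrow> (nat \<Rightarrow> nat \<Rightarrow> int) \<Rightarrow> nat \<Rightarrow> laurent mat" where
  "b_block d r c a \<kappa> \<gamma> = Matrix.mat r r (\<lambda>(l, j).
     let Q = Qcol d c \<gamma> j;
         s = lmonom (1 / complex_of_real (sqrt 2)) 0;
         x = msubsymbol d (int \<gamma>) a $$ (l, j);
         y = lmonom 1 (\<kappa> j \<gamma>) * msubsymbol d (int Q) a $$ (l, j)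
     in if \<gamma> = Q then x else if \<gamma> < Q then s * (x + y) else s * (x - y))"

definition transform_matrix ::
  "nat \<Rightarrow> nat \<Rightarrow> (nat \<Rightarrow> real) \<Rightarrow> (nat \<Rightarrow> nat \<Rightarrow> int) \<Rightarrow> laurent mat" where
  "transform_matrix d r c \<kappa> = Matrix.mat (d * r) (d * r) (\<lambda>(p, q).
     let \<gamma>' = p div r; i = p mod r; \<gamma> = q div r; j = q mod r;
         Q = Qcol d c \<gamma> j;
         h = 1 / complex_of_real (sqrt 2)
     in if i \<noteq> j then 0
        else if \<gamma> = Q then (if \<gamma>' = \<gamma> then 1 else 0)
        else if \<gamma>' = \<gamma> then lmonom h 0
        else if \<gamma>' = Q then lmonom (if \<gamma> < Q then h else - h) (\<kappa> j \<gamma>)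
        else 0)"

definition monom_col :: "nat \<Rightarrow> (nat \<Rightarrow> complex) \<Rightarrow> (nat \<Rightarrow> int) \<Rightarrow> laurent mat" where
  "monom_col n \<epsilon> k = Matrix.mat n 1 (\<lambda>(i, _). lmonom (\<epsilon> i) (k i))"

text \<open>
  If column \<open>k\<close> of \<open>P\<close> vanishes then the maximum below is \<open>-\<infinity>\<close>, while column \<open>k\<close> of a paraunitary
  matrix cannot vanish (for the Haar filter one gets \<open>P = [1, 0]\<close>). Such a column is allowed
  support length \<open>0\<close>; for all other columns \<open>max 0\<close> has no effect.
\<close>

definition is_extension :: "complex set \<Rightarrow> nat \<Rightarrow> nat \<Rightarrow> laurent mat \<Rightarrow> laurent mat \<Rightarrow> bool" where
  "is_extension F r s P Pe \<longleftrightarrow>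
     Pe \<in> carrier_mat s s \<and> coeffs_in F Pe \<and>
     (\<forall>i<r. row Pe i = row P i) \<and>
     paraunitary s Pe \<and>
     compatible_symmetry Pe \<and>
     (\<forall>j<s. \<forall>k<s. clen (Pe $$ (j, k)) \<le> max 0 (Max ((\<lambda>n. clen (P $$ (n, k))) ` {..<r})))"

text \<open>
  The standard form \<open>[1, -1, z\<^bsup>-1\<^esup>, -z\<^bsup>-1\<^esup>]\<close> (constant blocks of lengths \<open>n1, n2, n3, n4\<close>) of a row of
  symmetries, and the matrices \<open>U = diag(z\<^bsup>t\<^sub>i\<^esup>) E\<close>, \<open>E\<close> a permutation matrix, that bring a row
  \<open>\<theta>\<close> with \<open>\<S> \<theta> = S\<close> to it: \<open>(\<theta> U)\<^sub>j = \<theta>\<^bsub>\<pi> j\<^esub> z\<^bsup>t (\<pi> j)\<^esup>\<close>, and multiplying by \<open>z\<^sup>t\<close>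
  multiplies the symmetry by \<open>z\<^bsup>2t\<^esup>\<close>.
\<close>

definition standard_row :: "nat \<Rightarrow> laurent mat \<Rightarrow> bool" where
  "standard_row n T \<longleftrightarrow> (\<exists>n1 n2 n3 n4. n = n1 + n2 + n3 + n4 \<and>
     T = Matrix.mat 1 n (\<lambda>(_, j).
       if j < n1 then 1
       else if j < n1 + n2 then - 1
       else if j < n1 + n2 + n3 then lmonom 1 (- 1)
       else lmonom (- 1) (- 1)))"

definition symmetry_normalizer :: "nat \<Rightarrow> laurent mat \<Rightarrow> laurent mat \<Rightarrow> bool" where
  "symmetry_normalizer n S U \<longleftrightarrow> (\<exists>t \<pi>. \<pi> permutes {..<n} \<and>
     U = mat_diag n (\<lambda>i. lmonom 1 (t i)) * Matrix.mat n n (\<lambda>(i, j). if i = \<pi> j then 1 else 0) \<and>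
     standard_row n (Matrix.mat 1 n (\<lambda>(_, j). S $$ (0, \<pi> j) * lmonom 1 (2 * t (\<pi> j)))))"

definition extension_algorithm_output ::
  "complex set \<Rightarrow> nat \<Rightarrow> nat \<Rightarrow> laurent mat \<Rightarrow> laurent mat \<Rightarrow> laurent mat \<Rightarrow> laurent mat \<Rightarrow> bool" where
  "extension_algorithm_output F r s P S1 S2 Pe \<longleftrightarrow> (\<exists>U1 U2 As V.
     symmetry_normalizer r S1 U1 \<and> symmetry_normalizer s S2 U2 \<and>
     (let Q = (\<lambda>i. foldl (*) (mstar U1 * P * U2) (take i As)) in
       (\<forall>i<length As. mclen (Q i) > 0 \<and>
          paraunitary s (As ! i) \<and> compatible_symmetry (As ! i) \<and> mkeys (As ! i) \<subseteq> {-1..1} \<and>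
          mclen (Q (Suc i)) < mclen (Q i)) \<and>
       mclen (Q (length As)) = 0 \<and>
       paraunitary s V \<and> mkeys V \<subseteq> {0} \<and> coeffs_in F V \<and>
       Q (length As) * V = Matrix.mat r s (\<lambda>(i, j). if i = j then 1 else 0)) \<and>
     Pe = four_block_mat U1 (0\<^sub>m r (s - r)) (0\<^sub>m (s - r) r) (1\<^sub>m (s - r)) *
          (mstar V * foldl (\<lambda>M A. mstar A * M) (mstar U2) As))"

end

theory Submission
  imports Defs "HOL-Computational_Algebra.Polynomial" "Jordan_Normal_Form.Determinant"
begin

text \<open>
  Substitute \<open>z = w\<^sup>2\<close> and distribute the centres of symmetry over rows and columns, so that every
  entry of the matrix \<open>Q\<close> to be extended is even or odd under \<open>w \<mapsto> 1/w\<close>. If row \<open>i\<close> of \<open>Q\<close> has degree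
  \<open>n \<ge> 1\<close>, its leading coefficient vector is isotropic for the indefinite form given by the column
  signs, because the coefficient of \<open>w\<^bsup>2n\<^esup>\<close> in \<open>Q Q\<^sup>* = I\<close> vanishes. A constant unitary matrix
  therefore concentrates it in one column \<open>p\<close> of sign \<open>+\<close> and one column \<open>m\<close> of sign \<open>-\<close>, with
  equal entries, and the symmetric paraunitary matrix that multiplies
  \<open>p + m\<close> by \<open>1/w\<close> and \<open>p - m\<close> by \<open>w\<close> lowers the degree of row \<open>i\<close>. By orthogonality of the rows it
  raises the degree of no other row. Treating all rows of maximal degree, first with the even and
  then with the odd columns, gives one factor of the algorithm, with support in \<open>[-1, 1]\<close> in terms of
  \<open>z\<close>. Giving the odd columns the offset \<open>-1\<close> in even and \<open>+1\<close> in odd degree makes the support length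
  equal to the degree, so that it drops with each factor.

  The bound on the columns of the extension rests on the following invariant: if \<open>X\<close> is a column vector such that
  \<open>X\<close> and \<open>Q X\<close> have degree at most \<open>\<sigma>\<close>, then so has \<open>A\<^sup>* X\<close> for each factor \<open>A\<close>. Indeed, the coefficient
  of \<open>w\<^bsup>n + \<sigma>\<^esup>\<close> in row \<open>i\<close> of \<open>Q X\<close> vanishes, hence so does that of \<open>w\<^sup>\<sigma>\<close> in the component of \<open>X\<close>
  along \<open>p + m\<close>, the only one that \<open>A\<^sup>*\<close> multiplies by \<open>w\<close>. It is applied to unit vectors.
\<close>

subsection \<open>Laurent polynomials\<close>

text \<open>The overview leaves open where the symmetric matrix comes from. The symmetry of
  \<open>a0\<close> does not preserve a subsymbol: in column j it interchanges the subsymbols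
  \<gamma> and \<open>q \<gamma> j\<close>. Sums and differences over the orbits of this involution
  are symmetric, with opposite signs, and passing to them is paraunitary because the shifts of the
  two partners are opposite. Multiplying the extension by the adjoint of \<open>U\<close> restores,
  in every new row, a reflection that interchanges subsymbols; this is the symmetry of a filter. The
  order of even and odd columns has a reason. A mixing step changes the parity of its two columns,
  so a column takes part at most once while the parity of the treated columns is fixed, however many
  rows are lowered. Each half of a factor therefore has exponents in [-1, 1] in w, and the whole
  factor in [-1, 1] in z. Isotropy says that the positive and the negative part of the leading
  vector have equal squared norms. The square root of this number is the common value of the two
  entries; this is where closure of \<open>F\<close> under square roots enters.\<close>

abbreviation cf :: "laurent \<Rightarrow> int \<Rightarrow> complex" where
  "cf \<equiv> Poly_Mapping.lookup"

lemma laurent_sum_monomials: "p = (\<Sum>k\<in>Poly_Mapping.keys p. lmonom (cf p k) k)"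
proof (rule poly_mapping_eqI)
  fix m
  have "cf (\<Sum>k\<in>Poly_Mapping.keys p. lmonom (cf p k) k) m
    = (\<Sum>k\<in>Poly_Mapping.keys p. if k = m then cf p k else 0)"
    by (simp add: lookup_sum lookup_single when_def)
  also have "\<dots> = cf p m"
    by (simp add: in_keys_iff)
  finally show "cf p m = cf (\<Sum>k\<in>Poly_Mapping.keys p. lmonom (cf p k) k) m" by simp
qed

lemma laurent_induct [case_names zero add]:
  assumes zero: "P 0" and add: "\<And>p a n. P p \<Longrightarrow> P (p + lmonom a n)"
  shows "P p"
proof -
  have "P (\<Sum>k\<in>K. lmonom (cf p k) k)" if "finite K" for K
    using that
  proof induction
    case (insert k K)
    then show ?case using add[where a = "cf p k" and n = k] by (simp add: add.commute[of "lmonom (cf p k) k"])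
  qed (simp add: zero)
  then show ?thesis
    using laurent_sum_monomials[of p] by (metis finite_keys)
qed

lemma cf_lmonom_mult: "cf (lmonom a n * p) k = a * cf p (k - n)"
proof (induction p rule: laurent_induct)
  case (add p b m)
  then show ?case
    by (auto simp: distrib_left lookup_add mult_single lookup_single when_def)
qed simp

lemma cf_mult_lmonom: "cf (p * lmonom a n) k = cf p (k - n) * a"
  by (metis cf_lmonom_mult mult.commute)

lemma cf_mult:
  assumes "finite K" "Poly_Mapping.keys p \<subseteq> K"
  shows "cf (p * q) m = (\<Sum>k\<in>K. cf p k * cf q (m - k))"
proof -
  have "p * q = (\<Sum>k\<in>Poly_Mapping.keys p. lmonom (cf p k) k * q)"
    by (subst laurent_sum_monomials[of p]) (rule sum_distrib_right)
  then have "cf (p * q) m = (\<Sum>k\<in>Poly_Mapping.keys p. cf p k * cf q (m - k))"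
    by (simp add: lookup_sum cf_lmonom_mult)
  also have "\<dots> = (\<Sum>k\<in>K. cf p k * cf q (m - k))"
    by (rule sum.mono_neutral_left) (use assms in \<open>auto simp: in_keys_iff\<close>)
  finally show ?thesis .
qed

lemma cf_mult_nonzero:
  assumes "cf (p * q) t \<noteq> 0"
  obtains t1 t2 where "t = t1 + t2" "cf p t1 \<noteq> 0" "cf q t2 \<noteq> 0"
proof -
  have "t \<in> Poly_Mapping.keys (p * q)" using assms by (simp add: in_keys_iff)
  then show ?thesis using keys_mult[of p q] that by (fastforce simp: in_keys_iff)
qed

lemma leval_alt:
  assumes "finite K" "Poly_Mapping.keys p \<subseteq> K"
  shows "leval p z = (\<Sum>k\<in>K. cf p k * z powi k)"
  unfolding leval_def
  by (rule sum.mono_neutral_left) (use assms in \<open>auto simp: in_keys_iff\<close>)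

lemma leval_0 [simp]: "leval 0 z = 0"
  by (simp add: leval_def)

lemma leval_lmonom: "leval (lmonom a n) z = a * z powi n"
  by (subst leval_alt[of "{n}"]) (auto simp: lookup_single)

lemma leval_1 [simp]: "leval 1 z = 1"
  using leval_lmonom[where a = 1 and n = 0] by simp

lemma leval_add: "leval (p + q) z = leval p z + leval q z"
proof -
  let ?K = "Poly_Mapping.keys p \<union> Poly_Mapping.keys q"
  have "leval (p + q) z = (\<Sum>k\<in>?K. cf (p + q) k * z powi k)"
    by (rule leval_alt) (use keys_add[of p q] in auto)
  also have "\<dots> = leval p z + leval q z"
    by (subst (1 2) leval_alt[of ?K]) (auto simp: lookup_add distrib_right sum.distrib)
  finally show ?thesis .
qed

lemma leval_sum: "leval (\<Sum>i\<in>I. f i) z = (\<Sum>i\<in>I. leval (f i) z)"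
  by (induction I rule: infinite_finite_induct) (auto simp: leval_add)

lemma leval_mult:
  assumes "z \<noteq> 0"
  shows "leval (p * q) z = leval p z * leval q z"
proof (induction p rule: laurent_induct)
  case (add p a n)
  have "leval (lmonom a n * q) z = a * z powi n * leval q z"
  proof (induction q rule: laurent_induct)
    case (add q b m)
    then show ?case
      by (simp add: distrib_left leval_add leval_lmonom mult_single power_int_add assms)
  qed simp
  with add show ?case by (simp add: distrib_right leval_add leval_lmonom)
qed simp

text \<open>A power of z clears the negative exponents, and a nonzero polynomial has only finitely
  many roots. Paraunitarity and filter symmetry are stated pointwise in z; this turns them into
  identities of coefficients.\<close>

lemma leval_eq_0_imp:
  assumes "\<And>z. z \<noteq> 0 \<Longrightarrow> leval p z = 0"
  shows "p = 0"
proof -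
  define K where "K = Poly_Mapping.keys p"
  obtain n :: int where n: "\<And>k. k \<in> K \<Longrightarrow> - n \<le> k"
  proof (cases "K = {}")
    case False
    have "- (- Min K) \<le> k" if "k \<in> K" for k
      using that by (simp add: K_def)
    then show ?thesis using that by blast
  qed (use that in auto)
  define q where "q = (\<Sum>k\<in>K. Polynomial.monom (cf p k) (nat (k + n)))"
  have q: "poly q z = z powi n * leval p z" if "z \<noteq> 0" for z
  proof -
    have "cf p k * z ^ nat (k + n) = z powi n * (cf p k * z powi k)" if "k \<in> K" for k
    proof -
      have "z ^ nat (k + n) = z powi (k + n)"
        using n[OF that] by (simp add: power_int_def)
      then show ?thesis using \<open>z \<noteq> 0\<close> by (simp add: power_int_add)
    qed
    then show ?thesis
      unfolding q_def poly_sum poly_monom leval_def K_def[symmetric] sum_distrib_left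
      by (rule sum.cong[OF refl])
  qed
  have "- {0} \<subseteq> {z. poly q z = 0}" using q assms by auto
  moreover have "infinite (- {0 :: complex})"
    by (simp add: infinite_UNIV_char_0 Compl_eq_Diff_UNIV)
  ultimately have "q = 0" using poly_roots_finite finite_subset by blast
  have "cf p m = 0" for m
  proof (rule ccontr)
    assume m: "cf p m \<noteq> 0"
    then have mK: "m \<in> K" by (simp add: K_def in_keys_iff)
    have "coeff q (nat (m + n)) = (\<Sum>k\<in>K. if k = m then cf p k else 0)"
      unfolding q_def coeff_sum coeff_monom
    proof (rule sum.cong)
      fix k assume "k \<in> K"
      then have "nat (k + n) = nat (m + n) \<longleftrightarrow> k = m"
        using n[of k] n[OF mK] by auto
      then show "(if nat (k + n) = nat (m + n) then cf p k else 0) = (if k = m then cf p k else 0)"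
        by simp
    qed simp
    also have "\<dots> = cf p m" using mK by (simp add: K_def)
    finally show False using \<open>q = 0\<close> m by simp
  qed
  then show ?thesis by (simp add: poly_mapping_eqI)
qed

lemma leval_eqI:
  assumes "\<And>z. z \<noteq> 0 \<Longrightarrow> leval p z = leval q z"
  shows "p = q"
proof -
  \<comment> \<open>The difference is written with a factor -1 so that the rules for values of sums
    and products apply.\<close>
  have "leval (p + lmonom (-1) 0 * q) z = 0" if "z \<noteq> 0" for z
    using assms[OF that] by (simp add: leval_add leval_mult that leval_lmonom)
  from leval_eq_0_imp[OF this] show ?thesis
    by (simp add: single_uminus)
qed

lemma lstar_0 [simp]: "lstar 0 = 0"
  by (rule poly_mapping_eqI) (simp add: lookup_lstar)

lemma lstar_lmonom: "lstar (lmonom a n) = lmonom (cnj a) (- n)"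
  by (rule poly_mapping_eqI) (auto simp: lookup_lstar lookup_single when_def)

lemma lstar_1 [simp]: "lstar 1 = 1"
  using lstar_lmonom[where a = 1 and n = 0] by simp

lemma lstar_add: "lstar (p + q) = lstar p + lstar q"
  by (rule poly_mapping_eqI) (simp add: lookup_lstar lookup_add)

lemma lstar_sum: "lstar (\<Sum>i\<in>I. f i) = (\<Sum>i\<in>I. lstar (f i))"
  by (induction I rule: infinite_finite_induct) (auto simp: lstar_add)

lemma lstar_lstar [simp]: "lstar (lstar p) = p"
  by (rule poly_mapping_eqI) (simp add: lookup_lstar)

lemma lstar_mult: "lstar (p * q) = lstar p * lstar q"
proof (induction p rule: laurent_induct)
  case (add p a n)
  have "lstar (lmonom a n * q) = lmonom (cnj a) (- n) * lstar q"
    by (rule poly_mapping_eqI) (simp add: lookup_lstar cf_lmonom_mult)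
  with add show ?case by (simp add: distrib_right lstar_add lstar_lmonom)
qed simp

lemma cf_mult_reflect:
  assumes "\<And>k. cf p (c - k) = x * cf p k" "\<And>k. cf q (c' - k) = y * cf q k"
  shows "cf (p * q) (c + c' - m) = x * y * cf (p * q) m"
proof -
  \<comment> \<open>The exponents of p are closed up under the reflection, so that reindexing by it
    is a bijection even for x = 0.\<close>
  define K where "K = Poly_Mapping.keys p \<union> (\<lambda>k. c - k) ` Poly_Mapping.keys p"
  have K: "finite K" "Poly_Mapping.keys p \<subseteq> K" by (auto simp: K_def)
  have "bij_betw (\<lambda>k. c - k) K K"
    by (rule bij_betwI[where g = "\<lambda>k. c - k"]) (auto simp: K_def)
  then have "cf (p * q) (c + c' - m) = (\<Sum>k\<in>K. cf p (c - k) * cf q (c + c' - m - (c - k)))"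
    using cf_mult[OF K, of q "c + c' - m"] sum.reindex_bij_betw[of "\<lambda>k. c - k" K K "\<lambda>k. cf p k * cf q (c + c' - m - k)"]
    by simp
  also have "\<dots> = (\<Sum>k\<in>K. x * y * (cf p k * cf q (m - k)))"
  proof (rule sum.cong)
    fix k
    have "c + c' - m - (c - k) = c' - (m - k)" by simp
    then show "cf p (c - k) * cf q (c + c' - m - (c - k)) = x * y * (cf p k * cf q (m - k))"
      by (simp only: assms mult_ac)
  qed simp
  also have "\<dots> = x * y * cf (p * q) m"
    by (simp add: cf_mult[OF K] sum_distrib_left)
  finally show ?thesis .
qed

subsection \<open>Matrices\<close>

lemma mstar_carrier [simp]: "A \<in> carrier_mat n m \<Longrightarrow> mstar A \<in> carrier_mat m n"
  by (auto simp: mstar_def)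

lemma dim_mstar [simp]: "dim_row (mstar A) = dim_col A" "dim_col (mstar A) = dim_row A"
  by (auto simp: mstar_def)

lemma mstar_index [simp]: "i < dim_col A \<Longrightarrow> j < dim_row A \<Longrightarrow> mstar A $$ (i, j) = lstar (A $$ (j, i))"
  by (simp add: mstar_def)

lemma mstar_mstar [simp]: "mstar (mstar A) = A"
  by (rule eq_matI) auto

lemma mat_mult_index:
  "i < dim_row A \<Longrightarrow> j < dim_col B \<Longrightarrow> dim_row B = n \<Longrightarrow> dim_col A = n \<Longrightarrow>
    (A * B) $$ (i, j) = (\<Sum>l<n. A $$ (i, l) * B $$ (l, j))"
  by (simp add: scalar_prod_def lessThan_atLeast0)

lemma mstar_mult:
  assumes "A \<in> carrier_mat n m" "B \<in> carrier_mat m k"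
  shows "mstar (A * B) = mstar B * mstar A"
proof (rule eq_matI)
  fix i j assume "i < dim_row (mstar B * mstar A)" "j < dim_col (mstar B * mstar A)"
  then show "mstar (A * B) $$ (i, j) = (mstar B * mstar A) $$ (i, j)"
    using assms by (simp add: mat_mult_index[of _ _ _ _ m] lstar_sum lstar_mult mult.commute del: index_mult_mat(1))
qed (use assms in auto)

lemma mstar_one [simp]: "mstar (1\<^sub>m n) = 1\<^sub>m n"
  by (rule eq_matI) (auto simp: one_mat_def)

lemma meval_carrier [simp]: "A \<in> carrier_mat n m \<Longrightarrow> meval A z \<in> carrier_mat n m"
  by (auto simp: meval_def)

lemma meval_index [simp]: "i < dim_row A \<Longrightarrow> j < dim_col A \<Longrightarrow> meval A z $$ (i, j) = leval (A $$ (i, j)) z"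
  by (simp add: meval_def)

lemma dim_meval [simp]: "dim_row (meval A z) = dim_row A" "dim_col (meval A z) = dim_col A"
  by (auto simp: meval_def)

lemma meval_mult:
  assumes "A \<in> carrier_mat n m" "B \<in> carrier_mat m k" "z \<noteq> 0"
  shows "meval (A * B) z = meval A z * meval B z"
proof (rule eq_matI)
  fix i j assume "i < dim_row (meval A z * meval B z)" "j < dim_col (meval A z * meval B z)"
  then show "meval (A * B) z $$ (i, j) = (meval A z * meval B z) $$ (i, j)"
    using assms by (simp add: mat_mult_index[of _ _ _ _ m] leval_sum leval_mult del: index_mult_mat(1))
qed (use assms in auto)

lemma meval_one [simp]: "meval (1\<^sub>m n) z = 1\<^sub>m n"
  by (rule eq_matI) (auto simp: one_mat_def)

lemma meval_eqI:
  assumes "A \<in> carrier_mat n m" "B \<in> carrier_mat n m" "\<And>z. z \<noteq> 0 \<Longrightarrow> meval A z = meval B z"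
  shows "A = B"
proof (rule eq_matI)
  fix i j assume "i < dim_row B" "j < dim_col B"
  then show "A $$ (i, j) = B $$ (i, j)"
    using assms by (intro leval_eqI) (metis carrier_matD meval_index)
qed (use assms in auto)

text \<open>Moves paraunitarity from points of evaluation into the ring of Laurent polynomials,
  where the later computations take place.\<close>

lemma paraunitary_iff:
  "paraunitary n A \<longleftrightarrow> A \<in> carrier_mat n n \<and> A * mstar A = 1\<^sub>m n"
proof
  assume *: "paraunitary n A"
  then have A: "A \<in> carrier_mat n n" by (simp add: paraunitary_def)
  have "A * mstar A = 1\<^sub>m n"
    by (rule meval_eqI[of _ n n]) (use * A in \<open>auto simp: paraunitary_def meval_mult[of _ n n _ n]\<close>)
  with A show "A \<in> carrier_mat n n \<and> A * mstar A = 1\<^sub>m n" by simp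
next
  assume *: "A \<in> carrier_mat n n \<and> A * mstar A = 1\<^sub>m n"
  have "meval A z * meval (mstar A) z = 1\<^sub>m n" if "z \<noteq> 0" for z
    using * that meval_mult[of A n n "mstar A" n z] by simp
  with * show "paraunitary n A" by (simp add: paraunitary_def)
qed

lemma paraunitary_carrier: "paraunitary n A \<Longrightarrow> A \<in> carrier_mat n n"
  by (simp add: paraunitary_def)

text \<open>Over a field a one-sided inverse of a square matrix is two-sided; evaluation at each z
  reduces the claim to complex matrices.\<close>

lemma paraunitary_left:
  assumes "paraunitary n A"
  shows "mstar A * A = 1\<^sub>m n"
proof (rule meval_eqI[of _ n n])
  have A: "A \<in> carrier_mat n n" using assms by (simp add: paraunitary_def)
  then show "mstar A * A \<in> carrier_mat n n" by (intro mult_carrier_mat mstar_carrier)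
  fix z :: complex assume "z \<noteq> 0"
  with assms have "meval A z * meval (mstar A) z = 1\<^sub>m n" by (simp add: paraunitary_def)
  then have "meval (mstar A) z * meval A z = 1\<^sub>m n"
    using mat_mult_left_right_inverse[of "meval A z" n "meval (mstar A) z"] A by simp
  then show "meval (mstar A * A) z = meval (1\<^sub>m n) z"
    using A \<open>z \<noteq> 0\<close> by (simp add: meval_mult[of _ n n _ n])
qed simp

lemma paraunitary_mstar: "paraunitary n A \<Longrightarrow> paraunitary n (mstar A)"
  using paraunitary_left[of n A] by (simp add: paraunitary_iff)

lemma orthonormal_rows_mult:
  assumes "Q \<in> carrier_mat r n" "Q * mstar Q = 1\<^sub>m r" "paraunitary n A"
  shows "(Q * A) * mstar (Q * A) = 1\<^sub>m r"
proof -
  have A: "A \<in> carrier_mat n n" "A * mstar A = 1\<^sub>m n" using assms(3) by (auto simp: paraunitary_iff)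
  have "(Q * A) * mstar (Q * A) = Q * (A * (mstar A * mstar Q))"
    using assoc_mult_mat[OF assms(1) A(1) mult_carrier_mat[OF mstar_carrier[OF A(1)] mstar_carrier[OF assms(1)]]]
    by (simp add: mstar_mult[OF assms(1) A(1)])
  also have "A * (mstar A * mstar Q) = (A * mstar A) * mstar Q"
    using assms(1) A(1) by (subst assoc_mult_mat[of _ n n _ n _ r]) auto
  also have "\<dots> = mstar Q" using assms(1) A(2) by (simp add: left_mult_one_mat[of _ n r])
  finally show ?thesis using assms(2) by simp
qed

lemma paraunitary_mult:
  assumes "paraunitary n A" "paraunitary n B"
  shows "paraunitary n (A * B)"
  using assms orthonormal_rows_mult[of A n n B] by (auto simp: paraunitary_iff)

lemma paraunitary_one: "paraunitary n (1\<^sub>m n)"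
  by (simp add: paraunitary_iff)

lemma mult_mstar_cancel:
  assumes "Q \<in> carrier_mat r n" "paraunitary n A"
  shows "Q * A * mstar A = Q"
  using assms by (auto simp: paraunitary_iff assoc_mult_mat[of _ r n _ n _ n])

text \<open>The estimates for degree, parity and constancy of products start from this splitting of
  an exponent.\<close>

lemma mat_mult_cf_nonzero:
  assumes "i < dim_row A" "j < dim_col B" "dim_row B = n" "dim_col A = n"
    and "cf ((A * B) $$ (i, j)) t \<noteq> 0"
  obtains l t1 t2 where "l < n" "t = t1 + t2" "cf (A $$ (i, l)) t1 \<noteq> 0" "cf (B $$ (l, j)) t2 \<noteq> 0"
proof -
  have "\<exists>l\<in>{..<n}. cf (A $$ (i, l) * B $$ (l, j)) t \<noteq> 0"
    using assms(5) unfolding mat_mult_index[OF assms(1-4)] lookup_sum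
    by (meson sum.neutral)
  then show ?thesis using that by (metis cf_mult_nonzero lessThan_iff)
qed

subsection \<open>Coefficients in a subfield\<close>

locale conj_sqrt_field =
  fixes F :: "complex set"
  assumes subfield: "is_complex_subfield F"
    and cnj_closed: "\<forall>x\<in>F. cnj x \<in> F"
    and sqrt_closed: "\<forall>y::real. y > 0 \<and> complex_of_real y \<in> F \<longrightarrow> complex_of_real (sqrt y) \<in> F"
begin

lemma zero_closed [simp, intro]: "0 \<in> F" and one_closed [simp, intro]: "1 \<in> F"
  and add_closed [intro]: "x \<in> F \<Longrightarrow> y \<in> F \<Longrightarrow> x + y \<in> F"
  and diff_closed [intro]: "x \<in> F \<Longrightarrow> y \<in> F \<Longrightarrow> x - y \<in> F"
  and mult_closed [intro]: "x \<in> F \<Longrightarrow> y \<in> F \<Longrightarrow> x * y \<in> F"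
  and inverse_closed [intro]: "x \<in> F \<Longrightarrow> inverse x \<in> F"
  using subfield by (auto simp: is_complex_subfield_def)

lemma divide_closed [intro]: "x \<in> F \<Longrightarrow> y \<in> F \<Longrightarrow> x / y \<in> F"
  by (simp add: divide_inverse inverse_closed mult_closed)

lemma uminus_closed [intro]: "x \<in> F \<Longrightarrow> - x \<in> F"
  using diff_closed[of 0 x] by simp

lemma of_nat_closed [intro]: "of_nat n \<in> F"
  by (induction n) (auto intro: add_closed)

lemma sqrt_of_nat_closed: "complex_of_real (sqrt (real n)) \<in> F"
  using sqrt_closed[rule_format, of "real n"] of_nat_closed[of n] by (cases "n = 0") auto

lemma sum_closed: "(\<And>i. i \<in> I \<Longrightarrow> f i \<in> F) \<Longrightarrow> sum f I \<in> F"
  by (induction I rule: infinite_finite_induct) (auto intro: add_closed)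

lemma cf_mult_closed: "(\<And>k. cf p k \<in> F) \<Longrightarrow> (\<And>k. cf q k \<in> F) \<Longrightarrow> cf (p * q) k \<in> F"
  by (subst cf_mult[OF finite_keys order_refl]) (auto intro!: sum_closed)

lemma coeffs_in_mult:
  assumes "coeffs_in F A" "coeffs_in F B" "A \<in> carrier_mat n m" "B \<in> carrier_mat m k"
  shows "coeffs_in F (A * B)"
  unfolding coeffs_in_def
proof (intro allI impI)
  fix i j t assume ij: "i < dim_row (A * B)" "j < dim_col (A * B)"
  have "cf (A $$ (i, l) * B $$ (l, j)) t \<in> F" if "l < m" for l
    by (rule cf_mult_closed) (use assms ij that in \<open>auto simp: coeffs_in_def\<close>)
  then show "cf ((A * B) $$ (i, j)) t \<in> F"
    using assms ij by (simp add: mat_mult_index[of _ _ _ _ m] lookup_sum del: index_mult_mat(1))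
      (auto intro: sum_closed)
qed

lemma coeffs_in_mstar: "coeffs_in F A \<Longrightarrow> coeffs_in F (mstar A)"
  using cnj_closed by (auto simp: coeffs_in_def lookup_lstar)

lemma coeffs_in_one: "coeffs_in F (1\<^sub>m n)"
  by (auto simp: coeffs_in_def one_mat_def lookup_one when_def)

end

section \<open>Leading coefficients and constant unitary matrices\<close>

lemma cf_mult_top:
  assumes "\<And>t. cf p t \<noteq> 0 \<Longrightarrow> t \<le> D" "\<And>t. cf q t \<noteq> 0 \<Longrightarrow> t \<le> E"
  shows "cf (p * q) (D + E) = cf p D * cf q E"
proof -
  have "cf p k * cf q (D + E - k) = (if k = D then cf p D * cf q E else 0)" for k
    using assms(1)[of k] assms(2)[of "D + E - k"] by force
  then show ?thesis
    by (subst cf_mult[of "insert D (Poly_Mapping.keys p)"]) auto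
qed

text \<open>The matrix is \<open>I - w w\<^sup>* / \<tau>\<close> with \<open>w = e\<^sub>p - a\<close> and \<open>\<tau> = w\<^sup>* e\<^sub>p\<close> for a unit vector \<open>a\<close>; unlike the
  Hermitian reflection it maps \<open>e\<^sub>p\<close> to \<open>a\<close> without a phase factor. If \<open>\<tau> = 0\<close> then \<open>a = e\<^sub>p\<close>, and
  \<open>x / 0 = 0\<close> gives the identity.\<close>

lemma (in conj_sqrt_field) householder:
  fixes x :: "nat \<Rightarrow> complex"
  assumes C: "C \<subseteq> {..<s}" "p \<in> C" and xF: "\<And>j. j \<in> C \<Longrightarrow> x j \<in> F"
    and N: "N = (\<Sum>j\<in>C. (cmod (x j))\<^sup>2)" "N > 0"
  obtains h where
    "\<And>i j. i < s \<Longrightarrow> j < s \<Longrightarrow> (\<Sum>l<s. h i l * cnj (h j l)) = (if i = j then 1 else 0)"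
    "\<And>i j. h i j \<in> F"
    "\<And>i j. i \<notin> C \<or> j \<notin> C \<Longrightarrow> h i j = (if i = j then 1 else 0)"
    "\<And>j. j < s \<Longrightarrow> (\<Sum>i<s. x i * h i j) = (if j = p then complex_of_real (sqrt N) else if j \<in> C then 0 else x j)"
proof -
  define \<nu> where "\<nu> = complex_of_real (sqrt N)"
  have fin: "finite C" using C finite_subset by blast
  have CI: "{..<s} \<inter> C = C" and ps: "p < s" using C by auto
  have \<nu>: "\<nu> \<noteq> 0" "cnj \<nu> = \<nu>" "\<nu> * \<nu> = complex_of_real N"
    using N by (auto simp: \<nu>_def simp flip: of_real_mult)
  have NC: "complex_of_real N = (\<Sum>j\<in>C. x j * cnj (x j))"
    unfolding N(1) of_real_sum by (simp only: complex_norm_square)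
  have "complex_of_real N \<in> F"
    unfolding NC using xF cnj_closed by (intro sum_closed) auto
  then have \<nu>F: "\<nu> \<in> F" using sqrt_closed N(2) by (simp add: \<nu>_def)
  \<comment> \<open>\<open>h\<close> multiplies the row vector x from the right, so its column p has
    to be the normalized conjugate of x.\<close>
  define a where "a j = (if j \<in> C then cnj (x j) / \<nu> else 0)" for j
  define w where "w j = (if j = p then 1 else 0) - a j" for j
  define \<tau> where "\<tau> = cnj (w p)"
  define h where "h i j = (if i = j then 1 else 0) - w i * cnj (w j) / \<tau>" for i j
  have aF: "a j \<in> F" for j using xF \<nu>F cnj_closed by (auto simp: a_def)
  have wF: "w j \<in> F" for j using aF by (auto simp: w_def)
  have wC: "w j = 0" if "j \<notin> C" for j using that C by (auto simp: w_def a_def)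
  have "(\<Sum>l<s. cnj (a l) * a l) = (\<Sum>l\<in>C. (x l * cnj (x l)) / (\<nu> * \<nu>))"
    by (subst sum.mono_neutral_cong_right[of "{..<s}" C]) (use C \<nu> in \<open>auto simp: a_def\<close>)
  also have "\<dots> = 1" using \<nu> N(2) by (simp add: NC[symmetric] sum_divide_distrib[symmetric])
  finally have a1: "(\<Sum>l<s. cnj (a l) * a l) = 1" .
  \<comment> \<open>As \<open>a\<close> is a unit vector, the squared norm of w is twice the real
    part of \<tau>; this identity makes the matrix unitary although \<tau> is complex.\<close>
  have "(\<Sum>l<s. cnj (w l) * w l) = (\<Sum>l<s. cnj (a l) * a l + (if l = p then 1 - a p - cnj (a p) else 0))"
    by (rule sum.cong) (auto simp: w_def algebra_simps)
  also have "\<dots> = \<tau> + cnj \<tau>"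
    using ps by (simp add: sum.distrib a1 \<tau>_def w_def)
  finally have ww: "(\<Sum>l<s. cnj (w l) * w l) = \<tau> + cnj \<tau>" .
  have unit: "(\<Sum>l<s. h i l * cnj (h j l)) = (if i = j then 1 else 0)" if "i < s" "j < s" for i j
  proof (cases "\<tau> = 0")
    case False
    have "h i l * cnj (h j l) = (if l = i then (if i = j then 1 else 0) else 0)
        - (if l = i then w i * cnj (w j) / cnj \<tau> else 0) - (if l = j then w i * cnj (w j) / \<tau> else 0)
        + w i * cnj (w j) / (\<tau> * cnj \<tau>) * (cnj (w l) * w l)" for l
      by (auto simp: h_def algebra_simps)
    then have "(\<Sum>l<s. h i l * cnj (h j l)) = (if i = j then 1 else 0)
        - w i * cnj (w j) / cnj \<tau> - w i * cnj (w j) / \<tau>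
        + w i * cnj (w j) / (\<tau> * cnj \<tau>) * (\<tau> + cnj \<tau>)"
      using that by (simp add: sum.distrib sum_subtractf sum_distrib_left[symmetric] sum_divide_distrib[symmetric] ww)
    also have "\<dots> = (if i = j then 1 else 0)"
      using False by (simp add: divide_simps algebra_simps)
    finally show ?thesis .
  qed (use that in \<open>simp add: h_def if_distrib[of cnj] if_distrib[of "\<lambda>x. _ * x"] cong: if_cong\<close>)
  have xw: "(\<Sum>i<s. x i * w i) = - \<nu> * \<tau>"
  proof -
    have "(\<Sum>i<s. x i * w i) = (\<Sum>i\<in>C. x i * w i)"
      by (rule sum.mono_neutral_right) (use C wC in auto)
    also have "\<dots> = (\<Sum>i\<in>C. (if i = p then x p else 0) - x i * cnj (x i) / \<nu>)"
      by (rule sum.cong) (auto simp: w_def a_def algebra_simps)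
    also have "\<dots> = x p - \<nu>"
    proof -
      have "(\<Sum>i\<in>C. x i * cnj (x i) / \<nu>) = \<nu>"
        using \<nu> by (simp add: NC[symmetric] sum_divide_distrib[symmetric] divide_eq_eq)
      then show ?thesis using C fin by (simp add: sum_subtractf)
    qed
    also have "x p - \<nu> = - \<nu> * \<tau>" using C \<nu> by (simp add: \<tau>_def w_def a_def field_simps)
    finally show ?thesis .
  qed
  have xh: "(\<Sum>i<s. x i * h i j) = (if j = p then \<nu> else if j \<in> C then 0 else x j)" if "j < s" for j
  proof (cases "\<tau> = 0")
    case False
    have "(\<Sum>i<s. x i * h i j) = (\<Sum>i<s. (if i = j then x j else 0) - x i * w i * (cnj (w j) / \<tau>))"
      by (rule sum.cong) (auto simp: h_def algebra_simps)
    also have "\<dots> = x j + \<nu> * cnj (w j)"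
    proof -
      have "(\<Sum>i<s. x i * w i * (cnj (w j) / \<tau>)) = - \<nu> * \<tau> * (cnj (w j) / \<tau>)"
        by (simp only: sum_distrib_right[symmetric] xw)
      then show ?thesis using that False by (simp add: sum_subtractf)
    qed
    finally show ?thesis using \<nu> C by (auto simp: w_def a_def field_simps)
  next
    \<comment> \<open>Here \<open>a p = 1\<close>, so \<open>x p\<close> carries the whole norm and
      x is already concentrated at p within \<open>C\<close>.\<close>
    case True
    then have xp: "x p = \<nu>" using C \<nu> by (auto simp: \<tau>_def w_def a_def field_simps)
    have "N = (cmod (x p))\<^sup>2 + (\<Sum>j\<in>C - {p}. (cmod (x j))\<^sup>2)"
      unfolding N(1) using C fin by (simp add: sum.remove)
    moreover have "(cmod (x p))\<^sup>2 = N" using N(2) by (simp add: xp \<nu>_def)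
    ultimately have "\<forall>j\<in>C - {p}. (cmod (x j))\<^sup>2 = 0"
      using fin by (subst sum_nonneg_eq_0_iff[symmetric]) auto
    then have "x j = 0" if "j \<in> C" "j \<noteq> p" for j using that by auto
    then show ?thesis using True that xp by (auto simp: h_def if_distrib[of "\<lambda>u. _ * u"] cong: if_cong)
  qed
  show thesis
  proof (rule that[of h])
    show "h i j \<in> F" for i j
      using wF cnj_closed by (auto simp: h_def \<tau>_def intro!: diff_closed mult_closed divide_closed)
    show "h i j = (if i = j then 1 else 0)" if "i \<notin> C \<or> j \<notin> C" for i j
      using that wC by (auto simp: h_def)
  qed (use unit xh in \<open>auto simp: \<nu>_def\<close>)
qed

lemma lmonom_sum: "lmonom (\<Sum>i\<in>I. f i) n = (\<Sum>i\<in>I. lmonom (f i) n)"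
  by (rule poly_mapping_eqI) (simp add: lookup_sum lookup_single when_def)

definition const_mat :: "nat \<Rightarrow> (nat \<Rightarrow> nat \<Rightarrow> complex) \<Rightarrow> laurent mat" where
  "const_mat s h = Matrix.mat s s (\<lambda>(i, j). lmonom (h i j) 0)"

lemma const_mat_carrier [simp]: "const_mat s h \<in> carrier_mat s s"
  and dim_const_mat [simp]: "dim_row (const_mat s h) = s" "dim_col (const_mat s h) = s"
  by (auto simp: const_mat_def)

lemma cf_const_mat: "i < s \<Longrightarrow> j < s \<Longrightarrow> cf (const_mat s h $$ (i, j)) t = (if t = 0 then h i j else 0)"
  by (simp add: const_mat_def lookup_single when_def)

lemma cf_mult_const_mat:
  assumes "Q \<in> carrier_mat r s" "i < r" "j < s"
  shows "cf ((Q * const_mat s h) $$ (i, j)) t = (\<Sum>l<s. cf (Q $$ (i, l)) t * h l j)"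
  using assms by (simp add: mat_mult_index[of _ _ _ _ s] lookup_sum const_mat_def cf_mult_lmonom del: index_mult_mat(1))

lemma paraunitary_const_mat:
  assumes "\<And>i j. i < s \<Longrightarrow> j < s \<Longrightarrow> (\<Sum>l<s. h i l * cnj (h j l)) = (if i = j then 1 else 0)"
  shows "paraunitary s (const_mat s h)"
  unfolding paraunitary_iff
proof (intro conjI eq_matI)
  fix i j assume "i < dim_row (1\<^sub>m s :: laurent mat)" "j < dim_col (1\<^sub>m s :: laurent mat)"
  then show "(const_mat s h * mstar (const_mat s h)) $$ (i, j) = 1\<^sub>m s $$ (i, j)"
    using assms[of i j]
    by (auto simp: mat_mult_index[of _ _ _ _ s] const_mat_def lstar_lmonom mult_single lmonom_sum[symmetric]
        one_mat_def simp del: index_mult_mat(1) mstar_carrier)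
qed auto

text \<open>Entries are even or odd under w \<mapsto> 1/w and contain exponents of one parity only.
  In both conditions the middle labels of a product cancel, so they are stable under
  multiplication.\<close>

definition graded :: "(nat \<Rightarrow> complex) \<Rightarrow> (nat \<Rightarrow> bool) \<Rightarrow> (nat \<Rightarrow> complex) \<Rightarrow> (nat \<Rightarrow> bool) \<Rightarrow> laurent mat \<Rightarrow> bool" where
  "graded \<epsilon> a \<delta> b X \<longleftrightarrow> (\<forall>i<dim_row X. \<forall>j<dim_col X. \<forall>t.
     cf (X $$ (i, j)) (- t) = \<epsilon> i * \<delta> j * cf (X $$ (i, j)) t \<and>
     (cf (X $$ (i, j)) t \<noteq> 0 \<longrightarrow> (odd t \<longleftrightarrow> a i \<noteq> b j)))"

lemma gradedD:
  assumes "graded \<epsilon> a \<delta> b X" "X \<in> carrier_mat n m" "i < n" "j < m"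
  shows "cf (X $$ (i, j)) (- t) = \<epsilon> i * \<delta> j * cf (X $$ (i, j)) t"
    and "cf (X $$ (i, j)) t \<noteq> 0 \<Longrightarrow> odd t \<longleftrightarrow> a i \<noteq> b j"
  using assms by (auto simp: graded_def)

lemma graded_mult:
  assumes X: "graded \<epsilon> a \<delta> b X" "X \<in> carrier_mat n m" and Y: "graded \<delta> b \<eta> c Y" "Y \<in> carrier_mat m k"
    and \<delta>: "\<forall>l<m. \<delta> l \<in> {1, -1}"
  shows "graded \<epsilon> a \<eta> c (X * Y)"
  unfolding graded_def
proof (intro allI impI conjI)
  fix i j t assume "i < dim_row (X * Y)" "j < dim_col (X * Y)"
  then have ij: "i < n" "j < k" and dims: "i < dim_row X" "j < dim_col Y" "dim_row Y = m" "dim_col X = m"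
    using X(2) Y(2) by auto
  have "cf (X $$ (i, l) * Y $$ (l, j)) (- t) = \<epsilon> i * \<eta> j * cf (X $$ (i, l) * Y $$ (l, j)) t" if "l < m" for l
  proof -
    have "cf (X $$ (i, l) * Y $$ (l, j)) (0 + 0 - t) =
        (\<epsilon> i * \<delta> l) * (\<delta> l * \<eta> j) * cf (X $$ (i, l) * Y $$ (l, j)) t"
      by (rule cf_mult_reflect)
        (use gradedD(1)[OF X ij(1) that] gradedD(1)[OF Y that ij(2)] in auto)
    moreover have "\<delta> l * \<delta> l = 1" using \<delta> that by auto
    then have "(\<epsilon> i * \<delta> l) * (\<delta> l * \<eta> j) = \<epsilon> i * \<eta> j"
      by (metis (no_types, lifting) mult.assoc mult.right_neutral)
    ultimately show ?thesis by simp
  qed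
  then show "cf ((X * Y) $$ (i, j)) (- t) = \<epsilon> i * \<eta> j * cf ((X * Y) $$ (i, j)) t"
    by (simp add: mat_mult_index[OF dims] lookup_sum sum_distrib_left del: index_mult_mat(1))
  assume "cf ((X * Y) $$ (i, j)) t \<noteq> 0"
  then obtain l t1 t2 where "l < m" "t = t1 + t2" "cf (X $$ (i, l)) t1 \<noteq> 0" "cf (Y $$ (l, j)) t2 \<noteq> 0"
    by (rule mat_mult_cf_nonzero[OF dims])
  then show "odd t \<longleftrightarrow> a i \<noteq> c j"
    using gradedD(2)[OF X ij(1)] gradedD(2)[OF Y _ ij(2)] by fastforce
qed

lemma graded_const_mat:
  assumes "\<And>i j. h i j \<noteq> 0 \<Longrightarrow> i < s \<Longrightarrow> j < s \<Longrightarrow> \<delta> i = \<delta> j \<and> b i = b j" "\<forall>l<s. \<delta> l \<in> {1, -1}"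
  shows "graded \<delta> b \<delta> b (const_mat s h)"
  unfolding graded_def
proof (intro allI impI conjI)
  fix i j and t :: int assume "i < dim_row (const_mat s h)" "j < dim_col (const_mat s h)"
  then have ij: "i < s" "j < s" by auto
  show "cf (const_mat s h $$ (i, j)) (- t) = \<delta> i * \<delta> j * cf (const_mat s h $$ (i, j)) t"
    using assms(1)[OF _ ij] assms(2) ij by (cases "h i j = 0") (auto simp: cf_const_mat)
  show "odd t \<longleftrightarrow> b i \<noteq> b j" if "cf (const_mat s h $$ (i, j)) t \<noteq> 0"
    using that assms(1)[OF _ ij] ij by (auto simp: cf_const_mat split: if_splits)
qed

subsection \<open>Lowering the degree of a row\<close>

text \<open>On columns p and m this is the matrix with eigenvectors e_p + e_m and e_p - e_m and
  eigenvalues 1/w and w. Its diagonal entries are even and its off-diagonal ones odd under w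
  \<mapsto> 1/w, as opposite signs of the two columns require.\<close>

definition mixing_mat :: "nat \<Rightarrow> nat \<Rightarrow> nat \<Rightarrow> laurent mat" where
  "mixing_mat s p m = Matrix.mat s s (\<lambda>(i, j).
     if i \<in> {p, m} \<and> j \<in> {p, m} then
       (if i = j then lmonom (1/2) 1 + lmonom (1/2) (-1) else lmonom (1/2) (-1) + lmonom (-1/2) 1)
     else if i = j then 1 else 0)"

lemma mixing_mat_carrier [simp]: "mixing_mat s p m \<in> carrier_mat s s"
  and dim_mixing_mat [simp]: "dim_row (mixing_mat s p m) = s" "dim_col (mixing_mat s p m) = s"
  by (auto simp: mixing_mat_def)

lemma sum_pair:
  fixes f :: "nat \<Rightarrow> 'a::comm_monoid_add"
  assumes "p < s" "m < s" "p \<noteq> m" "\<And>l. l < s \<Longrightarrow> l \<noteq> p \<Longrightarrow> l \<noteq> m \<Longrightarrow> f l = 0"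
  shows "(\<Sum>l<s. f l) = f p + f m"
proof -
  have "(\<Sum>l<s. f l) = (\<Sum>l\<in>{p, m}. f l)"
    by (rule sum.mono_neutral_right) (use assms in auto)
  then show ?thesis using assms by simp
qed

lemma cf_numeral_mult: "cf (numeral n * p) k = numeral n * cf p k"
  using cf_lmonom_mult[where a = "numeral n" and n = 0] by simp

lemma paraunitary_mixing_mat:
  assumes pm: "p < s" "m < s" "p \<noteq> m"
  shows "paraunitary s (mixing_mat s p m)"
  unfolding paraunitary_iff
proof (intro conjI eq_matI)
  fix i j assume "i < dim_row (1\<^sub>m s :: laurent mat)" "j < dim_col (1\<^sub>m s :: laurent mat)"
  then have ij: "i < s" "j < s" by auto
  let ?K = "\<lambda>i j. mixing_mat s p m $$ (i, j)"
  have "(mixing_mat s p m * mstar (mixing_mat s p m)) $$ (i, j) = (\<Sum>l<s. ?K i l * lstar (?K j l))"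
    using ij by (simp add: mat_mult_index[of _ _ _ _ s] del: index_mult_mat(1) mstar_carrier)
  also have "\<dots> = (if i = j then 1 else 0)"
  proof (cases "i \<in> {p, m}")
    case True
    then have "(\<Sum>l<s. ?K i l * lstar (?K j l)) = ?K i p * lstar (?K j p) + ?K i m * lstar (?K j m)"
      by (intro sum_pair pm) (use pm ij in \<open>auto simp: mixing_mat_def\<close>)
    also have "\<dots> = (if i = j then 1 else 0)"
      using True pm ij
      by (auto simp: mixing_mat_def lstar_add lstar_lmonom distrib_left distrib_right mult_single
          simp flip: single_one; intro poly_mapping_eqI; simp add: lookup_add lookup_single lookup_one when_def cf_numeral_mult)
    finally show ?thesis .
  next
    case False
    then have "(\<Sum>l<s. ?K i l * lstar (?K j l)) = (\<Sum>l<s. if l = i then (if i = j then 1 else 0) else 0)"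
      by (intro sum.cong) (use pm ij in \<open>auto simp: mixing_mat_def\<close>)
    then show ?thesis using ij by simp
  qed
  also have "\<dots> = 1\<^sub>m s $$ (i, j)" using ij by (simp add: one_mat_def)
  finally show "(mixing_mat s p m * mstar (mixing_mat s p m)) $$ (i, j) = 1\<^sub>m s $$ (i, j)" .
qed auto

lemma cf_mixing_mat:
  assumes "i < s" "j < s"
  shows "cf (mixing_mat s p m $$ (i, j)) t = (if i \<in> {p, m} \<and> j \<in> {p, m} then
     (if t = 1 then (if i = j then 1/2 else - 1/2) else if t = -1 then 1/2 else 0)
     else if i = j \<and> t = 0 then 1 else 0)"
  using assms by (auto simp: mixing_mat_def lookup_add lookup_single when_def lookup_one)

lemma cf_mult_mixing_mat:
  assumes "Q \<in> carrier_mat r s" "i < r" "j < s" "p < s" "m < s" "p \<noteq> m"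
  shows "cf ((Q * mixing_mat s p m) $$ (i, j)) t =
    (if j = p then (cf (Q $$ (i, p)) (t - 1) - cf (Q $$ (i, m)) (t - 1) + cf (Q $$ (i, p)) (t + 1) + cf (Q $$ (i, m)) (t + 1)) / 2
     else if j = m then (cf (Q $$ (i, m)) (t - 1) - cf (Q $$ (i, p)) (t - 1) + cf (Q $$ (i, p)) (t + 1) + cf (Q $$ (i, m)) (t + 1)) / 2
     else cf (Q $$ (i, j)) t)"
proof -
  let ?K = "\<lambda>i j. mixing_mat s p m $$ (i, j)"
  have "(Q * mixing_mat s p m) $$ (i, j) = (\<Sum>l<s. Q $$ (i, l) * ?K l j)"
    using assms by (simp add: mat_mult_index[of _ _ _ _ s] del: index_mult_mat(1))
  also have "\<dots> = (if j \<in> {p, m} then Q $$ (i, p) * ?K p j + Q $$ (i, m) * ?K m j else Q $$ (i, j))"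
  proof (cases "j \<in> {p, m}")
    case True
    then show ?thesis
      by (simp, intro sum_pair) (use assms in \<open>auto simp: mixing_mat_def\<close>)
  next
    case False
    then have "(\<Sum>l<s. Q $$ (i, l) * ?K l j) = (\<Sum>l<s. if l = j then Q $$ (i, j) else 0)"
      by (intro sum.cong) (use assms in \<open>auto simp: mixing_mat_def\<close>)
    then show ?thesis using False assms by simp
  qed
  finally have eq: "(Q * mixing_mat s p m) $$ (i, j) = (if j \<in> {p, m} then Q $$ (i, p) * ?K p j + Q $$ (i, m) * ?K m j else Q $$ (i, j))" .
  show ?thesis unfolding eq
    using assms by (auto simp: mixing_mat_def lookup_add distrib_left cf_mult_lmonom diff_divide_distrib add_divide_distrib)
qed

lemma cf_mstar_mixing_mat_mult:
  assumes "X \<in> carrier_mat s k" "i < s" "j < k" "p < s" "m < s" "p \<noteq> m"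
  shows "cf ((mstar (mixing_mat s p m) * X) $$ (i, j)) t =
    (if i = p then (cf (X $$ (p, j)) (t - 1) + cf (X $$ (m, j)) (t - 1) + cf (X $$ (p, j)) (t + 1) - cf (X $$ (m, j)) (t + 1)) / 2
     else if i = m then (cf (X $$ (p, j)) (t - 1) + cf (X $$ (m, j)) (t - 1) - cf (X $$ (p, j)) (t + 1) + cf (X $$ (m, j)) (t + 1)) / 2
     else cf (X $$ (i, j)) t)"
proof -
  let ?K = "\<lambda>i j. lstar (mixing_mat s p m $$ (j, i))"
  have "(mstar (mixing_mat s p m) * X) $$ (i, j) = (\<Sum>l<s. ?K i l * X $$ (l, j))"
    using assms by (simp add: mat_mult_index[of _ _ _ _ s] del: index_mult_mat(1) mstar_carrier)
  also have "\<dots> = (if i \<in> {p, m} then ?K i p * X $$ (p, j) + ?K i m * X $$ (m, j) else X $$ (i, j))"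
  proof (cases "i \<in> {p, m}")
    case True
    then show ?thesis
      by (simp, intro sum_pair) (use assms in \<open>auto simp: mixing_mat_def\<close>)
  next
    case False
    then have "(\<Sum>l<s. ?K i l * X $$ (l, j)) = (\<Sum>l<s. if l = i then X $$ (i, j) else 0)"
      by (intro sum.cong) (use assms in \<open>auto simp: mixing_mat_def\<close>)
    then show ?thesis using False assms by simp
  qed
  finally have eq: "(mstar (mixing_mat s p m) * X) $$ (i, j) = (if i \<in> {p, m} then ?K i p * X $$ (p, j) + ?K i m * X $$ (m, j) else X $$ (i, j))" .
  show ?thesis unfolding eq
    using assms by (auto simp: mixing_mat_def lookup_add distrib_right lstar_add lstar_lmonom cf_lmonom_mult diff_divide_distrib add_divide_distrib)
qed

text \<open>Only an upper bound, because the invariant is stated for arbitrary columns, which carry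
  no symmetry. The lower bound for the extension follows at the end from its own symmetry.\<close>

definition bounded_by :: "int \<Rightarrow> laurent mat \<Rightarrow> bool" where
  "bounded_by \<sigma> X \<longleftrightarrow> (\<forall>i<dim_row X. \<forall>j<dim_col X. \<forall>t. cf (X $$ (i, j)) t \<noteq> 0 \<longrightarrow> t \<le> \<sigma>)"

lemma bounded_byD: "bounded_by \<sigma> X \<Longrightarrow> X \<in> carrier_mat n m \<Longrightarrow> i < n \<Longrightarrow> j < m \<Longrightarrow> cf (X $$ (i, j)) t \<noteq> 0 \<Longrightarrow> t \<le> \<sigma>"
  by (auto simp: bounded_by_def)

lemma bounded_by_mult:
  assumes "bounded_by \<sigma> X" "bounded_by \<tau> Y" "X \<in> carrier_mat n m" "Y \<in> carrier_mat m k"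
  shows "bounded_by (\<sigma> + \<tau>) (X * Y)"
  unfolding bounded_by_def
proof (intro allI impI)
  fix i j t assume ij: "i < dim_row (X * Y)" "j < dim_col (X * Y)" and nz: "cf ((X * Y) $$ (i, j)) t \<noteq> 0"
  have dims: "i < dim_row X" "j < dim_col Y" "dim_row Y = m" "dim_col X = m" using assms ij by auto
  obtain l t1 t2 where "l < m" "t = t1 + t2" "cf (X $$ (i, l)) t1 \<noteq> 0" "cf (Y $$ (l, j)) t2 \<noteq> 0"
    using mat_mult_cf_nonzero[OF dims nz] by metis
  then show "t \<le> \<sigma> + \<tau>"
    using assms(1,2) dims by (auto simp: bounded_by_def intro!: add_mono)
qed

definition top_preserving :: "nat \<Rightarrow> laurent mat \<Rightarrow> laurent mat \<Rightarrow> bool" where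
  "top_preserving s Q A \<longleftrightarrow> (\<forall>X \<sigma>. X \<in> carrier_mat s 1 \<longrightarrow> bounded_by \<sigma> X \<longrightarrow> bounded_by \<sigma> (Q * X) \<longrightarrow>
     bounded_by \<sigma> (mstar A * X))"

lemma top_preserving_one: "top_preserving s Q (1\<^sub>m s)"
  by (simp add: top_preserving_def)

text \<open>The hypothesis on the product with Q passes to the next factor unchanged, since
  \<open>Q * A * (mstar A * X) = Q * X\<close>.\<close>

lemma top_preserving_mult:
  assumes A: "paraunitary s A" "top_preserving s Q A" and B: "paraunitary s B" "top_preserving s (Q * A) B"
    and Q: "Q \<in> carrier_mat r s"
  shows "top_preserving s Q (A * B)"
  unfolding top_preserving_def
proof (intro allI impI)
  fix X \<sigma> assume X: "X \<in> carrier_mat s 1" "bounded_by \<sigma> X" "bounded_by \<sigma> (Q * X)"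
  have Ac: "A \<in> carrier_mat s s" and Bc: "B \<in> carrier_mat s s" using A B by (auto dest: paraunitary_carrier)
  have Y: "mstar A * X \<in> carrier_mat s 1" using Ac X(1) by (intro mult_carrier_mat[OF mstar_carrier])
  have "Q * A * (mstar A * X) = Q * A * mstar A * X"
    using assoc_mult_mat[OF mult_carrier_mat[OF Q Ac] mstar_carrier[OF Ac] X(1)] by simp
  also have "\<dots> = Q * X" by (simp add: mult_mstar_cancel[OF Q A(1)])
  finally have "bounded_by \<sigma> (mstar B * (mstar A * X))"
    using A(2) B(2) X Y by (auto simp: top_preserving_def)
  also have "mstar B * (mstar A * X) = mstar (A * B) * X"
    using assoc_mult_mat[OF mstar_carrier[OF Bc] mstar_carrier[OF Ac] X(1)] by (simp add: mstar_mult[OF Ac Bc])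
  finally show "bounded_by \<sigma> (mstar (A * B) * X)" .
qed

section \<open>Degree reduction for matrices with orthonormal symmetric rows\<close>

locale symmetric_rows = conj_sqrt_field F for F +
  fixes r s :: nat and \<epsilon> \<delta> :: "nat \<Rightarrow> complex" and a :: "nat \<Rightarrow> bool"
  assumes row_sign: "\<forall>i<r. \<epsilon> i \<in> {1, -1}" and col_sign: "\<forall>j<s. \<delta> j \<in> {1, -1}"
begin

definition isometric :: "(nat \<Rightarrow> bool) \<Rightarrow> laurent mat \<Rightarrow> bool" where
  "isometric b Q \<longleftrightarrow> Q \<in> carrier_mat r s \<and> Q * mstar Q = 1\<^sub>m r \<and> coeffs_in F Q \<and> graded \<epsilon> a \<delta> b Q"

text \<open>The column signs \<delta> stay the same along the whole reduction and belong to the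
  locale; the column parities change with every mixing and are therefore arguments.\<close>

definition column_step :: "(nat \<Rightarrow> bool) \<Rightarrow> (nat \<Rightarrow> bool) \<Rightarrow> laurent mat \<Rightarrow> bool" where
  "column_step b b' A \<longleftrightarrow> paraunitary s A \<and> coeffs_in F A \<and> graded \<delta> b \<delta> b' A"

definition row_degrees :: "(nat \<Rightarrow> int) \<Rightarrow> laurent mat \<Rightarrow> bool" where
  "row_degrees D Q \<longleftrightarrow> (\<forall>i<r. \<forall>j<s. \<forall>t. cf (Q $$ (i, j)) t \<noteq> 0 \<longrightarrow> \<bar>t\<bar> \<le> D i)"

lemma row_degreesD: "row_degrees D Q \<Longrightarrow> i < r \<Longrightarrow> j < s \<Longrightarrow> \<bar>t\<bar> > D i \<Longrightarrow> cf (Q $$ (i, j)) t = 0"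
  by (force simp: row_degrees_def)

lemma isometric_carrier: "isometric b Q \<Longrightarrow> Q \<in> carrier_mat r s"
  by (simp add: isometric_def)

lemma isometric_mult: "isometric b Q \<Longrightarrow> column_step b b' A \<Longrightarrow> isometric b' (Q * A)"
  unfolding isometric_def column_step_def
  using orthonormal_rows_mult[of Q r s A] coeffs_in_mult[of Q A r s s] graded_mult[of \<epsilon> a \<delta> b Q r s \<delta> b' A s] col_sign
  by (auto dest: paraunitary_carrier)

lemma column_step_mult: "column_step b b' A \<Longrightarrow> column_step b' b'' B \<Longrightarrow> column_step b b'' (A * B)"
  unfolding column_step_def
  using paraunitary_mult[of s A B] coeffs_in_mult[of A B s s s] graded_mult[of \<delta> b \<delta> b' A s s \<delta> b'' B s] col_sign
  by (auto dest: paraunitary_carrier)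

lemma column_step_one: "column_step b b (1\<^sub>m s)"
proof -
  have "graded \<delta> b \<delta> b (1\<^sub>m s)"
    using col_sign by (auto simp: graded_def one_mat_def lookup_one when_def)
  then show ?thesis by (simp add: column_step_def paraunitary_one coeffs_in_one)
qed

text \<open>The coefficient of degree \<open>D + n\<close> of the inner product of two rows vanishes; the symmetry turns
  the lowest coefficient of the second row into its highest one, so that the leading
  coefficients are isotropic for the indefinite form with signature \<open>\<delta>\<close>.\<close>

lemma leading_coeffs_isotropic:
  assumes Q: "isometric b Q" and ij: "i < r" "i' < r"
    and D: "\<And>j t. j < s \<Longrightarrow> cf (Q $$ (i, j)) t \<noteq> 0 \<Longrightarrow> \<bar>t\<bar> \<le> D"
    and n: "\<And>j t. j < s \<Longrightarrow> cf (Q $$ (i', j)) t \<noteq> 0 \<Longrightarrow> \<bar>t\<bar> \<le> n"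
    and Dn: "D + n > 0"
  shows "(\<Sum>j<s. \<delta> j * cf (Q $$ (i, j)) D * cnj (cf (Q $$ (i', j)) n)) = 0"
proof -
  have Qc: "Q \<in> carrier_mat r s" and QQ: "Q * mstar Q = 1\<^sub>m r" and gr: "graded \<epsilon> a \<delta> b Q"
    using Q by (auto simp: isometric_def)
  have "cf (Q $$ (i, j) * lstar (Q $$ (i', j))) (D + n) =
      \<epsilon> i' * (\<delta> j * cf (Q $$ (i, j)) D * cnj (cf (Q $$ (i', j)) n))" if "j < s" for j
  proof -
    have "cf (Q $$ (i, j) * lstar (Q $$ (i', j))) (D + n) = cf (Q $$ (i, j)) D * cf (lstar (Q $$ (i', j))) n"
      by (rule cf_mult_top) (use D[OF that] n[OF that] in \<open>force simp: lookup_lstar\<close>)+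
    also have "\<dots> = cf (Q $$ (i, j)) D * cnj (\<epsilon> i' * \<delta> j * cf (Q $$ (i', j)) n)"
      by (simp add: lookup_lstar gradedD(1)[OF gr Qc ij(2) that])
    also have "cnj (\<epsilon> i') = \<epsilon> i'" using row_sign ij(2) by auto
    moreover have "cnj (\<delta> j) = \<delta> j" using col_sign that by auto
    ultimately show ?thesis by simp
  qed
  then have "\<epsilon> i' * (\<Sum>j<s. \<delta> j * cf (Q $$ (i, j)) D * cnj (cf (Q $$ (i', j)) n))
      = (\<Sum>j<s. cf (Q $$ (i, j) * lstar (Q $$ (i', j))) (D + n))"
    by (simp add: sum_distrib_left)
  also have "\<dots> = cf ((Q * mstar Q) $$ (i, i')) (D + n)"
    using Qc ij by (simp add: mat_mult_index[of _ _ _ _ s] lookup_sum del: index_mult_mat(1))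
  also have "\<dots> = 0" using QQ ij Dn by (simp add: one_mat_def lookup_one when_def)
  finally show ?thesis using row_sign ij(2) by auto
qed

text \<open>A constant entry is even and has even exponent, so it may only connect columns of equal
  sign and equal parity.\<close>

lemma const_step:
  assumes h: "\<And>i j. i < s \<Longrightarrow> j < s \<Longrightarrow> (\<Sum>l<s. h i l * cnj (h j l)) = (if i = j then 1 else 0)"
    "\<And>i j. h i j \<in> F" "\<And>i j. i \<notin> C \<or> j \<notin> C \<Longrightarrow> h i j = (if i = j then 1 else 0)"
    and C: "\<And>j. j \<in> C \<Longrightarrow> j < s \<and> b j = c \<and> \<delta> j = e"
  shows "column_step b b (const_mat s h)"
proof -
  have "coeffs_in F (const_mat s h)" using h(2) by (auto simp: coeffs_in_def cf_const_mat)
  moreover have "graded \<delta> b \<delta> b (const_mat s h)"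
    by (rule graded_const_mat) (use h(3) C col_sign in \<open>metis+\<close>)
  ultimately show ?thesis using h(1) by (simp add: column_step_def paraunitary_const_mat)
qed

definition const_entries :: "laurent mat \<Rightarrow> bool" where
  "const_entries A \<longleftrightarrow> (\<forall>i<s. \<forall>j<s. \<forall>t. cf (A $$ (i, j)) t \<noteq> 0 \<longrightarrow> t = 0)"

lemma const_entries_mult:
  assumes "const_entries A" "const_entries B" "A \<in> carrier_mat s s" "B \<in> carrier_mat s s"
  shows "const_entries (A * B)"
  unfolding const_entries_def
proof (intro allI impI)
  fix i j t assume ij: "i < s" "j < s" and nz: "cf ((A * B) $$ (i, j)) t \<noteq> 0"
  have dims: "i < dim_row A" "j < dim_col B" "dim_row B = s" "dim_col A = s" using assms ij by auto
  show "t = 0"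
    using mat_mult_cf_nonzero[OF dims nz] assms ij unfolding const_entries_def by (metis add_0)
qed

lemma const_entries_const_mat: "const_entries (const_mat s h)"
  by (auto simp: const_entries_def cf_const_mat split: if_splits)

lemma row_degrees_const_entries:
  assumes "row_degrees D Q" "const_entries A" "Q \<in> carrier_mat r s" "A \<in> carrier_mat s s"
  shows "row_degrees D (Q * A)"
  unfolding row_degrees_def
proof (intro allI impI)
  fix i j t assume ij: "i < r" "j < s" and nz: "cf ((Q * A) $$ (i, j)) t \<noteq> 0"
  have dims: "i < dim_row Q" "j < dim_col A" "dim_row A = s" "dim_col Q = s" using assms ij by auto
  show "\<bar>t\<bar> \<le> D i"
    using mat_mult_cf_nonzero[OF dims nz] assms(1,2) ij unfolding const_entries_def row_degrees_def
    by (metis add.right_neutral)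
qed

text \<open>All exponents equal to the degree sit in columns of parity \<open>c\<close>. By isotropy
  the parts of the leading vector on the positive and on the negative columns of this parity have
  the same norm, so one Householder matrix in each sign class produces two equal entries.\<close>

lemma normalize_leading_row:
  assumes Q: "isometric b Q" and D: "row_degrees D Q" and i0: "i0 < r" "D i0 \<ge> 1"
    and c: "odd (D i0) \<longleftrightarrow> a i0 \<noteq> c"
    and j0: "j0 < s" "cf (Q $$ (i0, j0)) (D i0) \<noteq> 0"
  obtains W p m \<nu> where "column_step b b W" "const_entries W" "p < s" "m < s" "\<delta> p = 1" "\<delta> m = -1"
    "b p = c" "b m = c" "\<nu> \<noteq> 0"
    "\<And>j. j < s \<Longrightarrow> cf ((Q * W) $$ (i0, j)) (D i0) = (if j = p \<or> j = m then \<nu> else 0)"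
proof -
  have Qc: "Q \<in> carrier_mat r s" and gr: "graded \<epsilon> a \<delta> b Q" and QF: "coeffs_in F Q"
    using Q by (auto simp: isometric_def)
  define x where "x j = cf (Q $$ (i0, j)) (D i0)" for j
  define C where "C e = {j. j < s \<and> b j = c \<and> \<delta> j = e}" for e :: complex
  define N where "N e = (\<Sum>j\<in>C e. (cmod (x j))\<^sup>2)" for e
  have x0: "x j = 0" if "j < s" "b j \<noteq> c" for j
    using gradedD(2)[OF gr Qc i0(1) that(1)] that c by (auto simp: x_def)
  have xF: "x j \<in> F" if "j < s" for j
    using QF Qc i0 that by (auto simp: coeffs_in_def x_def)
  have fin: "finite (C e)" for e by (simp add: C_def)
  have "(\<Sum>j<s. \<delta> j * x j * cnj (x j)) = 0"
    unfolding x_def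
    by (rule leading_coeffs_isotropic[OF Q i0(1) i0(1)]) (use D i0 in \<open>auto simp: row_degrees_def\<close>)
  also have "(\<Sum>j<s. \<delta> j * x j * cnj (x j)) =
      (\<Sum>j<s. (if j \<in> C 1 then x j * cnj (x j) else 0) - (if j \<in> C (-1) then x j * cnj (x j) else 0))"
  proof (rule sum.cong[OF refl])
    fix j assume "j \<in> {..<s}"
    then have "j < s" "\<delta> j = 1 \<or> \<delta> j = -1" using col_sign by auto
    then show "\<delta> j * x j * cnj (x j) =
      (if j \<in> C 1 then x j * cnj (x j) else 0) - (if j \<in> C (-1) then x j * cnj (x j) else 0)"
      using x0[of j] by (auto simp: C_def)
  qed
  also have "\<dots> = (\<Sum>j\<in>C 1. x j * cnj (x j)) - (\<Sum>j\<in>C (-1). x j * cnj (x j))"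
    unfolding sum_subtractf sum.inter_restrict[OF finite_lessThan, symmetric]
    by (intro arg_cong2[where f = minus] sum.cong) (auto simp: C_def)
  also have "\<dots> = complex_of_real (N 1 - N (-1))"
    by (simp only: N_def of_real_diff of_real_sum complex_norm_square)
  finally have NN: "N 1 = N (-1)" by simp
  have "j0 \<in> C 1 \<or> j0 \<in> C (-1)"
    using j0 x0[of j0] col_sign by (auto simp: C_def x_def)
  \<comment> \<open>Since the two norms agree, one nonzero leading coefficient makes both sign
    classes nonempty.\<close>
  then have "0 < N 1 \<or> 0 < N (-1)"
    using j0 unfolding N_def x_def by (meson fin sum_pos2 zero_le_power2 zero_less_norm_iff zero_less_power)
  then have N: "N 1 > 0" "N (-1) > 0" using NN by auto
  obtain p m where p: "p \<in> C 1" and m: "m \<in> C (-1)"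
    using N unfolding N_def by (metis all_not_in_conv less_irrefl sum.empty)
  have Cs: "C e \<subseteq> {..<s}" for e by (auto simp: C_def)
  obtain h1 where h1: "\<And>i j. i < s \<Longrightarrow> j < s \<Longrightarrow> (\<Sum>l<s. h1 i l * cnj (h1 j l)) = (if i = j then 1 else 0)"
    "\<And>i j. h1 i j \<in> F"
    "\<And>i j. i \<notin> C 1 \<or> j \<notin> C 1 \<Longrightarrow> h1 i j = (if i = j then 1 else 0)"
    "\<And>j. j < s \<Longrightarrow> (\<Sum>i<s. x i * h1 i j) = (if j = p then complex_of_real (sqrt (N 1)) else if j \<in> C 1 then 0 else x j)"
    using householder[OF Cs p, of x "N 1"] xF N by (auto simp: C_def N_def)
  define x' where "x' j = (\<Sum>i<s. x i * h1 i j)" for j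
  have x': "x' j = (if j = p then complex_of_real (sqrt (N 1)) else if j \<in> C 1 then 0 else x j)" if "j < s" for j
    using h1(4)[OF that] by (simp add: x'_def)
  have disj: "C 1 \<inter> C (-1) = {}" by (auto simp: C_def)
  \<comment> \<open>The first matrix does not touch the negative columns, so the second one meets
    the original entries and the same norm.\<close>
  have xm: "x' j = x j" if "j \<in> C (-1)" for j
    using x'[of j] that p disj by (auto simp: C_def)
  have "N (-1) = (\<Sum>j\<in>C (-1). (cmod (x' j))\<^sup>2)" by (simp add: N_def xm)
  then obtain h2 where h2: "\<And>i j. i < s \<Longrightarrow> j < s \<Longrightarrow> (\<Sum>l<s. h2 i l * cnj (h2 j l)) = (if i = j then 1 else 0)"
    "\<And>i j. h2 i j \<in> F"
    "\<And>i j. i \<notin> C (-1) \<or> j \<notin> C (-1) \<Longrightarrow> h2 i j = (if i = j then 1 else 0)"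
    "\<And>j. j < s \<Longrightarrow> (\<Sum>i<s. x' i * h2 i j) = (if j = m then complex_of_real (sqrt (N (-1))) else if j \<in> C (-1) then 0 else x' j)"
    using householder[OF Cs m, of x' "N (-1)"] xF N xm by (auto simp: C_def)
  define W1 where "W1 = const_mat s h1"
  define W2 where "W2 = const_mat s h2"
  have W: "column_step b b W1" "column_step b b W2" unfolding W1_def W2_def
    by (rule const_step[where c = c and e = 1, OF h1(1-3)], assumption+, simp add: C_def)
      (rule const_step[where c = c and e = "-1", OF h2(1-3)], assumption+, simp add: C_def)
  have Wc: "W1 \<in> carrier_mat s s" "W2 \<in> carrier_mat s s" by (auto simp: W1_def W2_def)
  show thesis
  proof (rule that[of "W1 * W2" p m "complex_of_real (sqrt (N 1))"])
    show "column_step b b (W1 * W2)" using W by (rule column_step_mult)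
    show "const_entries (W1 * W2)"
      using Wc by (intro const_entries_mult) (auto simp: W1_def W2_def const_entries_const_mat)
    fix j assume j: "j < s"
    have "cf ((Q * (W1 * W2)) $$ (i0, j)) (D i0) = cf ((Q * W1 * W2) $$ (i0, j)) (D i0)"
      using assoc_mult_mat[OF Qc Wc] by simp
    also have "\<dots> = (\<Sum>l<s. x' l * h2 l j)"
      unfolding W2_def using cf_mult_const_mat[OF mult_carrier_mat[OF Qc Wc(1)] i0(1) j]
        cf_mult_const_mat[OF Qc i0(1)]
      by (simp add: W1_def x'_def x_def)
    also have "\<dots> = (if j = p \<or> j = m then complex_of_real (sqrt (N 1)) else 0)"
      using h2(4)[OF j] x'[OF j] NN x0[OF j] col_sign j p m by (auto simp: C_def)
    finally show "cf ((Q * (W1 * W2)) $$ (i0, j)) (D i0) = (if j = p \<or> j = m then complex_of_real (sqrt (N 1)) else 0)" .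
  qed (use p m N in \<open>auto simp: C_def\<close>)
qed

text \<open>The bound telescopes along products, which keeps the support of a product of arbitrarily many
  steps within that of a single one.\<close>

definition key_bound :: "bool \<Rightarrow> (nat \<Rightarrow> bool) \<Rightarrow> (nat \<Rightarrow> bool) \<Rightarrow> laurent mat \<Rightarrow> bool" where
  "key_bound c b b' A \<longleftrightarrow> (\<forall>i<s. \<forall>j<s. \<forall>t. cf (A $$ (i, j)) t \<noteq> 0 \<longrightarrow> \<bar>t\<bar> \<le> of_bool (b i = c) - of_bool (b' j = c))"

lemma key_bound_mult:
  assumes "key_bound c b b' A" "key_bound c b' b'' B" "A \<in> carrier_mat s s" "B \<in> carrier_mat s s"
  shows "key_bound c b b'' (A * B)"
  unfolding key_bound_def
proof (intro allI impI)
  fix i j t assume ij: "i < s" "j < s" and nz: "cf ((A * B) $$ (i, j)) t \<noteq> 0"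
  have dims: "i < dim_row A" "j < dim_col B" "dim_row B = s" "dim_col A = s" using assms ij by auto
  obtain l t1 t2 where "l < s" "t = t1 + t2" "cf (A $$ (i, l)) t1 \<noteq> 0" "cf (B $$ (l, j)) t2 \<noteq> 0"
    using mat_mult_cf_nonzero[OF dims nz] by metis
  then have "\<bar>t1\<bar> \<le> of_bool (b i = c) - of_bool (b' l = c)" "\<bar>t2\<bar> \<le> of_bool (b' l = c) - of_bool (b'' j = c)"
    using assms(1,2) ij by (auto simp: key_bound_def)
  then show "\<bar>t\<bar> \<le> of_bool (b i = c) - of_bool (b'' j = c)"
    using \<open>t = t1 + t2\<close> by linarith
qed

lemma key_bound_one: "key_bound c b b (1\<^sub>m s)"
  by (auto simp: key_bound_def one_mat_def lookup_one when_def split: if_splits)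

lemma key_bound_const_entries:
  assumes "const_entries A" "graded \<delta> b \<delta> b A" "A \<in> carrier_mat s s"
  shows "key_bound c b b A"
  unfolding key_bound_def
proof (intro allI impI)
  fix i j t assume ij: "i < s" "j < s" and nz: "cf (A $$ (i, j)) t \<noteq> 0"
  then have "t = 0" using assms(1) by (auto simp: const_entries_def)
  moreover have "b i = b j" using gradedD(2)[OF assms(2,3) ij nz] \<open>t = 0\<close> by simp
  ultimately show "\<bar>t\<bar> \<le> of_bool (b i = c) - of_bool (b j = c)" by simp
qed

text \<open>The block has odd exponents only, so both columns leave the class \<open>c\<close>. This
  makes the key bound 1 - 0 on the block, and a later step with the same \<open>c\<close> cannot use
  these columns again.\<close>

lemma mixing_step:
  assumes pm: "p < s" "m < s" "\<delta> p = 1" "\<delta> m = -1" "b p = c" "b m = c"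
  shows "column_step b (b(p := \<not> c, m := \<not> c)) (mixing_mat s p m)"
    and "key_bound c b (b(p := \<not> c, m := \<not> c)) (mixing_mat s p m)"
proof -
  have ne: "p \<noteq> m" using pm by auto
  have "1 / 2 \<in> F" using inverse_closed[OF of_nat_closed[of 2]] by (simp add: inverse_eq_divide)
  then have "coeffs_in F (mixing_mat s p m)"
    using uminus_closed[of "1/2"] by (auto simp: coeffs_in_def cf_mixing_mat)
  moreover have "graded \<delta> b \<delta> (b(p := \<not> c, m := \<not> c)) (mixing_mat s p m)"
    unfolding graded_def
  proof (intro allI impI)
    fix i j and t :: int assume "i < dim_row (mixing_mat s p m)" "j < dim_col (mixing_mat s p m)"
    then have ij: "i < s" "j < s" by auto
    have "\<delta> i * \<delta> i = 1" using col_sign ij by auto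
    then show "cf (mixing_mat s p m $$ (i, j)) (- t) = \<delta> i * \<delta> j * cf (mixing_mat s p m $$ (i, j)) t \<and>
      (cf (mixing_mat s p m $$ (i, j)) t \<noteq> 0 \<longrightarrow> odd t = (b i \<noteq> (b(p := \<not> c, m := \<not> c)) j))"
      unfolding cf_mixing_mat[OF ij] using pm ne by auto
  qed
  ultimately show "column_step b (b(p := \<not> c, m := \<not> c)) (mixing_mat s p m)"
    by (simp add: column_step_def paraunitary_mixing_mat pm ne)
  show "key_bound c b (b(p := \<not> c, m := \<not> c)) (mixing_mat s p m)"
    using pm ne by (auto simp: key_bound_def cf_mixing_mat)
qed

text \<open>After normalization only p - m is multiplied by w, and its coefficient of degree
  \<open>D i\<close> vanishes in every row i; hence no degree rises. In row \<open>i0\<close> the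
  exponent \<open>D i0\<close> disappears from columns p and m because their parity has changed, and
  it was absent from all others.\<close>

lemma lower_row:
  assumes Q: "isometric b Q" and D: "row_degrees D Q" and D0: "\<forall>i<r. D i \<ge> 0"
    and i0: "i0 < r" "D i0 \<ge> 1" and c: "odd (D i0) \<longleftrightarrow> a i0 \<noteq> c"
  obtains A b' where "column_step b b' A" "key_bound c b b' A"
    "row_degrees (D(i0 := D i0 - 1)) (Q * A)" "top_preserving s Q A"
proof (cases "\<exists>j<s. cf (Q $$ (i0, j)) (D i0) \<noteq> 0")
  \<comment> \<open>\<open>D i0\<close> is merely an upper bound; if it is not attained, the
    identity serves.\<close>
  case False
  have Qc: "Q \<in> carrier_mat r s" and gr: "graded \<epsilon> a \<delta> b Q"
    using Q by (auto simp: isometric_def)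
  have "\<bar>t\<bar> \<le> (D(i0 := D i0 - 1)) i" if "i < r" "j < s" "cf (Q $$ (i, j)) t \<noteq> 0" for i j t
  proof -
    have "\<bar>t\<bar> \<le> D i" using D that by (auto simp: row_degrees_def)
    moreover have "\<bar>t\<bar> \<noteq> D i" if "i = i0"
    proof
      assume "\<bar>t\<bar> = D i"
      then have "t = D i0 \<or> - t = D i0" using that by auto
      moreover have "cf (Q $$ (i, j)) (- t) \<noteq> 0"
        using gradedD(1)[OF gr Qc \<open>i < r\<close> \<open>j < s\<close>, of "- t"] \<open>cf (Q $$ (i, j)) t \<noteq> 0\<close> by auto
      ultimately show False using False that \<open>j < s\<close> \<open>cf (Q $$ (i, j)) t \<noteq> 0\<close> by metis
    qed
    ultimately show ?thesis by auto
  qed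
  then have "row_degrees (D(i0 := D i0 - 1)) (Q * 1\<^sub>m s)"
    using Qc unfolding row_degrees_def by simp
  then show thesis
    using that[OF column_step_one key_bound_one] top_preserving_one by blast
next
  case True
  then obtain j0 where j0: "j0 < s" "cf (Q $$ (i0, j0)) (D i0) \<noteq> 0" by auto
  obtain W p m \<nu> where W: "column_step b b W" "const_entries W" and pm: "p < s" "m < s" "\<delta> p = 1" "\<delta> m = -1"
    "b p = c" "b m = c" and \<nu>: "\<nu> \<noteq> 0"
    and lead: "\<And>j. j < s \<Longrightarrow> cf ((Q * W) $$ (i0, j)) (D i0) = (if j = p \<or> j = m then \<nu> else 0)"
    using normalize_leading_row[OF Q D i0 c j0] by metis
  define b' where "b' = b(p := \<not> c, m := \<not> c)"
  define K where "K = mixing_mat s p m"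
  define Q1 where "Q1 = Q * W"
  have ne: "p \<noteq> m" using pm by auto
  have Qc: "Q \<in> carrier_mat r s" using Q by (rule isometric_carrier)
  have Wc: "W \<in> carrier_mat s s" and Kc: "K \<in> carrier_mat s s" and Wp: "paraunitary s W"
    using W by (auto simp: column_step_def K_def dest: paraunitary_carrier)
  have K: "column_step b b' K" "key_bound c b b' K"
    using mixing_step[OF pm] by (auto simp: K_def b'_def)
  have Q1: "isometric b Q1" using isometric_mult[OF Q W(1)] by (simp add: Q1_def)
  have Q1c: "Q1 \<in> carrier_mat r s" using Q1 by (rule isometric_carrier)
  have Q1g: "graded \<epsilon> a \<delta> b Q1" using Q1 by (simp add: isometric_def)
  have D1: "row_degrees D Q1" unfolding Q1_def by (rule row_degrees_const_entries[OF D W(2) Qc Wc])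
  have QK: "Q * (W * K) = Q1 * K" using assoc_mult_mat[OF Qc Wc Kc] by (simp add: Q1_def)
  have Q2g: "graded \<epsilon> a \<delta> b' (Q1 * K)" using isometric_mult[OF Q1 K(1)] by (simp add: isometric_def)
  \<comment> \<open>The leading vector of row \<open>i0\<close> is now \<nu> (e_p + e_m).
    Orthogonality to it for the form with signs 1 at p and -1 at m says that the two leading
    coefficients of any row agree.\<close>
  have pair: "cf (Q1 $$ (i, p)) (D i) = cf (Q1 $$ (i, m)) (D i)" if "i < r" for i
  proof -
    have "(\<Sum>j<s. \<delta> j * cf (Q1 $$ (i, j)) (D i) * cnj (cf (Q1 $$ (i0, j)) (D i0))) = 0"
      by (rule leading_coeffs_isotropic[OF Q1 that i0(1)])
        (use D1 that i0 D0 in \<open>auto simp: row_degrees_def add_nonneg_pos\<close>)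
    also have "(\<Sum>j<s. \<delta> j * cf (Q1 $$ (i, j)) (D i) * cnj (cf (Q1 $$ (i0, j)) (D i0)))
      = cf (Q1 $$ (i, p)) (D i) * cnj \<nu> - cf (Q1 $$ (i, m)) (D i) * cnj \<nu>"
      using pm ne lead by (subst sum_pair[of p s m]) (auto simp: Q1_def)
    finally show ?thesis using \<nu> by simp
  qed
  have "\<bar>t\<bar> \<le> (D(i0 := D i0 - 1)) i" if ij: "i < r" "j < s" and nz: "cf ((Q1 * K) $$ (i, j)) t \<noteq> 0" for i j t
  proof -
    have up: "\<bar>t\<bar> \<le> D i" if nz: "cf ((Q1 * K) $$ (i, j)) t \<noteq> 0" "t \<ge> 0" for t
    proof (rule ccontr)
      assume "\<not> \<bar>t\<bar> \<le> D i"
      then have t: "t > D i" using that by auto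
      have z: "cf (Q1 $$ (i, l)) t' = 0" if "t' > D i" "l < s" for l t'
        using row_degreesD[OF D1 ij(1) that(2)] that(1) by simp
      have "cf (Q1 $$ (i, p)) (t - 1) = cf (Q1 $$ (i, m)) (t - 1)"
        using z[of "t - 1" p] z[of "t - 1" m] pm pair[OF ij(1)] t by (cases "t = D i + 1") auto
      then show False
        using nz(1) z t pm ij unfolding K_def cf_mult_mixing_mat[OF Q1c ij pm(1,2) ne] by (auto split: if_splits)
    qed
    have top: "t \<noteq> D i0" if nz: "i = i0" "cf ((Q1 * K) $$ (i, j)) t \<noteq> 0" for t
    proof
      assume t: "t = D i0"
      show False
      proof (cases "j = p \<or> j = m")
        case True
        then show False
          using gradedD(2)[OF Q2g mult_carrier_mat[OF Q1c Kc] ij nz(2)] c t that(1) ne by (auto simp: b'_def)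
      next
        case False
        then have "cf ((Q1 * K) $$ (i, j)) t = cf (Q1 $$ (i, j)) t"
          unfolding K_def cf_mult_mixing_mat[OF Q1c ij pm(1,2) ne] by simp
        then show False using lead[OF ij(2)] that t False by (simp add: Q1_def)
      qed
    qed
    have nz': "cf ((Q1 * K) $$ (i, j)) (- t) \<noteq> 0"
      using gradedD(1)[OF Q2g mult_carrier_mat[OF Q1c Kc] ij, of "- t"] nz by auto
    have "\<bar>t\<bar> \<le> D i" using up[OF nz] up[OF nz'] by (cases "t \<ge> 0") auto
    moreover have "\<bar>t\<bar> \<noteq> D i0" if "i = i0" using top[OF that nz] top[OF that nz'] by auto
    ultimately show ?thesis by auto
  qed
  then have deg: "row_degrees (D(i0 := D i0 - 1)) (Q * (W * K))"
    unfolding row_degrees_def QK by blast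
  have "top_preserving s Q (W * K)"
    unfolding top_preserving_def
  proof (intro allI impI)
    fix X \<sigma> assume X: "X \<in> carrier_mat s 1" "bounded_by \<sigma> X" "bounded_by \<sigma> (Q * X)"
    define Y where "Y = mstar W * X"
    have Yc: "Y \<in> carrier_mat s 1" using Wc X(1) by (auto simp: Y_def intro: mult_carrier_mat[OF mstar_carrier])
    have "bounded_by (0 + \<sigma>) Y"
      unfolding Y_def
    proof (rule bounded_by_mult[OF _ X(2) mstar_carrier[OF Wc] X(1)])
      show "bounded_by 0 (mstar W)"
        using W(2) Wc by (force simp: bounded_by_def const_entries_def lookup_lstar)
    qed
    then have Y\<sigma>: "bounded_by \<sigma> Y" by simp
    have "Q1 * Y = Q1 * mstar W * X"
      unfolding Y_def using assoc_mult_mat[OF Q1c mstar_carrier[OF Wc] X(1)] by simp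
    also have "\<dots> = Q * X" unfolding Q1_def by (simp add: mult_mstar_cancel[OF Qc Wp])
    finally have "bounded_by \<sigma> (Q1 * Y)" using X(3) by simp
    \<comment> \<open>\<open>D i0 \<ge> 1\<close> puts this exponent above the bound on the product,
      while it is the sum of the two top exponents, so that only leading coefficients
      contribute.\<close>
    then have "cf ((Q1 * Y) $$ (i0, 0)) (D i0 + \<sigma>) = 0"
      using bounded_byD[OF _ mult_carrier_mat[OF Q1c Yc] i0(1), of \<sigma> 0 "D i0 + \<sigma>"] i0(2) by auto
    also have "cf ((Q1 * Y) $$ (i0, 0)) (D i0 + \<sigma>) = (\<Sum>j<s. cf (Q1 $$ (i0, j)) (D i0) * cf (Y $$ (j, 0)) \<sigma>)"
    proof -
      have "cf (Q1 $$ (i0, j) * Y $$ (j, 0)) (D i0 + \<sigma>) = cf (Q1 $$ (i0, j)) (D i0) * cf (Y $$ (j, 0)) \<sigma>"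
        if "j < s" for j
        by (rule cf_mult_top) (use D1 i0 that bounded_byD[OF Y\<sigma> Yc that] in \<open>force simp: row_degrees_def\<close>)+
      then show ?thesis
        using Q1c Yc i0(1) by (simp add: mat_mult_index[of _ _ _ _ s] lookup_sum del: index_mult_mat(1))
    qed
    also have "\<dots> = \<nu> * (cf (Y $$ (p, 0)) \<sigma> + cf (Y $$ (m, 0)) \<sigma>)"
      using pm ne lead by (subst sum_pair[of p s m]) (auto simp: Q1_def distrib_left)
    finally have Ypm: "cf (Y $$ (p, 0)) \<sigma> + cf (Y $$ (m, 0)) \<sigma> = 0" using \<nu> by simp
    have "cf ((mstar K * Y) $$ (i, 0)) t = 0" if "i < s" "t > \<sigma>" for i t
    proof -
      have z: "cf (Y $$ (l, 0)) t' = 0" if "l < s" "t' > \<sigma>" for l t'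
        using bounded_byD[OF Y\<sigma> Yc that(1), of 0 t'] that(2) by auto
      have "cf (Y $$ (p, 0)) (t - 1) + cf (Y $$ (m, 0)) (t - 1) = 0"
        using z[of p "t - 1"] z[of m "t - 1"] pm Ypm that(2) by (cases "t = \<sigma> + 1") auto
      then show ?thesis
        using cf_mstar_mixing_mat_mult[OF Yc that(1) _ pm(1,2) ne, of 0 t] z pm that by (auto simp: K_def)
    qed
    then have "bounded_by \<sigma> (mstar K * Y)"
      using Yc Kc unfolding bounded_by_def by (force simp del: index_mult_mat(1))
    also have "mstar K * Y = mstar (W * K) * X"
      unfolding Y_def mstar_mult[OF Wc Kc]
      using assoc_mult_mat[OF mstar_carrier[OF Kc] mstar_carrier[OF Wc] X(1)] by simp
    finally show "bounded_by \<sigma> (mstar (W * K) * X)" .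
  qed
  moreover have "key_bound c b b' (W * K)"
    using key_bound_mult[OF key_bound_const_entries[OF W(2) _ Wc] K(2) Wc Kc] W(1)
    by (simp add: column_step_def)
  ultimately show thesis
    using that[OF column_step_mult[OF W(1) K(1)]] deg by blast
qed

text \<open>The rows of \<open>I\<close> carry their leading coefficients in columns of the same
  parity \<open>c\<close>, so the key bounds of all factors refer to one \<open>c\<close> and
  telescope. \<open>J\<close> collects the rows already lowered, whose degrees must not rise
  again.\<close>

lemma lower_rows:
  assumes "finite I" "I \<subseteq> {i. i < r \<and> (odd n \<longleftrightarrow> a i \<noteq> c)}" "J \<inter> I = {}" "n \<ge> 1"
    and Q: "isometric b Q" "row_degrees (\<lambda>i. if i \<in> J then n - 1 else n) Q"
  obtains A b' where "column_step b b' A" "key_bound c b b' A"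
    "row_degrees (\<lambda>i. if i \<in> J \<union> I then n - 1 else n) (Q * A)" "top_preserving s Q A"
  using assms
proof (induction I arbitrary: J b Q thesis rule: finite_induct)
  case empty
  have "Q * 1\<^sub>m s = Q" using isometric_carrier[OF empty(5)] by simp
  then show ?case
    using empty(1)[OF column_step_one key_bound_one] empty.prems top_preserving_one by (metis Un_empty_right)
next
  case (insert i0 I)
  let ?D = "\<lambda>i. if i \<in> J then n - 1 else n"
  have i0: "i0 < r" "i0 \<notin> J" "odd n \<longleftrightarrow> a i0 \<noteq> c" using insert.prems by auto
  obtain A b' where A: "column_step b b' A" "key_bound c b b' A"
    "row_degrees (?D(i0 := ?D i0 - 1)) (Q * A)" "top_preserving s Q A"
    by (rule lower_row[OF insert.prems(5,6), of i0 c]) (use i0 insert.prems in auto)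
  have "?D(i0 := ?D i0 - 1) = (\<lambda>i. if i \<in> insert i0 J then n - 1 else n)"
    using i0 by auto
  then have deg: "row_degrees (\<lambda>i. if i \<in> insert i0 J then n - 1 else n) (Q * A)"
    using A(3) by simp
  obtain B b'' where B: "column_step b' b'' B" "key_bound c b' b'' B"
    "row_degrees (\<lambda>i. if i \<in> insert i0 J \<union> I then n - 1 else n) (Q * A * B)" "top_preserving s (Q * A) B"
    by (rule insert.IH[OF _ _ _ insert.prems(4) isometric_mult[OF insert.prems(5) A(1)] deg])
      (use insert.prems insert.hyps in auto)
  have Qc: "Q \<in> carrier_mat r s" and AB: "A \<in> carrier_mat s s" "B \<in> carrier_mat s s" "paraunitary s A" "paraunitary s B"
    using insert.prems(5) A B by (auto simp: isometric_def column_step_def dest: paraunitary_carrier)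
  show ?case
  proof (rule insert.prems(1))
    show "column_step b b'' (A * B)" using A B column_step_mult by blast
    show "key_bound c b b'' (A * B)" using A B AB key_bound_mult by blast
    show "row_degrees (\<lambda>i. if i \<in> J \<union> insert i0 I then n - 1 else n) (Q * (A * B))"
      using B(3) assoc_mult_mat[OF Qc AB(1,2)] by simp
    show "top_preserving s Q (A * B)" using top_preserving_mult[OF AB(3) A(4) AB(4) B(4) Qc] .
  qed
qed

lemma lower_degree:
  assumes Q: "isometric b Q" "row_degrees (\<lambda>_. n) Q" and n: "n \<ge> 1"
  obtains A b' where "column_step b b' A"
    "\<And>i j t. i < s \<Longrightarrow> j < s \<Longrightarrow> cf (A $$ (i, j)) t \<noteq> 0 \<Longrightarrow> \<bar>t\<bar> \<le> of_bool (\<not> b i) + of_bool (\<not> b' j)"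
    "row_degrees (\<lambda>_. n - 1) (Q * A)" "top_preserving s Q A"
proof -
  \<comment> \<open>In the rows of \<open>I c\<close> the exponents n and -n can occur only in
    columns of parity \<open>c\<close>, whatever the current column parities are.\<close>
  define I where "I c = {i. i < r \<and> (odd n \<longleftrightarrow> a i \<noteq> c)}" for c
  have fin: "finite (I c)" for c by (simp add: I_def)
  have dis: "I False \<inter> I True = {}" and un: "i \<in> I False \<union> I True" if "i < r" for i
    using that by (auto simp: I_def)
  obtain A b1 where A: "column_step b b1 A" "key_bound False b b1 A"
    "row_degrees (\<lambda>i. if i \<in> {} \<union> I False then n - 1 else n) (Q * A)" "top_preserving s Q A"
    by (rule lower_rows[OF fin, of False n False "{}" b Q]) (use Q n in \<open>auto simp: I_def\<close>)
  obtain B b2 where B: "column_step b1 b2 B" "key_bound True b1 b2 B"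
    "row_degrees (\<lambda>i. if i \<in> ({} \<union> I False) \<union> I True then n - 1 else n) (Q * A * B)" "top_preserving s (Q * A) B"
    by (rule lower_rows[OF fin, of True n True "{} \<union> I False" b1 "Q * A"])
      (use n A isometric_mult[OF Q(1) A(1)] in \<open>auto simp: I_def\<close>)
  have Qc: "Q \<in> carrier_mat r s" and AB: "A \<in> carrier_mat s s" "B \<in> carrier_mat s s" "paraunitary s A" "paraunitary s B"
    using Q(1) A B by (auto simp: isometric_def column_step_def dest: paraunitary_carrier)
  show thesis
  proof (rule that[of b2 "A * B"])
    show "column_step b b2 (A * B)" using A B column_step_mult by blast
    show "row_degrees (\<lambda>_. n - 1) (Q * (A * B))"
      using B(3) un unfolding assoc_mult_mat[OF Qc AB(1,2)] row_degrees_def by auto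
    show "top_preserving s Q (A * B)" using top_preserving_mult[OF AB(3) A(4) AB(4) B(4) Qc] .
    fix i j t assume ij: "i < s" "j < s" and nz: "cf ((A * B) $$ (i, j)) t \<noteq> 0"
    have dims: "i < dim_row A" "j < dim_col B" "dim_row B = s" "dim_col A = s" using AB ij by auto
    obtain l t1 t2 where "l < s" "t = t1 + t2" "cf (A $$ (i, l)) t1 \<noteq> 0" "cf (B $$ (l, j)) t2 \<noteq> 0"
      using mat_mult_cf_nonzero[OF dims nz] by metis
    then have "\<bar>t1\<bar> \<le> of_bool (b i = False) - of_bool (b1 l = False)" "\<bar>t2\<bar> \<le> of_bool (b1 l = True) - of_bool (b2 j = True)"
      using A(2) B(2) ij unfolding key_bound_def by blast+
    \<comment> \<open>The middle index contributes [b1 l] - [\<not> b1 l] \<le> 1, and 1 - [b2 j] =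
      [\<not> b2 j].\<close>
    then show "\<bar>t\<bar> \<le> of_bool (\<not> b i) + of_bool (\<not> b2 j)"
      using \<open>t = t1 + t2\<close> by (cases "b i"; cases "b1 l"; cases "b2 j") auto
  qed
qed

end

subsection \<open>Passing to the square root of the variable\<close>

lemma cf_dilate:
  assumes "d > 0"
  shows "cf (dilate d p) t = (if int d dvd t then cf p (t div int d) else 0)"
proof -
  have "cf (dilate d p) t = (\<Sum>k\<in>Poly_Mapping.keys p. if int d * k = t then cf p k else 0)"
    by (simp add: dilate_def lookup_sum lookup_single when_def)
  also have "\<dots> = (\<Sum>k\<in>Poly_Mapping.keys p. if k = t div int d then (if int d dvd t then cf p k else 0) else 0)"
    by (rule sum.cong) (use assms in auto)
  also have "\<dots> = (if int d dvd t then cf p (t div int d) else 0)"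
    by (auto simp: in_keys_iff)
  finally show ?thesis .
qed

lemma dilate_add: "d > 0 \<Longrightarrow> dilate d (p + q) = dilate d p + dilate d q"
  by (rule poly_mapping_eqI) (simp add: cf_dilate lookup_add)

lemma dilate_0 [simp]: "dilate d 0 = 0"
  by (simp add: dilate_def)

lemma dilate_sum: "d > 0 \<Longrightarrow> dilate d (\<Sum>i\<in>I. f i) = (\<Sum>i\<in>I. dilate d (f i))"
  by (induction I rule: infinite_finite_induct) (auto simp: dilate_add)

lemma dilate_lmonom: "d > 0 \<Longrightarrow> dilate d (lmonom c n) = lmonom c (int d * n)"
  by (rule poly_mapping_eqI) (auto simp: cf_dilate lookup_single when_def, metis dvd_triv_left)

lemma dilate_mult:
  assumes "d > 0"
  shows "dilate d (p * q) = dilate d p * dilate d q"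
proof (induction p rule: laurent_induct)
  case (add p x n)
  have "dilate d (lmonom x n * q) = dilate d (lmonom x n) * dilate d q"
  proof (induction q rule: laurent_induct)
    case (add q y m)
    then show ?case
      by (simp add: distrib_left dilate_add dilate_lmonom mult_single assms)
  qed simp
  with add show ?case by (simp add: distrib_right dilate_add assms)
qed simp

text \<open>Writing \<open>z = w\<^sup>2\<close> and distributing the half-integral centres of symmetry \<open>(\<beta> j - \<alpha> i) / 2\<close> over
  rows and columns makes all entries symmetric about \<open>0\<close>; parities of exponents then play the role
  of the parities of \<open>\<alpha> i\<close> and \<open>\<beta> j\<close>.\<close>

definition widen :: "(nat \<Rightarrow> int) \<Rightarrow> (nat \<Rightarrow> int) \<Rightarrow> laurent mat \<Rightarrow> laurent mat" where
  "widen \<alpha> \<beta> X = Matrix.mat (dim_row X) (dim_col X) (\<lambda>(i, j). dilate 2 (X $$ (i, j)) * lmonom 1 (\<alpha> i - \<beta> j))"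

text \<open>Keeps every second coefficient. For graded matrices the discarded ones are zero, so that
  this inverts \<open>widen\<close>.\<close>

definition narrow :: "(nat \<Rightarrow> int) \<Rightarrow> (nat \<Rightarrow> int) \<Rightarrow> laurent mat \<Rightarrow> laurent mat" where
  "narrow \<alpha> \<beta> X = Matrix.mat (dim_row X) (dim_col X)
     (\<lambda>(i, j). Poly_Mapping.map_key (\<lambda>k. 2 * k - \<beta> j + \<alpha> i) (X $$ (i, j)))"

lemma widen_carrier [simp]: "X \<in> carrier_mat n m \<Longrightarrow> widen \<alpha> \<beta> X \<in> carrier_mat n m"
  by (auto simp: widen_def)

lemma narrow_carrier [simp]: "X \<in> carrier_mat n m \<Longrightarrow> narrow \<alpha> \<beta> X \<in> carrier_mat n m"
  by (auto simp: narrow_def)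

lemma dim_widen [simp]: "dim_row (widen \<alpha> \<beta> X) = dim_row X" "dim_col (widen \<alpha> \<beta> X) = dim_col X"
  by (auto simp: widen_def)

lemma cf_widen:
  assumes "i < dim_row X" "j < dim_col X"
  shows "cf (widen \<alpha> \<beta> X $$ (i, j)) t =
    (if even (t + \<beta> j - \<alpha> i) then cf (X $$ (i, j)) ((t + \<beta> j - \<alpha> i) div 2) else 0)"
proof -
  have "cf (widen \<alpha> \<beta> X $$ (i, j)) t = cf (dilate 2 (X $$ (i, j))) (t - (\<alpha> i - \<beta> j))"
    using assms by (simp add: widen_def cf_mult_lmonom)
  also have "t - (\<alpha> i - \<beta> j) = t + \<beta> j - \<alpha> i" by simp
  finally show ?thesis by (simp add: cf_dilate)
qed

lemma cf_widen_double:
  assumes "i < dim_row X" "j < dim_col X"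
  shows "cf (widen \<alpha> \<beta> X $$ (i, j)) (2 * k - \<beta> j + \<alpha> i) = cf (X $$ (i, j)) k"
  by (simp add: cf_widen[OF assms])

lemma cf_widen_nonzero:
  assumes "i < dim_row X" "j < dim_col X" "cf (widen \<alpha> \<beta> X $$ (i, j)) t \<noteq> 0"
  obtains k where "t = 2 * k - \<beta> j + \<alpha> i" "cf (X $$ (i, j)) k \<noteq> 0"
proof
  show "t = 2 * ((t + \<beta> j - \<alpha> i) div 2) - \<beta> j + \<alpha> i" "cf (X $$ (i, j)) ((t + \<beta> j - \<alpha> i) div 2) \<noteq> 0"
    using assms by (auto simp: cf_widen split: if_splits)
qed

lemma cf_narrow:
  assumes "i < dim_row X" "j < dim_col X"
  shows "cf (narrow \<alpha> \<beta> X $$ (i, j)) k = cf (X $$ (i, j)) (2 * k - \<beta> j + \<alpha> i)"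
proof -
  have "inj (\<lambda>k. 2 * k - \<beta> j + \<alpha> i)" by (auto simp: inj_def)
  then show ?thesis using assms by (simp add: narrow_def map_key.rep_eq)
qed

lemma widen_narrow:
  assumes "graded \<epsilon> (\<lambda>i. odd (\<alpha> i)) \<delta> (\<lambda>j. odd (\<beta> j)) X"
  shows "widen \<alpha> \<beta> (narrow \<alpha> \<beta> X) = X"
proof (rule eq_matI)
  fix i j assume "i < dim_row X" "j < dim_col X"
  then have ij: "i < dim_row X" "j < dim_col X" "i < dim_row (narrow \<alpha> \<beta> X)" "j < dim_col (narrow \<alpha> \<beta> X)"
    by (auto simp: narrow_def)
  show "widen \<alpha> \<beta> (narrow \<alpha> \<beta> X) $$ (i, j) = X $$ (i, j)"
  proof (rule poly_mapping_eqI)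
    fix t
    have "even (t + \<beta> j - \<alpha> i)" if "cf (X $$ (i, j)) t \<noteq> 0"
      using assms ij(1,2) that unfolding graded_def by fastforce
    then show "cf (widen \<alpha> \<beta> (narrow \<alpha> \<beta> X) $$ (i, j)) t = cf (X $$ (i, j)) t"
      by (auto simp: cf_widen[OF ij(3,4)] cf_narrow[OF ij(1,2)])
  qed
qed (auto simp: narrow_def)

lemma widen_inject:
  assumes "widen \<alpha> \<beta> X = widen \<alpha> \<beta> Y"
  shows "X = Y"
proof -
  have dims: "dim_row X = dim_row Y" "dim_col X = dim_col Y"
    using assms by (metis dim_widen)+
  show ?thesis
  proof (rule eq_matI)
    fix i j assume "i < dim_row Y" "j < dim_col Y"
    then show "X $$ (i, j) = Y $$ (i, j)"
      using dims assms by (intro poly_mapping_eqI) (metis cf_widen_double)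
  qed (use dims in auto)
qed

text \<open>The inner offset cancels between the factors, so it can be chosen freely.\<close>

lemma widen_mult:
  assumes "X \<in> carrier_mat n m" "Y \<in> carrier_mat m k"
  shows "widen \<alpha> \<gamma> (X * Y) = widen \<alpha> \<beta> X * widen \<beta> \<gamma> Y"
proof (rule eq_matI)
  fix i j assume "i < dim_row (widen \<alpha> \<beta> X * widen \<beta> \<gamma> Y)" "j < dim_col (widen \<alpha> \<beta> X * widen \<beta> \<gamma> Y)"
  then have ij: "i < n" "j < k" using assms by auto
  have "widen \<alpha> \<gamma> (X * Y) $$ (i, j) = (\<Sum>l<m. dilate 2 (X $$ (i, l)) * dilate 2 (Y $$ (l, j))) * lmonom 1 (\<alpha> i - \<gamma> j)"
    using assms ij by (simp add: widen_def mat_mult_index[of _ _ _ _ m] dilate_sum dilate_mult del: index_mult_mat(1))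
  also have "\<dots> = (\<Sum>l<m. (dilate 2 (X $$ (i, l)) * lmonom 1 (\<alpha> i - \<beta> l)) * (dilate 2 (Y $$ (l, j)) * lmonom 1 (\<beta> l - \<gamma> j)))"
    unfolding sum_distrib_right
  proof (rule sum.cong)
    fix l
    have "lmonom 1 (\<alpha> i - \<gamma> j) = lmonom 1 (\<alpha> i - \<beta> l) * lmonom 1 (\<beta> l - \<gamma> j)"
      by (simp add: mult_single)
    then show "dilate 2 (X $$ (i, l)) * dilate 2 (Y $$ (l, j)) * lmonom 1 (\<alpha> i - \<gamma> j) =
      (dilate 2 (X $$ (i, l)) * lmonom 1 (\<alpha> i - \<beta> l)) * (dilate 2 (Y $$ (l, j)) * lmonom 1 (\<beta> l - \<gamma> j))"
      by (simp only: mult_ac)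
  qed simp
  also have "\<dots> = (widen \<alpha> \<beta> X * widen \<beta> \<gamma> Y) $$ (i, j)"
    using assms ij by (simp add: mat_mult_index[of _ _ _ _ m] widen_def del: index_mult_mat(1))
  finally show "widen \<alpha> \<gamma> (X * Y) $$ (i, j) = (widen \<alpha> \<beta> X * widen \<beta> \<gamma> Y) $$ (i, j)" .
qed (use assms in auto)

lemma widen_mstar: "widen \<beta> \<alpha> (mstar X) = mstar (widen \<alpha> \<beta> X)"
proof (rule eq_matI)
  fix i j assume "i < dim_row (mstar (widen \<alpha> \<beta> X))" "j < dim_col (mstar (widen \<alpha> \<beta> X))"
  then have ij: "j < dim_row X" "i < dim_col X" by auto
  show "widen \<beta> \<alpha> (mstar X) $$ (i, j) = mstar (widen \<alpha> \<beta> X) $$ (i, j)"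
  proof (rule poly_mapping_eqI)
    fix t
    show "cf (widen \<beta> \<alpha> (mstar X) $$ (i, j)) t = cf (mstar (widen \<alpha> \<beta> X) $$ (i, j)) t"
    proof (cases "even (t + \<alpha> j - \<beta> i)")
      case True
      then obtain k where "t + \<alpha> j - \<beta> i = 2 * k" by blast
      then have t: "t = 2 * k - \<alpha> j + \<beta> i" and "- t = 2 * (- k) - \<beta> i + \<alpha> j" by auto
      then have "cf (widen \<alpha> \<beta> X $$ (j, i)) (- t) = cf (X $$ (j, i)) (- k)"
        using cf_widen_double[OF ij, of \<alpha> \<beta> "- k"] by simp
      moreover have "cf (widen \<beta> \<alpha> (mstar X) $$ (i, j)) t = cf (mstar X $$ (i, j)) k"
        using cf_widen_double[of i "mstar X" j \<beta> \<alpha> k] ij t by simp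
      ultimately show ?thesis using ij by (simp add: lookup_lstar)
    next
      case False
      then have "odd (- t + \<beta> i - \<alpha> j)" by presburger
      then show ?thesis using ij False by (simp add: cf_widen lookup_lstar)
    qed
  qed
qed auto

lemma widen_one: "widen \<alpha> \<alpha> (1\<^sub>m n) = 1\<^sub>m n"
proof (rule eq_matI)
  fix i j assume "i < dim_row (1\<^sub>m n)" "j < dim_col (1\<^sub>m n)"
  moreover have "dilate 2 1 = 1" using dilate_lmonom[where d = 2 and c = 1 and n = 0] by simp
  ultimately show "widen \<alpha> \<alpha> (1\<^sub>m n) $$ (i, j) = 1\<^sub>m n $$ (i, j)"
    by (simp add: widen_def one_mat_def)
qed auto

lemma widen_gram:
  assumes "X \<in> carrier_mat n m"
  shows "X * mstar X = 1\<^sub>m n \<longleftrightarrow> widen \<alpha> \<beta> X * mstar (widen \<alpha> \<beta> X) = 1\<^sub>m n"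
proof -
  have "widen \<alpha> \<alpha> (X * mstar X) = widen \<alpha> \<beta> X * mstar (widen \<alpha> \<beta> X)"
    using widen_mult[OF assms mstar_carrier[OF assms]] widen_mstar by metis
  then show ?thesis by (metis widen_inject widen_one)
qed

text \<open>Compatible symmetry in coefficients, with explicit data: the row vectors have symmetries
  \<open>\<epsilon> i z^(\<alpha> i)\<close> and \<open>\<delta> j z^(\<beta> j)\<close>, the first
  of which enters through its adjoint. Zero entries need no separate convention in this
  form.\<close>

definition symmetric_mat :: "(nat \<Rightarrow> complex) \<Rightarrow> (nat \<Rightarrow> int) \<Rightarrow> (nat \<Rightarrow> complex) \<Rightarrow> (nat \<Rightarrow> int) \<Rightarrow> laurent mat \<Rightarrow> bool" where
  "symmetric_mat \<epsilon> \<alpha> \<delta> \<beta> X \<longleftrightarrow> (\<forall>i<dim_row X. \<forall>j<dim_col X. \<forall>k.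
     cf (X $$ (i, j)) (\<beta> j - \<alpha> i - k) = \<epsilon> i * \<delta> j * cf (X $$ (i, j)) k)"

lemma symmetric_matD:
  "symmetric_mat \<epsilon> \<alpha> \<delta> \<beta> X \<Longrightarrow> X \<in> carrier_mat n m \<Longrightarrow> i < n \<Longrightarrow> j < m \<Longrightarrow>
    cf (X $$ (i, j)) (\<beta> j - \<alpha> i - k) = \<epsilon> i * \<delta> j * cf (X $$ (i, j)) k"
  by (auto simp: symmetric_mat_def)

text \<open>In t = 2 k - \<beta> j + \<alpha> i the reflection of k becomes t \<mapsto> -t, and the
  parity of t is that of \<alpha> i - \<beta> j.\<close>

lemma graded_widen:
  "graded \<epsilon> (\<lambda>i. odd (\<alpha> i)) \<delta> (\<lambda>j. odd (\<beta> j)) (widen \<alpha> \<beta> X) \<longleftrightarrow> symmetric_mat \<epsilon> \<alpha> \<delta> \<beta> X"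
proof
  assume gr: "graded \<epsilon> (\<lambda>i. odd (\<alpha> i)) \<delta> (\<lambda>j. odd (\<beta> j)) (widen \<alpha> \<beta> X)"
  show "symmetric_mat \<epsilon> \<alpha> \<delta> \<beta> X"
    unfolding symmetric_mat_def
  proof (intro allI impI)
    fix i j k assume ij: "i < dim_row X" "j < dim_col X"
    have "- (2 * k - \<beta> j + \<alpha> i) = 2 * (\<beta> j - \<alpha> i - k) - \<beta> j + \<alpha> i" by simp
    then show "cf (X $$ (i, j)) (\<beta> j - \<alpha> i - k) = \<epsilon> i * \<delta> j * cf (X $$ (i, j)) k"
      using gr ij by (metis cf_widen_double dim_widen graded_def)
  qed
next
  assume sym: "symmetric_mat \<epsilon> \<alpha> \<delta> \<beta> X"
  show "graded \<epsilon> (\<lambda>i. odd (\<alpha> i)) \<delta> (\<lambda>j. odd (\<beta> j)) (widen \<alpha> \<beta> X)"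
    unfolding graded_def
  proof (intro allI impI conjI)
    fix i j t assume "i < dim_row (widen \<alpha> \<beta> X)" "j < dim_col (widen \<alpha> \<beta> X)"
    then have ij: "i < dim_row X" "j < dim_col X" by auto
    show "cf (widen \<alpha> \<beta> X $$ (i, j)) (- t) = \<epsilon> i * \<delta> j * cf (widen \<alpha> \<beta> X $$ (i, j)) t"
    proof (cases "even (t + \<beta> j - \<alpha> i)")
      case True
      then obtain k where "t + \<beta> j - \<alpha> i = 2 * k" by blast
      then have t: "t = 2 * k - \<beta> j + \<alpha> i" "- t = 2 * (\<beta> j - \<alpha> i - k) - \<beta> j + \<alpha> i" by auto
      show ?thesis unfolding t(2) unfolding t(1) cf_widen_double[OF ij]
        using sym ij by (simp add: symmetric_mat_def)
    next
      case False
      then have "odd (- t + \<beta> j - \<alpha> i)" by presburger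
      then show ?thesis using ij False by (simp add: cf_widen)
    qed
    show "odd t \<longleftrightarrow> odd (\<alpha> i) \<noteq> odd (\<beta> j)" if "cf (widen \<alpha> \<beta> X $$ (i, j)) t \<noteq> 0"
      using cf_widen_nonzero[OF ij that] by (metis even_add even_mult_iff even_numeral odd_even_add even_diff)
  qed
qed

lemma symmetric_mat_mult:
  assumes X: "symmetric_mat \<epsilon> \<alpha> \<delta> \<beta> X" "X \<in> carrier_mat n m" and Y: "symmetric_mat \<delta> \<beta> \<eta> \<gamma> Y" "Y \<in> carrier_mat m k"
    and \<delta>: "\<forall>l<m. \<delta> l \<in> {1, -1}"
  shows "symmetric_mat \<epsilon> \<alpha> \<eta> \<gamma> (X * Y)"
  using graded_mult[OF _ widen_carrier[OF X(2)] _ widen_carrier[OF Y(2)] \<delta>] X(1) Y(1)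
  unfolding graded_widen[symmetric] widen_mult[OF X(2) Y(2), where \<beta> = \<beta>] by blast

lemma symmetric_mat_mstar:
  assumes X: "symmetric_mat \<epsilon> \<alpha> \<delta> \<beta> X" "X \<in> carrier_mat n m"
    and "\<forall>i<n. \<epsilon> i \<in> {1, -1}" "\<forall>l<m. \<delta> l \<in> {1, -1}"
  shows "symmetric_mat \<delta> \<beta> \<epsilon> \<alpha> (mstar X)"
  unfolding symmetric_mat_def
proof (intro allI impI)
  fix i j k assume "i < dim_row (mstar X)" "j < dim_col (mstar X)"
  then have ij: "i < m" "j < n" using X(2) by auto
  have "cf (X $$ (j, i)) (\<beta> i - \<alpha> j - (- k)) = \<epsilon> j * \<delta> i * cf (X $$ (j, i)) (- k)"
    using symmetric_matD[OF X ij(2,1)] .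
  moreover have "cnj (\<epsilon> j) = \<epsilon> j" "cnj (\<delta> i) = \<delta> i" using assms ij by auto
  moreover have "- (\<alpha> j - \<beta> i - k) = \<beta> i - \<alpha> j - (- k)" by simp
  ultimately show "cf (mstar X $$ (i, j)) (\<alpha> j - \<beta> i - k) = \<delta> i * \<epsilon> j * cf (mstar X $$ (i, j)) k"
    using X(2) ij by (simp add: lookup_lstar algebra_simps)
qed

lemma has_S_lmonom:
  "has_S p (lmonom e c) \<longleftrightarrow> e \<in> {1, -1} \<and> (\<forall>k. cf p (c - k) = e * cf p k)" if "e \<noteq> 0"
proof -
  have "lmonom e c = lmonom e' c' \<longleftrightarrow> e = e' \<and> c = c'" for e' c'
    using that by (metis lookup_single_eq lookup_single_not_eq)
  then show ?thesis unfolding has_S_def by auto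
qed

lemma symmetric_mat_compatible:
  assumes X: "symmetric_mat \<epsilon> \<alpha> \<delta> \<beta> X" "X \<in> carrier_mat n m"
    and sgn: "\<forall>i<n. \<epsilon> i \<in> {1, -1}" "\<forall>l<m. \<delta> l \<in> {1, -1}"
  shows "compatible_symmetry X"
proof -
  define S1 where "S1 = Matrix.mat 1 n (\<lambda>(_, i). lmonom (\<epsilon> i) (\<alpha> i))"
  define S2 where "S2 = Matrix.mat 1 m (\<lambda>(_, i). lmonom (\<delta> i) (\<beta> i))"
  \<comment> \<open>Zero rows admit every choice of signed monomials, so \<open>S1\<close> and
    \<open>S2\<close> can be prescribed.\<close>
  have "mhas_S (0\<^sub>m 1 n) S1" "mhas_S (0\<^sub>m 1 m) S2"
  proof -
    have "has_S 0 (lmonom e c)" if "e \<in> {1, -1}" for e c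
      using that by (subst has_S_lmonom) auto
    then show "mhas_S (0\<^sub>m 1 n) S1" "mhas_S (0\<^sub>m 1 m) S2"
      using sgn unfolding mhas_S_def S1_def S2_def by auto
  qed
  moreover have "mhas_S X (mstar S1 * S2)"
    unfolding mhas_S_def
  proof (intro conjI allI impI)
    show "mstar S1 * S2 \<in> carrier_mat (dim_row X) (dim_col X)"
      using X(2) by (auto simp: S1_def S2_def)
    fix i j assume "i < dim_row X" "j < dim_col X"
    then have ij: "i < n" "j < m" using X(2) by auto
    have "(mstar S1 * S2) $$ (i, j) = lmonom (\<epsilon> i * \<delta> j) (\<beta> j - \<alpha> i)"
    proof -
      have "cnj (\<epsilon> i) = \<epsilon> i" using sgn ij by auto
      then show ?thesis
        using ij by (simp add: mat_mult_index[of _ _ _ _ 1] S1_def S2_def lstar_lmonom mult_single del: index_mult_mat(1))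
    qed
    moreover have "\<epsilon> i * \<delta> j \<in> {1, -1}"
    proof -
      have "\<epsilon> i = 1 \<or> \<epsilon> i = -1" "\<delta> j = 1 \<or> \<delta> j = -1" using sgn ij by auto
      then show ?thesis by auto
    qed
    ultimately show "has_S (X $$ (i, j)) ((mstar S1 * S2) $$ (i, j))"
      using symmetric_matD[OF X ij] by (simp only:) (subst has_S_lmonom, auto)
  qed
  moreover have "dim_row X = n" "dim_col X = m" using X(2) by auto
  ultimately show ?thesis
    unfolding compatible_symmetry_def by (metis zero_carrier_mat)
qed

subsection \<open>Support lengths\<close>

lemma support_length_ge:
  assumes "finite K" "k \<in> K" "k' \<in> K"
  shows "ereal (real_of_int (k - k')) \<le> support_length K"
proof -
  have "k \<le> Max K" "Min K \<le> k'" using assms by auto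
  then have "k - k' \<le> Max K - Min K" by linarith
  then show ?thesis using assms by (auto simp: support_length_def simp flip: of_int_diff)
qed

lemma support_length_le:
  assumes "finite K" "\<And>k k'. k \<in> K \<Longrightarrow> k' \<in> K \<Longrightarrow> k - k' \<le> n"
  shows "support_length K \<le> ereal (real_of_int n)"
proof (cases "K = {}")
  case False
  then have "Max K - Min K \<le> n" using assms by (intro assms(2) Max_in Min_in)
  then show ?thesis using False by (simp add: support_length_def)
qed (simp add: support_length_def)

lemma mkeys_iff:
  "X \<in> carrier_mat n m \<Longrightarrow> k \<in> mkeys X \<longleftrightarrow> (\<exists>i<n. \<exists>j<m. cf (X $$ (i, j)) k \<noteq> 0)"
  by (auto simp: mkeys_def in_keys_iff)

lemma finite_mkeys: "finite (mkeys X)"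
  by (auto simp: mkeys_def)

definition bounded_above :: "(nat \<Rightarrow> int) \<Rightarrow> int \<Rightarrow> laurent mat \<Rightarrow> bool" where
  "bounded_above \<beta> \<sigma> X \<longleftrightarrow> (\<forall>i<dim_row X. \<forall>j<dim_col X. \<forall>k. cf (X $$ (i, j)) k \<noteq> 0 \<longrightarrow> 2 * k + \<beta> i \<le> \<sigma>)"

lemma bounded_by_widen: "bounded_by \<sigma> (widen \<beta> (\<lambda>_. 0) X) \<longleftrightarrow> bounded_above \<beta> \<sigma> X"
proof
  assume b: "bounded_by \<sigma> (widen \<beta> (\<lambda>_. 0) X)"
  show "bounded_above \<beta> \<sigma> X"
    unfolding bounded_above_def
  proof (intro allI impI)
    fix i j k assume ij: "i < dim_row X" "j < dim_col X" and "cf (X $$ (i, j)) k \<noteq> 0"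
    then have "cf (widen \<beta> (\<lambda>_. 0) X $$ (i, j)) (2 * k + \<beta> i) \<noteq> 0"
      using cf_widen_double[OF ij, of \<beta> "\<lambda>_. 0" k] by simp
    then show "2 * k + \<beta> i \<le> \<sigma>" using b ij by (auto simp: bounded_by_def)
  qed
next
  assume b: "bounded_above \<beta> \<sigma> X"
  show "bounded_by \<sigma> (widen \<beta> (\<lambda>_. 0) X)"
    unfolding bounded_by_def
  proof (intro allI impI)
    fix i j t assume "i < dim_row (widen \<beta> (\<lambda>_. 0) X)" "j < dim_col (widen \<beta> (\<lambda>_. 0) X)"
      and nz: "cf (widen \<beta> (\<lambda>_. 0) X $$ (i, j)) t \<noteq> 0"
    then have ij: "i < dim_row X" "j < dim_col X" by auto
    obtain k where "t = 2 * k - 0 + \<beta> i" "cf (X $$ (i, j)) k \<noteq> 0"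
      using cf_widen_nonzero[OF ij nz] by metis
    then show "t \<le> \<sigma>" using b ij by (auto simp: bounded_above_def)
  qed
qed

lemma dim_narrow [simp]: "dim_row (narrow \<alpha> \<beta> X) = dim_row X" "dim_col (narrow \<alpha> \<beta> X) = dim_col X"
  by (auto simp: narrow_def)

subsection \<open>Reduction to a constant matrix\<close>

locale offset_rows = conj_sqrt_field F for F +
  fixes r s :: nat and \<epsilon> \<delta> :: "nat \<Rightarrow> complex" and \<alpha> :: "nat \<Rightarrow> int"
  assumes row_sign: "\<forall>i<r. \<epsilon> i \<in> {1, -1}" and col_sign: "\<forall>j<s. \<delta> j \<in> {1, -1}"
    and row_offset: "\<forall>i<r. \<alpha> i \<in> {0, -1}" and r: "r \<ge> 1"
begin

sublocale symmetric_rows F r s \<epsilon> \<delta> "\<lambda>i. odd (\<alpha> i)"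
  by unfold_locales (use row_sign col_sign in auto)

definition isometric_at :: "(nat \<Rightarrow> int) \<Rightarrow> laurent mat \<Rightarrow> bool" where
  "isometric_at \<beta> Q \<longleftrightarrow> Q \<in> carrier_mat r s \<and> Q * mstar Q = 1\<^sub>m r \<and> coeffs_in F Q \<and> symmetric_mat \<epsilon> \<alpha> \<delta> \<beta> Q"

definition shift_step :: "(nat \<Rightarrow> int) \<Rightarrow> (nat \<Rightarrow> int) \<Rightarrow> laurent mat \<Rightarrow> bool" where
  "shift_step \<beta> \<beta>' A \<longleftrightarrow> paraunitary s A \<and> coeffs_in F A \<and> symmetric_mat \<delta> \<beta> \<delta> \<beta>' A"

definition degree_le :: "(nat \<Rightarrow> int) \<Rightarrow> int \<Rightarrow> laurent mat \<Rightarrow> bool" where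
  "degree_le \<beta> n Q \<longleftrightarrow> (\<forall>i<r. \<forall>j<s. \<forall>k. cf (Q $$ (i, j)) k \<noteq> 0 \<longrightarrow> \<bar>2 * k - \<beta> j + \<alpha> i\<bar> \<le> n)"

definition degree_eq :: "(nat \<Rightarrow> int) \<Rightarrow> int \<Rightarrow> laurent mat \<Rightarrow> bool" where
  "degree_eq \<beta> n Q \<longleftrightarrow> degree_le \<beta> n Q \<and> (\<exists>i<r. \<exists>j<s. \<exists>k. cf (Q $$ (i, j)) k \<noteq> 0 \<and> \<bar>2 * k - \<beta> j + \<alpha> i\<bar> = n)"

definition preserves_above :: "(nat \<Rightarrow> int) \<Rightarrow> (nat \<Rightarrow> int) \<Rightarrow> laurent mat \<Rightarrow> laurent mat \<Rightarrow> bool" where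
  "preserves_above \<beta> \<beta>' Q A \<longleftrightarrow> (\<forall>X \<sigma>. X \<in> carrier_mat s 1 \<longrightarrow> bounded_above \<beta> \<sigma> X \<longrightarrow>
     bounded_above \<alpha> \<sigma> (Q * X) \<longrightarrow> bounded_above \<beta>' \<sigma> (mstar A * X))"

lemma isometric_atD: "isometric_at \<beta> Q \<Longrightarrow> Q \<in> carrier_mat r s"
  by (simp add: isometric_at_def)

lemma shift_stepD: "shift_step \<beta> \<beta>' A \<Longrightarrow> A \<in> carrier_mat s s"
  by (auto simp: shift_step_def dest: paraunitary_carrier)

lemma coeffs_in_widen: "coeffs_in F X \<Longrightarrow> coeffs_in F (widen \<beta> \<gamma> X)"
  by (auto simp: coeffs_in_def cf_widen)

lemma isometric_widen: "isometric_at \<beta> Q \<Longrightarrow> isometric (\<lambda>j. odd (\<beta> j)) (widen \<alpha> \<beta> Q)"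
  by (simp add: isometric_at_def isometric_def graded_widen coeffs_in_widen widen_gram[of Q r s \<alpha> \<beta>, symmetric])

lemma isometric_at_mult: "isometric_at \<beta> Q \<Longrightarrow> shift_step \<beta> \<beta>' A \<Longrightarrow> isometric_at \<beta>' (Q * A)"
  unfolding isometric_at_def shift_step_def
  using orthonormal_rows_mult[of Q r s A] coeffs_in_mult[of Q A r s s]
    symmetric_mat_mult[of \<epsilon> \<alpha> \<delta> \<beta> Q r s \<delta> \<beta>' A s] col_sign
  by (auto dest: paraunitary_carrier)

lemma shift_step_mult: "shift_step \<beta> \<beta>' A \<Longrightarrow> shift_step \<beta>' \<beta>'' B \<Longrightarrow> shift_step \<beta> \<beta>'' (A * B)"
  unfolding shift_step_def
  using paraunitary_mult[of s A B] coeffs_in_mult[of A B s s s]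
    symmetric_mat_mult[of \<delta> \<beta> \<delta> \<beta>' A s s \<delta> \<beta>'' B s] col_sign
  by (auto dest: paraunitary_carrier)

lemma shift_step_one: "shift_step \<beta> \<beta> (1\<^sub>m s)"
proof -
  have "symmetric_mat \<delta> \<beta> \<delta> \<beta> (1\<^sub>m s)"
    using column_step_one[of "\<lambda>j. odd (\<beta> j)"]
    by (subst graded_widen[symmetric]) (simp add: widen_one column_step_def)
  then show ?thesis by (simp add: shift_step_def paraunitary_one coeffs_in_one)
qed

lemma preserves_above_one: "preserves_above \<beta> \<beta> Q (1\<^sub>m s)"
  by (simp add: preserves_above_def)

lemma preserves_above_mult:
  assumes A: "shift_step \<beta> \<beta>' A" "preserves_above \<beta> \<beta>' Q A"
    and B: "shift_step \<beta>' \<beta>'' B" "preserves_above \<beta>' \<beta>'' (Q * A) B"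
    and Q: "Q \<in> carrier_mat r s"
  shows "preserves_above \<beta> \<beta>'' Q (A * B)"
  unfolding preserves_above_def
proof (intro allI impI)
  fix X \<sigma> assume X: "X \<in> carrier_mat s 1" "bounded_above \<beta> \<sigma> X" "bounded_above \<alpha> \<sigma> (Q * X)"
  have Ac: "A \<in> carrier_mat s s" and Bc: "B \<in> carrier_mat s s" using A B by (auto dest: shift_stepD)
  have Y: "mstar A * X \<in> carrier_mat s 1" using Ac X(1) by (intro mult_carrier_mat[OF mstar_carrier])
  have "Q * A * (mstar A * X) = Q * A * mstar A * X"
    using assoc_mult_mat[OF mult_carrier_mat[OF Q Ac] mstar_carrier[OF Ac] X(1)] by simp
  also have "\<dots> = Q * X" using A(1) by (simp add: mult_mstar_cancel[OF Q] shift_step_def)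
  finally have "bounded_above \<beta>'' \<sigma> (mstar B * (mstar A * X))"
    using A(2) B(2) X Y by (auto simp: preserves_above_def)
  also have "mstar B * (mstar A * X) = mstar (A * B) * X"
    using assoc_mult_mat[OF mstar_carrier[OF Bc] mstar_carrier[OF Ac] X(1)] by (simp add: mstar_mult[OF Ac Bc])
  finally show "bounded_above \<beta>'' \<sigma> (mstar (A * B) * X)" .
qed

lemma isometric_nonzero:
  assumes "isometric b Q"
  obtains i j t where "i < r" "j < s" "cf (Q $$ (i, j)) t \<noteq> 0"
proof -
  have Q: "Q \<in> carrier_mat r s" "Q * mstar Q = 1\<^sub>m r" using assms by (auto simp: isometric_def)
  then have "cf ((Q * mstar Q) $$ (0, 0)) 0 \<noteq> 0" using r by simp
  then show thesis using that Q(1) r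
    by (elim mat_mult_cf_nonzero[rotated 4, where n = s]) auto
qed

text \<open>The new degree \<open>n'\<close> has to be exact, not just at most n - 1: its parity
  selects the offsets of the odd columns, and with these the support length equals the
  degree.\<close>

lemma degree_step:
  assumes Q: "isometric_at \<beta> Q" "degree_le \<beta> n Q" and n: "n \<ge> 1" and \<beta>: "\<forall>j<s. \<beta> j \<in> {-1, 0, 1}"
  obtains A \<beta>' n' where "shift_step \<beta> \<beta>' A" "mkeys A \<subseteq> {-1..1}" "preserves_above \<beta> \<beta>' Q A"
    "0 \<le> n'" "n' < n" "degree_eq \<beta>' n' (Q * A)" "\<forall>j<s. \<beta>' j \<in> {0, if even n' then -1 else 1}"
proof -
  let ?b = "\<lambda>j. odd (\<beta> j)"
  define W where "W = widen \<alpha> \<beta> Q"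
  have Qc: "Q \<in> carrier_mat r s" using Q(1) by (rule isometric_atD)
  have W: "isometric ?b W" unfolding W_def using Q(1) by (rule isometric_widen)
  have "row_degrees (\<lambda>_. n) W"
    unfolding row_degrees_def W_def
  proof (intro allI impI)
    fix i j t assume ij: "i < r" "j < s" and nz: "cf (widen \<alpha> \<beta> Q $$ (i, j)) t \<noteq> 0"
    have "i < dim_row Q" "j < dim_col Q" using ij Qc by auto
    then obtain k where "t = 2 * k - \<beta> j + \<alpha> i" "cf (Q $$ (i, j)) k \<noteq> 0"
      using nz by (elim cf_widen_nonzero)
    then show "\<bar>t\<bar> \<le> n" using ij Q(2) by (auto simp: degree_le_def)
  qed
  then obtain B b' where B: "column_step ?b b' B"
    and keys: "\<And>i j t. i < s \<Longrightarrow> j < s \<Longrightarrow> cf (B $$ (i, j)) t \<noteq> 0 \<Longrightarrow> \<bar>t\<bar> \<le> of_bool (even (\<beta> i)) + of_bool (\<not> b' j)"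
    and deg: "row_degrees (\<lambda>_. n - 1) (W * B)" and top: "top_preserving s W B"
    using lower_degree[OF W _ n] by (metis (no_types, lifting))
  have WB: "isometric b' (W * B)" using isometric_mult[OF W B] .
  have Bc: "B \<in> carrier_mat s s" using B by (auto simp: column_step_def dest: paraunitary_carrier)
  define T where "T = (\<Union>i<r. \<Union>j<s. abs ` Poly_Mapping.keys ((W * B) $$ (i, j)))"
  define n' where "n' = Max T"
  have T: "x \<in> T \<longleftrightarrow> (\<exists>i<r. \<exists>j<s. \<exists>t. cf ((W * B) $$ (i, j)) t \<noteq> 0 \<and> x = \<bar>t\<bar>)" for x
    unfolding T_def by (fastforce simp: in_keys_iff image_iff)
  have finT: "finite T" by (simp add: T_def)
  obtain i0 j0 t0 where "i0 < r" "j0 < s" "cf ((W * B) $$ (i0, j0)) t0 \<noteq> 0"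
    using isometric_nonzero[OF WB] .
  then have neT: "T \<noteq> {}" using T by blast
  have n'T: "n' \<in> T" unfolding n'_def using finT neT by (rule Max_in)
  have n'_ge: "\<bar>t\<bar> \<le> n'" if "i < r" "j < s" "cf ((W * B) $$ (i, j)) t \<noteq> 0" for i j t
    unfolding n'_def using finT T that by (intro Max_ge) blast+
  have n': "0 \<le> n'" "n' < n" using n'T deg unfolding T row_degrees_def by fastforce+
  \<comment> \<open>The reduction in w determines only the parity of the new offsets; the choice
    between -1 and 1 is free and is made for the sake of \<open>mclen_le\<close>.\<close>
  define \<beta>' where "\<beta>' j = (if b' j then (if even n' then -1 else 1) else 0 :: int)" for j
  have \<beta>'b: "(\<lambda>j. odd (\<beta>' j)) = b'" by (auto simp: \<beta>'_def)
  have Bgr: "graded \<delta> ?b \<delta> (\<lambda>j. odd (\<beta>' j)) B" using B by (simp add: column_step_def \<beta>'b)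
  define A where "A = narrow \<beta> \<beta>' B"
  have wA: "widen \<beta> \<beta>' A = B" unfolding A_def by (rule widen_narrow[OF Bgr])
  have Ac: "A \<in> carrier_mat s s" unfolding A_def using Bc by simp
  have "A * mstar A = 1\<^sub>m s"
    using B widen_gram[OF Ac, of \<beta> \<beta>'] by (simp add: wA column_step_def paraunitary_iff)
  moreover have "coeffs_in F A"
    using B Bc unfolding A_def column_step_def coeffs_in_def by (auto simp: cf_narrow)
  moreover have "symmetric_mat \<delta> \<beta> \<delta> \<beta>' A"
    using Bgr by (simp add: graded_widen[symmetric] wA)
  ultimately have A: "shift_step \<beta> \<beta>' A" using Ac by (simp add: shift_step_def paraunitary_iff)
  have cfA: "cf (A $$ (i, j)) k = cf (B $$ (i, j)) (2 * k - \<beta>' j + \<beta> i)" if "i < s" "j < s" for i j k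
    unfolding A_def using that Bc by (simp add: cf_narrow)
  have "k \<in> {-1..1}" if kA: "k \<in> mkeys A" for k
  proof -
    obtain i j where ij: "i < s" "j < s" "cf (A $$ (i, j)) k \<noteq> 0"
      using kA unfolding mkeys_iff[OF Ac] by blast
    \<comment> \<open>Two zero offsets give \<bar>2 k\<bar> \<le> 2, one odd offset gives an odd
      number of modulus at most 1, and two odd offsets give 2 k = \<beta>' j - \<beta> i. In each
      case \<bar>k\<bar> \<le> 1.\<close>
    then have "\<bar>2 * k - \<beta>' j + \<beta> i\<bar> \<le> of_bool (even (\<beta> i)) + of_bool (\<not> b' j)"
      using keys cfA by metis
    moreover have "\<beta> i = -1 \<or> \<beta> i = 0 \<or> \<beta> i = 1" using \<beta> ij by auto
    ultimately show ?thesis by (auto simp: \<beta>'_def split: if_splits)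
  qed
  then have mA: "mkeys A \<subseteq> {-1..1}" by blast
  have wQA: "widen \<alpha> \<beta>' (Q * A) = W * B"
    unfolding W_def wA[symmetric] by (rule widen_mult[OF Qc Ac])
  have QAc: "Q * A \<in> carrier_mat r s" using Qc Ac by (rule mult_carrier_mat)
  have "degree_eq \<beta>' n' (Q * A)"
    unfolding degree_eq_def degree_le_def
  proof (intro conjI allI impI)
    fix i j k assume ij: "i < r" "j < s" and nz: "cf ((Q * A) $$ (i, j)) k \<noteq> 0"
    have "cf ((W * B) $$ (i, j)) (2 * k - \<beta>' j + \<alpha> i) \<noteq> 0"
      using cf_widen_double[of i "Q * A" j \<alpha> \<beta>' k] QAc ij nz unfolding wQA carrier_matD[OF QAc] by metis
    then show "\<bar>2 * k - \<beta>' j + \<alpha> i\<bar> \<le> n'" using n'_ge ij by blast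
  next
    obtain i j t where ij: "i < r" "j < s" and t: "cf ((W * B) $$ (i, j)) t \<noteq> 0" "n' = \<bar>t\<bar>"
      using n'T T by auto
    have "i < dim_row (Q * A)" "j < dim_col (Q * A)" using ij QAc by auto
    then obtain k where "t = 2 * k - \<beta>' j + \<alpha> i" "cf ((Q * A) $$ (i, j)) k \<noteq> 0"
      using t(1) unfolding wQA[symmetric] by (elim cf_widen_nonzero)
    then show "\<exists>i<r. \<exists>j<s. \<exists>k. cf ((Q * A) $$ (i, j)) k \<noteq> 0 \<and> \<bar>2 * k - \<beta>' j + \<alpha> i\<bar> = n'"
      using ij t by blast
  qed
  moreover have "preserves_above \<beta> \<beta>' Q A"
    unfolding preserves_above_def
  proof (intro allI impI)
    fix X \<sigma> assume X: "X \<in> carrier_mat s 1" "bounded_above \<beta> \<sigma> X" "bounded_above \<alpha> \<sigma> (Q * X)"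
    have "bounded_by \<sigma> (W * widen \<beta> (\<lambda>_. 0) X)"
      using X(3) unfolding W_def bounded_by_widen[symmetric] widen_mult[OF Qc X(1), where \<beta> = \<beta>] .
    then have "bounded_by \<sigma> (mstar B * widen \<beta> (\<lambda>_. 0) X)"
      using top X(1,2) unfolding top_preserving_def bounded_by_widen[symmetric] by auto
    then show "bounded_above \<beta>' \<sigma> (mstar A * X)"
      unfolding bounded_by_widen[symmetric] widen_mult[OF mstar_carrier[OF Ac] X(1), where \<beta> = \<beta>] widen_mstar wA .
  qed
  ultimately show thesis using that[OF A mA] n' by (auto simp: \<beta>'_def)
qed

text \<open>An exponent at which the degree is attained and its mirror image in the same entry lie
  exactly n apart. This holds for any column offsets.\<close>

lemma mclen_ge:
  assumes "isometric_at \<beta> Q" "degree_eq \<beta> n Q"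
  shows "ereal (real_of_int n) \<le> mclen Q"
proof -
  have Qc: "Q \<in> carrier_mat r s" and sym: "symmetric_mat \<epsilon> \<alpha> \<delta> \<beta> Q"
    using assms(1) by (auto simp: isometric_at_def)
  obtain i j k where ij: "i < r" "j < s" and k: "cf (Q $$ (i, j)) k \<noteq> 0" "\<bar>2 * k - \<beta> j + \<alpha> i\<bar> = n"
    using assms(2) by (auto simp: degree_eq_def)
  have "cf (Q $$ (i, j)) (\<beta> j - \<alpha> i - k) \<noteq> 0"
    unfolding symmetric_matD[OF sym Qc ij] using k row_sign col_sign ij by auto
  then have "k \<in> mkeys Q" "\<beta> j - \<alpha> i - k \<in> mkeys Q"
    using k ij by (auto simp: mkeys_iff[OF Qc])
  moreover have "n = k - (\<beta> j - \<alpha> i - k) \<or> n = (\<beta> j - \<alpha> i - k) - k" using k(2) by auto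
  ultimately show ?thesis using support_length_ge[OF finite_mkeys] by metis
qed

text \<open>All entries have their exponents in one common window of length n, although their
  centres of symmetry differ.\<close>

lemma mclen_le:
  assumes Q: "isometric_at \<beta> Q" and "degree_le \<beta> n Q" and \<beta>: "\<forall>j<s. \<beta> j \<in> {0, if even n then -1 else 1}"
  shows "mclen Q \<le> ereal (real_of_int n)"
proof (rule support_length_le[OF finite_mkeys])
  \<comment> \<open>The centring conditions bound 2 k by \<plusminus>n plus \<beta> j - \<alpha> i,
    which lies in {-1, 0, 1} for even n and in {0, 1, 2} for odd n; rounding leaves n + 1 integers.
    For odd n the offset -1 would allow one more.\<close>
  define lo where "lo = (if even n then - (n div 2) else - ((n - 1) div 2))"
  have range: "k \<in> {lo..n + lo}" if "k \<in> mkeys Q" for k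
  proof -
    from that obtain i j where ij: "i < r" "j < s" and k: "cf (Q $$ (i, j)) k \<noteq> 0"
      using Q by (auto simp: mkeys_iff isometric_at_def)
    have "\<bar>2 * k - \<beta> j + \<alpha> i\<bar> \<le> n" using assms(2) ij k by (auto simp: degree_le_def)
    moreover have "\<alpha> i = 0 \<or> \<alpha> i = -1" using row_offset ij by auto
    moreover have "\<beta> j = 0 \<or> \<beta> j = (if even n then -1 else 1)" using \<beta> ij by auto
    ultimately show "k \<in> {lo..n + lo}"
      unfolding lo_def by (cases "even n") (auto elim!: evenE oddE)
  qed
  fix k k' assume "k \<in> mkeys Q" "k' \<in> mkeys Q"
  from range[OF this(1)] range[OF this(2)] show "k - k' \<le> n" by simp
qed

text \<open>The list records the run of the algorithm and \<open>B\<close> its product; the adjoints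
  are folded in the order in which the algorithm builds the extension.\<close>

definition reduction :: "(nat \<Rightarrow> int) \<Rightarrow> laurent mat \<Rightarrow> laurent mat list \<Rightarrow> laurent mat \<Rightarrow> (nat \<Rightarrow> int) \<Rightarrow> bool" where
  "reduction \<beta> Q As B \<beta>' \<longleftrightarrow>
    (\<forall>i<length As. mclen (foldl (*) Q (take i As)) > 0 \<and>
       paraunitary s (As ! i) \<and> compatible_symmetry (As ! i) \<and> mkeys (As ! i) \<subseteq> {-1..1} \<and>
       mclen (foldl (*) Q (take (Suc i) As)) < mclen (foldl (*) Q (take i As))) \<and>
    foldl (*) Q As = Q * B \<and>
    (\<forall>M k. M \<in> carrier_mat s k \<longrightarrow> foldl (\<lambda>M A. mstar A * M) M As = mstar B * M) \<and>
    shift_step \<beta> \<beta>' B \<and> degree_eq \<beta>' 0 (Q * B) \<and> (\<forall>j<s. \<beta>' j \<in> {0, -1}) \<and> preserves_above \<beta> \<beta>' Q B"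

text \<open>A step resets the column offsets to those suited to the new degree, so the initial ones
  may be arbitrary. Only at n = 0, where no step follows, must they already be suited to even
  degree.\<close>

lemma reduction_exists:
  assumes "isometric_at \<beta> Q" "degree_eq \<beta> (int n) Q" "\<forall>j<s. \<beta> j \<in> {-1, 0, 1}" "n = 0 \<longrightarrow> (\<forall>j<s. \<beta> j \<in> {0, -1})"
  shows "\<exists>As B \<beta>'. reduction \<beta> Q As B \<beta>'"
  using assms
proof (induction n arbitrary: Q \<beta> rule: less_induct)
  case (less n)
  have Qc: "Q \<in> carrier_mat r s" using less.prems(1) by (rule isometric_atD)
  show ?case
  proof (cases "n = 0")
    case True
    then show ?thesis
      using less.prems Qc shift_step_one preserves_above_one
      by (intro exI[of _ "[]"] exI[of _ "1\<^sub>m s"] exI[of _ \<beta>]) (auto simp: reduction_def)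
  next
    case False
    obtain A \<beta>1 n' where A: "shift_step \<beta> \<beta>1 A" "mkeys A \<subseteq> {-1..1}" "preserves_above \<beta> \<beta>1 Q A"
      and n': "0 \<le> n'" "n' < int n" and deg: "degree_eq \<beta>1 n' (Q * A)"
      and \<beta>1: "\<forall>j<s. \<beta>1 j \<in> {0, if even n' then -1 else 1}"
      by (rule degree_step[OF less.prems(1) _ _ less.prems(3), of "int n"])
        (use less.prems(2) False in \<open>auto simp: degree_eq_def\<close>)
    have QA: "isometric_at \<beta>1 (Q * A)" using isometric_at_mult[OF less.prems(1) A(1)] .
    have Ac: "A \<in> carrier_mat s s" using A(1) by (rule shift_stepD)
    \<comment> \<open>The lower bound for \<open>Q\<close> holds for any offsets and the upper bound
      for \<open>Q * A\<close> for the new ones. Thus the length drops even if the initial offsets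
      do not match the degree and make \<open>Q\<close> longer than n.\<close>
    have len: "mclen Q > 0" "mclen (Q * A) < mclen Q"
    proof -
      have le: "ereal (real_of_int (int n)) \<le> mclen Q" using mclen_ge[OF less.prems(1,2)] .
      moreover have "(0 :: ereal) < ereal (real_of_int (int n))" using False by simp
      ultimately show "mclen Q > 0" by (rule less_le_trans[rotated])
      have "mclen (Q * A) \<le> ereal (real_of_int n')"
        using mclen_le[OF QA _ \<beta>1] deg by (simp add: degree_eq_def)
      also have "\<dots> < ereal (real_of_int (int n))" using n' by simp
      finally show "mclen (Q * A) < mclen Q" using le by (rule less_le_trans)
    qed
    have "\<exists>As B \<beta>'. reduction \<beta>1 (Q * A) As B \<beta>'"
    proof (rule less.IH)
      show "nat n' < n" using n' by auto
      show "degree_eq \<beta>1 (int (nat n')) (Q * A)" using deg n' by simp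
      show "\<forall>j<s. \<beta>1 j \<in> {-1, 0, 1}" using \<beta>1 by (auto split: if_splits)
      show "nat n' = 0 \<longrightarrow> (\<forall>j<s. \<beta>1 j \<in> {0, -1})" using \<beta>1 n' by auto
    qed (rule QA)
    then obtain As B \<beta>' where red: "reduction \<beta>1 (Q * A) As B \<beta>'" by blast
    then have As: "\<forall>i<length As. mclen (foldl (*) (Q * A) (take i As)) > 0 \<and>
         paraunitary s (As ! i) \<and> compatible_symmetry (As ! i) \<and> mkeys (As ! i) \<subseteq> {-1..1} \<and>
         mclen (foldl (*) (Q * A) (take (Suc i) As)) < mclen (foldl (*) (Q * A) (take i As))"
      and B: "foldl (*) (Q * A) As = Q * A * B"
        "\<And>M k. M \<in> carrier_mat s k \<Longrightarrow> foldl (\<lambda>M A. mstar A * M) M As = mstar B * M"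
        "shift_step \<beta>1 \<beta>' B" "degree_eq \<beta>' 0 (Q * A * B)" "\<forall>j<s. \<beta>' j \<in> {0, -1}" "preserves_above \<beta>1 \<beta>' (Q * A) B"
      by (auto simp: reduction_def)
    have Bc: "B \<in> carrier_mat s s" using B(3) by (rule shift_stepD)
    have assoc: "Q * A * B = Q * (A * B)" using assoc_mult_mat[OF Qc Ac Bc] .
    have "reduction \<beta> Q (A # As) (A * B) \<beta>'"
      unfolding reduction_def
    proof (intro conjI allI impI)
      fix i assume i: "i < length (A # As)"
      have "compatible_symmetry A"
        using A(1) Ac col_sign by (intro symmetric_mat_compatible[of \<delta> \<beta> \<delta> \<beta>1 A s s]) (auto simp: shift_step_def)
      then show "mclen (foldl (*) Q (take i (A # As))) > 0" "paraunitary s ((A # As) ! i)"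
        "compatible_symmetry ((A # As) ! i)" "mkeys ((A # As) ! i) \<subseteq> {-1..1}"
        "mclen (foldl (*) Q (take (Suc i) (A # As))) < mclen (foldl (*) Q (take i (A # As)))"
        using As i A(1,2) len by (cases i; auto simp: shift_step_def)+
    next
      show "foldl (*) Q (A # As) = Q * (A * B)" using B(1) assoc by simp
      fix M :: "laurent mat" and k assume M: "M \<in> carrier_mat s k"
      have "foldl (\<lambda>M A. mstar A * M) M (A # As) = mstar B * (mstar A * M)"
        using B(2)[OF mult_carrier_mat[OF mstar_carrier[OF Ac] M]] by simp
      also have "\<dots> = mstar (A * B) * M"
        using assoc_mult_mat[OF mstar_carrier[OF Bc] mstar_carrier[OF Ac] M] by (simp add: mstar_mult[OF Ac Bc])
      finally show "foldl (\<lambda>M A. mstar A * M) M (A # As) = mstar (A * B) * M" .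
    next
      show "shift_step \<beta> \<beta>' (A * B)" using A(1) B(3) by (rule shift_step_mult)
      show "degree_eq \<beta>' 0 (Q * (A * B))" using B(4) assoc by simp
      show "preserves_above \<beta> \<beta>' Q (A * B)" using preserves_above_mult[OF A(1,3) B(3,6) Qc] .
    qed (use B(5) in auto)
    then show ?thesis by blast
  qed
qed

end

subsection \<open>Matrix extension\<close>

text \<open>Unitary elimination, one row after the other, inside classes of equal labels. The labels
  \<tau> of rows and \<kappa> of columns stand for symmetry types; \<kappa>' records the types of
  the columns of \<open>V\<close>, which become the rows of the extension.\<close>

lemma (in conj_sqrt_field) const_extension:
  fixes \<kappa> :: "nat \<Rightarrow> 'c" and \<tau> :: "nat \<Rightarrow> 'c"
  assumes Q: "Q \<in> carrier_mat r s" "Q * mstar Q = 1\<^sub>m r" "coeffs_in F Q"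
    and const: "\<And>i j t. i < r \<Longrightarrow> j < s \<Longrightarrow> cf (Q $$ (i, j)) t \<noteq> 0 \<Longrightarrow> t = 0 \<and> \<tau> i = \<kappa> j"
  obtains V \<kappa>' where "paraunitary s V" "coeffs_in F V"
    "\<And>i j t. i < s \<Longrightarrow> j < s \<Longrightarrow> cf (V $$ (i, j)) t \<noteq> 0 \<Longrightarrow> t = 0 \<and> \<kappa> i = \<kappa>' j"
    "\<And>i. i < r \<Longrightarrow> \<kappa>' i = \<tau> i" "\<kappa>' ` {..<s} \<subseteq> \<kappa> ` {..<s}" "r \<le> s"
    "Q * V = Matrix.mat r s (\<lambda>(i, j). if i = j then 1 else 0)"
proof -
  have "\<exists>V \<kappa>'. paraunitary s V \<and> coeffs_in F V \<and>
      (\<forall>i<s. \<forall>j<s. \<forall>t. cf (V $$ (i, j)) t \<noteq> 0 \<longrightarrow> t = 0 \<and> \<kappa> i = \<kappa>' j) \<and>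
      (\<forall>i<m. \<kappa>' i = \<tau> i) \<and> \<kappa>' ` {..<s} \<subseteq> \<kappa> ` {..<s} \<and> m \<le> s \<and>
      (\<forall>i<m. \<forall>j<s. (Q * V) $$ (i, j) = (if i = j then 1 else 0))" if "m \<le> r" for m
    using that
  proof (induction m)
    case 0
    show ?case
      using paraunitary_one[of s] coeffs_in_one[of s]
      by (intro exI[of _ "1\<^sub>m s"] exI[of _ \<kappa>]) (auto simp: lookup_one when_def split: if_splits)
  next
    case (Suc m)
    then obtain V \<kappa>' where V: "paraunitary s V" "coeffs_in F V"
      "\<forall>i<s. \<forall>j<s. \<forall>t. cf (V $$ (i, j)) t \<noteq> 0 \<longrightarrow> t = 0 \<and> \<kappa> i = \<kappa>' j"
      "\<forall>i<m. \<kappa>' i = \<tau> i" "\<kappa>' ` {..<s} \<subseteq> \<kappa> ` {..<s}" "m \<le> s"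
      "\<forall>i<m. \<forall>j<s. (Q * V) $$ (i, j) = (if i = j then 1 else 0)"
      by auto
    have Vc: "V \<in> carrier_mat s s" using V(1) by (rule paraunitary_carrier)
    have mr: "m < r" using Suc.prems by simp
    define Q1 where "Q1 = Q * V"
    have Q1c: "Q1 \<in> carrier_mat r s" unfolding Q1_def using Q(1) Vc by (rule mult_carrier_mat)
    have Q1F: "coeffs_in F Q1" unfolding Q1_def using coeffs_in_mult[OF Q(3) V(2) Q(1) Vc] .
    have Q1const: "t = 0 \<and> \<tau> i = \<kappa>' j" if ij: "i < r" "j < s" and nz: "cf (Q1 $$ (i, j)) t \<noteq> 0" for i j t
    proof -
      have dims: "i < dim_row Q" "j < dim_col V" "dim_row V = s" "dim_col Q = s"
        using ij Q(1) Vc by auto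
      obtain l t1 t2 where "l < s" "t = t1 + t2" "cf (Q $$ (i, l)) t1 \<noteq> 0" "cf (V $$ (l, j)) t2 \<noteq> 0"
        using mat_mult_cf_nonzero[OF dims nz[unfolded Q1_def]] by metis
      then show ?thesis using const[of i l t1] V(3) ij by force
    qed
    define x where "x j = cf (Q1 $$ (m, j)) 0" for j
    have gram: "(\<Sum>l<s. cf (Q1 $$ (i, l)) 0 * cnj (cf (Q1 $$ (j, l)) 0)) = (if i = j then 1 else 0)"
      if "i < r" "j < r" for i j
    proof -
      have "cf (Q1 $$ (i, l) * lstar (Q1 $$ (j, l))) (0 + 0) = cf (Q1 $$ (i, l)) 0 * cnj (cf (Q1 $$ (j, l)) 0)"
        if l: "l < s" for l
      proof -
        have "t = 0" if "cf (Q1 $$ (i, l)) t \<noteq> 0" for t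
          using Q1const[OF \<open>i < r\<close> l that] by simp
        moreover have "t = 0" if "cf (lstar (Q1 $$ (j, l))) t \<noteq> 0" for t
          using Q1const[OF \<open>j < r\<close> l, of "- t"] that by (simp add: lookup_lstar)
        ultimately have "cf (Q1 $$ (i, l) * lstar (Q1 $$ (j, l))) (0 + 0) = cf (Q1 $$ (i, l)) 0 * cf (lstar (Q1 $$ (j, l))) 0"
          by (intro cf_mult_top) force+
        then show ?thesis by (simp add: lookup_lstar)
      qed
      then have "(\<Sum>l<s. cf (Q1 $$ (i, l)) 0 * cnj (cf (Q1 $$ (j, l)) 0)) = cf ((Q1 * mstar Q1) $$ (i, j)) 0"
        using that Q1c by (simp add: mat_mult_index[of _ _ _ _ s] lookup_sum del: index_mult_mat(1))
      also have "Q1 * mstar Q1 = 1\<^sub>m r"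
        unfolding Q1_def using orthonormal_rows_mult[OF Q(1,2) V(1)] .
      finally show ?thesis using that by (simp add: one_mat_def)
    qed
    \<comment> \<open>The rows before m are already unit vectors, so orthogonality clears the first
      m entries of row m.\<close>
    have x0: "x j = 0" if "j < m" for j
    proof -
      have "(\<Sum>l<s. x l * cnj (cf (Q1 $$ (j, l)) 0)) = 0"
        using gram[OF mr, of j] that mr by (simp add: x_def)
      also have "(\<Sum>l<s. x l * cnj (cf (Q1 $$ (j, l)) 0)) = (\<Sum>l<s. if l = j then x j else 0)"
        by (rule sum.cong) (use V(7) that in \<open>auto simp: Q1_def simp del: index_mult_mat(1)\<close>)
      finally show ?thesis using that V(6) by simp
    qed
    define C where "C = {j. m \<le> j \<and> j < s \<and> \<kappa>' j = \<tau> m}"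
    have Cs: "C \<subseteq> {..<s}" by (auto simp: C_def)
    have xC: "x j = 0" if "j < s" "j \<notin> C" for j
      using x0[of j] Q1const[OF mr that(1), of 0] that by (cases "j < m") (auto simp: C_def x_def)
    have "complex_of_real (\<Sum>j\<in>C. (cmod (x j))\<^sup>2) = (\<Sum>j\<in>C. x j * cnj (x j))"
      unfolding of_real_sum by (simp only: complex_norm_square)
    also have "\<dots> = (\<Sum>j<s. x j * cnj (x j))"
      by (rule sum.mono_neutral_left) (use Cs xC in auto)
    also have "\<dots> = complex_of_real 1" using gram[OF mr mr] by (simp add: x_def)
    finally have N: "1 = (\<Sum>j\<in>C. (cmod (x j))\<^sup>2)" by (simp only: of_real_eq_iff)
    then obtain p where p: "p \<in> C" by (metis all_not_in_conv sum.empty zero_neq_one)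
    have xF: "x j \<in> F" if "j \<in> C" for j
      using that Cs Q1F Q1c mr by (auto simp: coeffs_in_def x_def)
    obtain h where h: "\<And>i j. i < s \<Longrightarrow> j < s \<Longrightarrow> (\<Sum>l<s. h i l * cnj (h j l)) = (if i = j then 1 else 0)"
      "\<And>i j. h i j \<in> F"
      "\<And>i j. i \<notin> C \<or> j \<notin> C \<Longrightarrow> h i j = (if i = j then 1 else 0)"
      "\<And>j. j < s \<Longrightarrow> (\<Sum>i<s. x i * h i j) = (if j = p then complex_of_real (sqrt 1) else if j \<in> C then 0 else x j)"
      by (rule householder[OF Cs p xF N]) (assumption, simp, rule that)
    \<comment> \<open>The Householder matrix puts the entry 1 into column p; the transposition moves
      it to column m and fixes the columns before m.\<close>
    define \<sigma> where "\<sigma> = Transposition.transpose m p"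
    have p': "m \<le> p" "p < s" "\<kappa>' p = \<tau> m" using p by (auto simp: C_def)
    have \<sigma>: "\<sigma> j < s" "j < m \<Longrightarrow> \<sigma> j = j" "\<sigma> j = p \<longleftrightarrow> j = m" if "j < s" for j
      using that p' by (auto simp: \<sigma>_def Transposition.transpose_def)
    have bij: "bij_betw \<sigma> {..<s} {..<s}"
      by (rule bij_betwI[where g = \<sigma>]) (use \<sigma>(1) in \<open>auto simp: \<sigma>_def\<close>)
    define W where "W = const_mat s (\<lambda>i j. h i (\<sigma> j))"
    have Wc: "W \<in> carrier_mat s s" by (simp add: W_def)
    have W: "paraunitary s W"
      unfolding W_def
    proof (rule paraunitary_const_mat)
      fix i j assume "i < s" "j < s"
      then show "(\<Sum>l<s. h i (\<sigma> l) * cnj (h j (\<sigma> l))) = (if i = j then 1 else 0)"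
        using h(1) sum.reindex_bij_betw[OF bij, of "\<lambda>l. h i l * cnj (h j l)"] by simp
    qed
    have WF: "coeffs_in F W" using h(2) by (auto simp: coeffs_in_def W_def cf_const_mat)
    have Wcl: "t = 0 \<and> \<kappa>' i = \<kappa>' (\<sigma> j)" if "i < s" "j < s" "cf (W $$ (i, j)) t \<noteq> 0" for i j t
    proof -
      have nz: "h i (\<sigma> j) \<noteq> 0" "t = 0" using that by (auto simp: W_def cf_const_mat split: if_splits)
      then have "i = \<sigma> j \<or> (i \<in> C \<and> \<sigma> j \<in> C)" using h(3)[of i "\<sigma> j"] by metis
      then show ?thesis using nz(2) by (auto simp: C_def)
    qed
    have QVW: "Q * (V * W) = Q1 * W" unfolding Q1_def using assoc_mult_mat[OF Q(1) Vc Wc] by simp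
    have QW: "cf ((Q1 * W) $$ (i, j)) t = (\<Sum>l<s. cf (Q1 $$ (i, l)) t * h l (\<sigma> j))" if "i < r" "j < s" for i j t
      unfolding W_def by (rule cf_mult_const_mat[OF Q1c that])
    have row: "(Q1 * W) $$ (i, j) = (if i = j then 1 else 0)" if "i < Suc m" "j < s" for i j
    proof (rule poly_mapping_eqI)
      fix t
      have ir: "i < r" using that mr by simp
      show "cf ((Q1 * W) $$ (i, j)) t = cf (if i = j then 1 else 0) t"
      proof (cases "t = 0")
        case False
        then have "cf (Q1 $$ (i, l)) t = 0" if "l < s" for l using Q1const[OF ir that] by auto
        then show ?thesis using False ir that(2) by (simp add: QW lookup_one)
      next
        case t: True
        show ?thesis
        proof (cases "i = m")
          case True
          have "cf ((Q1 * W) $$ (i, j)) t = (\<Sum>l<s. x l * h l (\<sigma> j))"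
            using QW[OF ir that(2)] True t by (simp add: x_def)
          then show ?thesis
            using h(4)[OF \<sigma>(1)[OF that(2)]] \<sigma>[OF that(2)] xC[of "\<sigma> j"] True t
            by (auto simp: lookup_one)
        next
          case False
          then have im: "i < m" using that by simp
          then have "i \<notin> C" by (simp add: C_def)
          have "cf ((Q1 * W) $$ (i, j)) t = (\<Sum>l<s. if l = i then h i (\<sigma> j) else 0)"
            unfolding QW[OF ir that(2)]
            by (rule sum.cong) (use V(7) im t in \<open>auto simp: Q1_def lookup_one simp del: index_mult_mat(1)\<close>)
          also have "\<dots> = (if i = \<sigma> j then 1 else 0)"
            using im V(6) h(3)[of i "\<sigma> j"] \<open>i \<notin> C\<close> by simp
          also have "i = \<sigma> j \<longleftrightarrow> i = j"
            using \<sigma>(2)[of i] im V(6) by (auto simp: \<sigma>_def)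
          finally show ?thesis using t by simp
        qed
      qed
    qed
    show ?case
    proof (intro exI conjI)
      show "paraunitary s (V * W)" using V(1) W by (rule paraunitary_mult)
      show "coeffs_in F (V * W)" using coeffs_in_mult[OF V(2) WF Vc Wc] .
      show "\<forall>i<s. \<forall>j<s. \<forall>t. cf ((V * W) $$ (i, j)) t \<noteq> 0 \<longrightarrow> t = 0 \<and> \<kappa> i = (\<kappa>' \<circ> \<sigma>) j"
      proof (intro allI impI)
        fix i j t assume ij: "i < s" "j < s" and nz: "cf ((V * W) $$ (i, j)) t \<noteq> 0"
        have dims: "i < dim_row V" "j < dim_col W" "dim_row W = s" "dim_col V = s"
          using ij Vc Wc by auto
        obtain l t1 t2 where "l < s" "t = t1 + t2" "cf (V $$ (i, l)) t1 \<noteq> 0" "cf (W $$ (l, j)) t2 \<noteq> 0"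
          using mat_mult_cf_nonzero[OF dims nz] by metis
        then show "t = 0 \<and> \<kappa> i = (\<kappa>' \<circ> \<sigma>) j" using Wcl[of l j t2] V(3) ij by force
      qed
      show "\<forall>i<Suc m. (\<kappa>' \<circ> \<sigma>) i = \<tau> i"
      proof (intro allI impI)
        fix i assume "i < Suc m"
        then show "(\<kappa>' \<circ> \<sigma>) i = \<tau> i"
          using V(4) \<sigma>(2)[of i] p' by (cases "i = m") (auto simp: \<sigma>_def)
      qed
      have "(\<kappa>' \<circ> \<sigma>) ` {..<s} \<subseteq> \<kappa>' ` {..<s}" using \<sigma>(1) by auto
      then show "(\<kappa>' \<circ> \<sigma>) ` {..<s} \<subseteq> \<kappa> ` {..<s}" using V(5) by (rule subset_trans)
      show "Suc m \<le> s" using p' by simp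
      show "\<forall>i<Suc m. \<forall>j<s. (Q * (V * W)) $$ (i, j) = (if i = j then 1 else 0)"
        unfolding QVW using row by blast
    qed
  qed
  from this[OF order_refl] obtain V \<kappa>' where V: "paraunitary s V" "coeffs_in F V"
      "\<forall>i<s. \<forall>j<s. \<forall>t. cf (V $$ (i, j)) t \<noteq> 0 \<longrightarrow> t = 0 \<and> \<kappa> i = \<kappa>' j"
      "\<forall>i<r. \<kappa>' i = \<tau> i" "\<kappa>' ` {..<s} \<subseteq> \<kappa> ` {..<s}" "r \<le> s"
      "\<forall>i<r. \<forall>j<s. (Q * V) $$ (i, j) = (if i = j then 1 else 0)"
    by (elim exE conjE) (rule that)
  have "Q * V = Matrix.mat r s (\<lambda>(i, j). if i = j then 1 else 0)"
  proof (rule eq_matI)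
    fix i j assume "i < dim_row (Matrix.mat r s (\<lambda>(i, j). if i = j then 1 else 0 :: laurent))"
      "j < dim_col (Matrix.mat r s (\<lambda>(i, j). if i = j then 1 else 0 :: laurent))"
    then have "i < r" "j < s" by auto
    then show "(Q * V) $$ (i, j) = Matrix.mat r s (\<lambda>(i, j). if i = j then 1 else 0) $$ (i, j)"
      using V(7) by simp
  qed (use Q(1) paraunitary_carrier[OF V(1)] in auto)
  then show thesis using that[of V \<kappa>'] V by simp
qed

context offset_rows
begin

lemma degree_eq_exists:
  assumes "isometric_at \<beta> Q"
  obtains n where "degree_eq \<beta> (int n) Q"
proof -
  define T where "T = (\<Union>i<r. \<Union>j<s. (\<lambda>k. nat \<bar>2 * k - \<beta> j + \<alpha> i\<bar>) ` Poly_Mapping.keys (Q $$ (i, j)))"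
  have T: "x \<in> T \<longleftrightarrow> (\<exists>i<r. \<exists>j<s. \<exists>k. cf (Q $$ (i, j)) k \<noteq> 0 \<and> x = nat \<bar>2 * k - \<beta> j + \<alpha> i\<bar>)" for x
    unfolding T_def by (fastforce simp: in_keys_iff image_iff)
  have fin: "finite T" by (simp add: T_def)
  obtain i j t where ij: "i < r" "j < s" and t: "cf (widen \<alpha> \<beta> Q $$ (i, j)) t \<noteq> 0"
    using isometric_nonzero[OF isometric_widen[OF assms]] .
  have "i < dim_row Q" "j < dim_col Q" using ij isometric_atD[OF assms] by auto
  then obtain k where "cf (Q $$ (i, j)) k \<noteq> 0" using t by (elim cf_widen_nonzero)
  then have "T \<noteq> {}" using T ij by blast
  then have M: "Max T \<in> T" using fin by (intro Max_in)
  show thesis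
  proof (rule that[of "Max T"])
    show "degree_eq \<beta> (int (Max T)) Q"
      unfolding degree_eq_def degree_le_def
    proof (intro conjI allI impI)
      fix i j k assume "i < r" "j < s" "cf (Q $$ (i, j)) k \<noteq> 0"
      then have "nat \<bar>2 * k - \<beta> j + \<alpha> i\<bar> \<in> T" using T by blast
      then have "nat \<bar>2 * k - \<beta> j + \<alpha> i\<bar> \<le> Max T" using fin by (intro Max_ge)
      then show "\<bar>2 * k - \<beta> j + \<alpha> i\<bar> \<le> int (Max T)" by linarith
    next
      obtain i j k where "i < r" "j < s" "cf (Q $$ (i, j)) k \<noteq> 0" "Max T = nat \<bar>2 * k - \<beta> j + \<alpha> i\<bar>"
        using M unfolding T by blast
      then show "\<exists>i<r. \<exists>j<s. \<exists>k. cf (Q $$ (i, j)) k \<noteq> 0 \<and> \<bar>2 * k - \<beta> j + \<alpha> i\<bar> = int (Max T)"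
        by (metis abs_ge_zero int_nat_eq)
    qed
  qed
qed

text \<open>At degree 0 a nonzero entry forces equal sign and equal offset of its row and column, so
  these pairs serve as labels for the constant completion. The extension is the product of the
  adjoints of \<open>V\<close> and \<open>B\<close>, and its row symmetries are the labels of the
  columns of \<open>V\<close>.\<close>

lemma normalized_extension:
  assumes Q: "isometric_at \<beta> Q" and \<beta>: "\<forall>j<s. \<beta> j \<in> {0, -1}"
  obtains As V Qe \<epsilon>' \<alpha>' where
    "\<forall>i<length As. mclen (foldl (*) Q (take i As)) > 0 \<and>
       paraunitary s (As ! i) \<and> compatible_symmetry (As ! i) \<and> mkeys (As ! i) \<subseteq> {-1..1} \<and>
       mclen (foldl (*) Q (take (Suc i) As)) < mclen (foldl (*) Q (take i As))"
    "mclen (foldl (*) Q As) = 0"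
    "paraunitary s V" "mkeys V \<subseteq> {0}" "coeffs_in F V"
    "foldl (*) Q As * V = Matrix.mat r s (\<lambda>(i, j). if i = j then 1 else 0)"
    "\<And>M k. M \<in> carrier_mat s k \<Longrightarrow> mstar V * foldl (\<lambda>M A. mstar A * M) M As = Qe * M"
    "paraunitary s Qe" "coeffs_in F Qe" "symmetric_mat \<epsilon>' \<alpha>' \<delta> \<beta> Qe" "\<forall>i<s. \<epsilon>' i \<in> {1, -1}"
    "\<And>i. i < r \<Longrightarrow> \<epsilon>' i = \<epsilon> i \<and> \<alpha>' i = \<alpha> i" "r \<le> s"
    "\<And>i j. i < r \<Longrightarrow> j < s \<Longrightarrow> Qe $$ (i, j) = Q $$ (i, j)"
    "\<And>i j k m. i < s \<Longrightarrow> j < s \<Longrightarrow> 0 \<le> m \<Longrightarrow>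
      \<forall>i<r. \<forall>k. cf (Q $$ (i, j)) k \<noteq> 0 \<longrightarrow> \<bar>2 * k - \<beta> j + \<alpha> i\<bar> \<le> m \<Longrightarrow>
      cf (Qe $$ (i, j)) k \<noteq> 0 \<Longrightarrow> \<bar>2 * k - \<beta> j + \<alpha>' i\<bar> \<le> m"
proof -
  obtain n where n: "degree_eq \<beta> (int n) Q" using degree_eq_exists[OF Q] .
  have "\<exists>As B \<beta>'. reduction \<beta> Q As B \<beta>'"
    by (rule reduction_exists[OF Q n]) (use \<beta> in auto)
  then obtain As B \<beta>' where red: "reduction \<beta> Q As B \<beta>'" by blast
  have B: "foldl (*) Q As = Q * B"
      "\<And>M k. M \<in> carrier_mat s k \<Longrightarrow> foldl (\<lambda>M A. mstar A * M) M As = mstar B * M"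
      "shift_step \<beta> \<beta>' B" "degree_eq \<beta>' 0 (Q * B)" "\<forall>j<s. \<beta>' j \<in> {0, -1}" "preserves_above \<beta> \<beta>' Q B"
    using red by (auto simp: reduction_def)
  have Qc: "Q \<in> carrier_mat r s" using Q by (rule isometric_atD)
  have Bc: "B \<in> carrier_mat s s" and Bp: "paraunitary s B" and BF: "coeffs_in F B"
    using B(3) by (auto simp: shift_step_def dest: paraunitary_carrier)
  define Q1 where "Q1 = Q * B"
  have Q1: "isometric_at \<beta>' Q1" unfolding Q1_def using isometric_at_mult[OF Q B(3)] .
  then have Q1c: "Q1 \<in> carrier_mat r s" "Q1 * mstar Q1 = 1\<^sub>m r" "coeffs_in F Q1"
    and Q1s: "symmetric_mat \<epsilon> \<alpha> \<delta> \<beta>' Q1" by (auto simp: isometric_at_def)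
  have mclen0: "mclen Q1 = 0"
  proof (rule antisym)
    have "mclen Q1 \<le> ereal (real_of_int 0)"
      by (rule mclen_le[OF Q1]) (use B(4,5) in \<open>auto simp: degree_eq_def Q1_def\<close>)
    then show "mclen Q1 \<le> 0" by (simp add: zero_ereal_def)
    have "ereal (real_of_int 0) \<le> mclen Q1"
      by (rule mclen_ge[OF Q1]) (use B(4) in \<open>simp add: Q1_def\<close>)
    then show "0 \<le> mclen Q1" by (simp add: zero_ereal_def)
  qed
  \<comment> \<open>Both offsets lie in {0, -1}, so 2 t = \<beta>' j - \<alpha> i leaves only t = 0;
    a nonzero constant symmetric about 0 must be even.\<close>
  have Q1const: "t = 0 \<and> (\<epsilon> i, \<alpha> i) = (\<delta> j, \<beta>' j)" if ij: "i < r" "j < s" and nz: "cf (Q1 $$ (i, j)) t \<noteq> 0" for i j t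
  proof -
    have "\<bar>2 * t - \<beta>' j + \<alpha> i\<bar> \<le> 0"
      using B(4) ij nz unfolding degree_eq_def degree_le_def Q1_def by blast
    moreover have "\<alpha> i = 0 \<or> \<alpha> i = -1" using row_offset ij by auto
    moreover have "\<beta>' j = 0 \<or> \<beta>' j = -1" using B(5) ij by auto
    ultimately have t: "t = 0" "\<alpha> i = \<beta>' j" by presburger+
    have "cf (Q1 $$ (i, j)) 0 = \<epsilon> i * \<delta> j * cf (Q1 $$ (i, j)) 0"
      using symmetric_matD[OF Q1s Q1c(1) ij, of 0] t by simp
    then have "\<epsilon> i * \<delta> j = 1" using nz t by simp
    moreover have "\<epsilon> i = 1 \<or> \<epsilon> i = -1" "\<delta> j = 1 \<or> \<delta> j = -1" using row_sign col_sign ij by auto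
    ultimately show ?thesis using t by auto
  qed
  obtain V \<kappa> where V: "paraunitary s V" "coeffs_in F V"
    and Vcl: "\<And>i j t. i < s \<Longrightarrow> j < s \<Longrightarrow> cf (V $$ (i, j)) t \<noteq> 0 \<Longrightarrow> t = 0 \<and> (\<delta> i, \<beta>' i) = \<kappa> j"
    and \<kappa>: "\<And>i. i < r \<Longrightarrow> \<kappa> i = (\<epsilon> i, \<alpha> i)" "\<kappa> ` {..<s} \<subseteq> (\<lambda>i. (\<delta> i, \<beta>' i)) ` {..<s}" and rs: "r \<le> s"
    and QV: "Q1 * V = Matrix.mat r s (\<lambda>(i, j). if i = j then 1 else 0)"
    by (rule const_extension[where \<tau> = "\<lambda>i. (\<epsilon> i, \<alpha> i)" and \<kappa> = "\<lambda>j. (\<delta> j, \<beta>' j)", OF Q1c])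
      (erule (2) Q1const, rule that)
  define \<epsilon>' where "\<epsilon>' i = fst (\<kappa> i)" for i
  define \<alpha>' where "\<alpha>' i = snd (\<kappa> i)" for i
  \<comment> \<open>Each new label is the label of an existing column, so its first component is a
    sign.\<close>
  have \<epsilon>': "\<forall>i<s. \<epsilon>' i \<in> {1, -1}"
    using \<kappa>(2) col_sign by (fastforce simp: \<epsilon>'_def)
  have Vc: "V \<in> carrier_mat s s" using V(1) by (rule paraunitary_carrier)
  define Qe where "Qe = mstar V * mstar B"
  have Qec: "Qe \<in> carrier_mat s s" unfolding Qe_def using Vc Bc by (intro mult_carrier_mat[OF mstar_carrier mstar_carrier])
  have QeM: "Qe * M = mstar V * (mstar B * M)" if "M \<in> carrier_mat s k" for M k
    unfolding Qe_def using assoc_mult_mat[OF mstar_carrier[OF Vc] mstar_carrier[OF Bc] that] .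
  have Vsym: "symmetric_mat \<delta> \<beta>' \<epsilon>' \<alpha>' V"
    unfolding symmetric_mat_def
  proof (intro allI impI)
    fix i j k assume "i < dim_row V" "j < dim_col V"
    then have ij: "i < s" "j < s" using Vc by auto
    show "cf (V $$ (i, j)) (\<alpha>' j - \<beta>' i - k) = \<delta> i * \<epsilon>' j * cf (V $$ (i, j)) k"
    proof (cases "cf (V $$ (i, j)) 0 = 0")
      case True
      then have "cf (V $$ (i, j)) t = 0" for t using Vcl[OF ij, of t] by auto
      then show ?thesis by simp
    next
      case False
      then have "\<epsilon>' j = \<delta> i" "\<alpha>' j = \<beta>' i" using Vcl[OF ij False] by (auto simp: \<epsilon>'_def \<alpha>'_def dest: sym)
      moreover have "\<delta> i * \<delta> i = 1" using col_sign ij by auto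
      moreover have "cf (V $$ (i, j)) (- k) = cf (V $$ (i, j)) k"
        using Vcl[OF ij, of k] Vcl[OF ij, of "- k"] by (metis neg_equal_0_iff_equal)
      ultimately show ?thesis by simp
    qed
  qed
  have Qesym: "symmetric_mat \<epsilon>' \<alpha>' \<delta> \<beta> Qe"
    unfolding Qe_def
    using symmetric_mat_mult[OF symmetric_mat_mstar[OF Vsym Vc col_sign \<epsilon>'] mstar_carrier[OF Vc]
        symmetric_mat_mstar[of \<delta> \<beta> \<delta> \<beta>' B, OF _ Bc col_sign col_sign] mstar_carrier[OF Bc] col_sign] B(3)
    by (simp add: shift_step_def)
  show thesis
  proof (rule that[of As V Qe \<epsilon>' \<alpha>'])
    show "\<forall>i<length As. mclen (foldl (*) Q (take i As)) > 0 \<and>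
       paraunitary s (As ! i) \<and> compatible_symmetry (As ! i) \<and> mkeys (As ! i) \<subseteq> {-1..1} \<and>
       mclen (foldl (*) Q (take (Suc i) As)) < mclen (foldl (*) Q (take i As))"
      using red unfolding reduction_def by (rule conjunct1)
    show "mclen (foldl (*) Q As) = 0" using mclen0 B(1) by (simp add: Q1_def)
    show "mkeys V \<subseteq> {0}" using Vcl by (auto simp: mkeys_iff[OF Vc])
    show "foldl (*) Q As * V = Matrix.mat r s (\<lambda>(i, j). if i = j then 1 else 0)"
      using QV B(1) by (simp add: Q1_def)
    show "mstar V * foldl (\<lambda>M A. mstar A * M) M As = Qe * M" if "M \<in> carrier_mat s k" for M k
      using B(2)[OF that] QeM[OF that] by simp
    show "paraunitary s Qe"
      unfolding Qe_def using V(1) Bp by (intro paraunitary_mult paraunitary_mstar)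
    show "coeffs_in F Qe"
      unfolding Qe_def using coeffs_in_mult[OF coeffs_in_mstar coeffs_in_mstar mstar_carrier mstar_carrier] V(2) BF Vc Bc by blast
    show "\<epsilon>' i = \<epsilon> i \<and> \<alpha>' i = \<alpha> i" if "i < r" for i
      using \<kappa>(1)[OF that] by (simp add: \<epsilon>'_def \<alpha>'_def)
    show "Qe $$ (i, j) = Q $$ (i, j)" if "i < r" "j < s" for i j
    proof -
      let ?E = "Matrix.mat r s (\<lambda>(i, j). if i = j then 1 else 0) :: laurent mat"
      have Ec: "?E \<in> carrier_mat r s" by simp
      have "?E * Qe = ?E * mstar V * mstar B"
        unfolding Qe_def using assoc_mult_mat[OF Ec mstar_carrier[OF Vc] mstar_carrier[OF Bc]] by simp
      also have "?E * mstar V = Q1" unfolding QV[symmetric] by (rule mult_mstar_cancel[OF Q1c(1) V(1)])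
      also have "Q1 * mstar B = Q" unfolding Q1_def by (rule mult_mstar_cancel[OF Qc Bp])
      finally have "Q $$ (i, j) = (?E * Qe) $$ (i, j)" by simp
      also have "\<dots> = (\<Sum>l<s. ?E $$ (i, l) * Qe $$ (l, j))"
        by (rule mat_mult_index) (use that Qec in auto)
      also have "\<dots> = (\<Sum>l<s. if l = i then Qe $$ (i, j) else 0)"
        by (rule sum.cong) (use that in auto)
      also have "\<dots> = Qe $$ (i, j)" using that rs by simp
      finally show ?thesis by simp
    qed
    fix i j k m assume ij: "i < s" "j < s" and m: "(0::int) \<le> m"
      and deg: "\<forall>i<r. \<forall>k. cf (Q $$ (i, j)) k \<noteq> 0 \<longrightarrow> \<bar>2 * k - \<beta> j + \<alpha> i\<bar> \<le> m"
      and nz: "cf (Qe $$ (i, j)) k \<noteq> 0"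
    \<comment> \<open>The unit vector that selects column j of a product.\<close>
    define X where "X = Matrix.mat s 1 (\<lambda>(l, _). if l = j then 1 else 0 :: laurent)"
    have Xc: "X \<in> carrier_mat s 1" by (simp add: X_def)
    have YX: "(Y * X) $$ (i', 0) = Y $$ (i', j)" if "Y \<in> carrier_mat q s" "i' < q" for Y q i'
    proof -
      have "(Y * X) $$ (i', 0) = (\<Sum>l<s. Y $$ (i', l) * X $$ (l, 0))"
        by (rule mat_mult_index) (use that Xc in auto)
      also have "\<dots> = (\<Sum>l<s. if l = j then Y $$ (i', j) else 0)"
        by (rule sum.cong) (auto simp: X_def)
      finally have "(Y * X) $$ (i', 0) = (\<Sum>l<s. if l = j then Y $$ (i', j) else 0)" .
      then show ?thesis using ij by simp
    qed
    \<comment> \<open>With \<sigma> = m + \<beta> j the condition on the unit vector is just m \<ge>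
      0; this is why a vanishing column of \<open>P\<close> is allowed length 0.\<close>
    have "bounded_above \<beta> (m + \<beta> j) X"
      using m by (auto simp: bounded_above_def X_def lookup_one when_def split: if_splits)
    moreover have "bounded_above \<alpha> (m + \<beta> j) (Q * X)"
      unfolding bounded_above_def
    proof (intro allI impI)
      fix i' j' k' assume "i' < dim_row (Q * X)" "j' < dim_col (Q * X)" and nz': "cf ((Q * X) $$ (i', j')) k' \<noteq> 0"
      then have "i' < r" "j' = 0" using Qc Xc by auto
      then have "\<bar>2 * k' - \<beta> j + \<alpha> i'\<bar> \<le> m" using deg nz' YX[OF Qc, of i'] by simp
      then show "2 * k' + \<alpha> i' \<le> m + \<beta> j" by linarith
    qed
    ultimately have BX: "bounded_above \<beta>' (m + \<beta> j) (mstar B * X)"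
      using B(6) Xc unfolding preserves_above_def by blast
    have up: "2 * k + \<alpha>' i \<le> m + \<beta> j" if nz: "cf (Qe $$ (i, j)) k \<noteq> 0" for k
    proof -
      have BXc: "mstar B * X \<in> carrier_mat s 1" using mult_carrier_mat[OF mstar_carrier[OF Bc] Xc] .
      have dims: "i < dim_row (mstar V)" "0 < dim_col (mstar B * X)" "dim_row (mstar B * X) = s" "dim_col (mstar V) = s"
        using ij Vc Bc BXc Xc by auto
      have "cf ((mstar V * (mstar B * X)) $$ (i, 0)) k \<noteq> 0"
        using nz YX[OF Qec ij(1)] QeM[OF Xc] by simp
      then obtain l t1 t2 where l: "l < s" "k = t1 + t2" "cf (mstar V $$ (i, l)) t1 \<noteq> 0"
        "cf ((mstar B * X) $$ (l, 0)) t2 \<noteq> 0"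
        using mat_mult_cf_nonzero[OF dims] by metis
      then have "cf (V $$ (l, i)) (- t1) \<noteq> 0" using Vc ij by (simp add: lookup_lstar)
      from Vcl[OF l(1) ij(1) this] have "t1 = 0" "\<alpha>' i = \<beta>' l" by (auto simp: \<alpha>'_def dest: sym)
      moreover have "2 * t2 + \<beta>' l \<le> m + \<beta> j"
        using BX l(1,4) unfolding bounded_above_def carrier_matD[OF BXc] by blast
      ultimately show ?thesis using l(2) by simp
    qed
    \<comment> \<open>The mirror exponent obeys the same upper bound, which gives the lower
      one.\<close>
    have "cf (Qe $$ (i, j)) (\<beta> j - \<alpha>' i - k) \<noteq> 0"
      unfolding symmetric_matD[OF Qesym Qec ij] using nz \<epsilon>' col_sign ij by auto
    from up[OF nz] up[OF this] show "\<bar>2 * k - \<beta> j + \<alpha>' i\<bar> \<le> m" by (simp add: abs_le_iff)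
  qed (use V \<epsilon>' Qesym rs in auto)
qed

end

section \<open>Normalizing the symmetry pattern by monomial matrices\<close>

definition monomial_mat :: "nat \<Rightarrow> (nat \<Rightarrow> int) \<Rightarrow> (nat \<Rightarrow> nat) \<Rightarrow> laurent mat" where
  "monomial_mat n t \<pi> = Matrix.mat n n (\<lambda>(i, j). if i = \<pi> j then lmonom 1 (t i) else 0)"

lemma monomial_mat_carrier [simp]: "monomial_mat n t \<pi> \<in> carrier_mat n n"
  and dim_monomial_mat [simp]: "dim_row (monomial_mat n t \<pi>) = n" "dim_col (monomial_mat n t \<pi>) = n"
  by (auto simp: monomial_mat_def)

lemma monomial_mat_alt:
  "mat_diag n (\<lambda>i. lmonom 1 (t i)) * Matrix.mat n n (\<lambda>(i, j). if i = \<pi> j then 1 else 0) = monomial_mat n t \<pi>"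
  by (subst mat_diag_mult_left[of _ n n]) (auto simp: monomial_mat_def)

lemma permutes_lessThan:
  assumes "\<pi> permutes {..<n}" "i < n"
  shows "\<pi> i < n" "inv_into UNIV \<pi> i < n" "\<pi> (inv_into UNIV \<pi> i) = i" "inv_into UNIV \<pi> (\<pi> i) = i" "i = \<pi> l \<longleftrightarrow> l = inv_into UNIV \<pi> i"
proof -
  show "\<pi> i < n" using permutes_in_image[OF assms(1), of i] assms(2) by simp
  show "inv_into UNIV \<pi> i < n" using permutes_in_image[OF permutes_inv[OF assms(1)], of i] assms(2) by simp
  show "\<pi> (inv_into UNIV \<pi> i) = i" "inv_into UNIV \<pi> (\<pi> i) = i" using permutes_inverses[OF assms(1)] by auto
  show "i = \<pi> l \<longleftrightarrow> l = inv_into UNIV \<pi> i" using permutes_inv_eq[OF assms(1)] by metis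
qed

lemma mult_monomial_mat_index:
  assumes "X \<in> carrier_mat m n" "\<pi> permutes {..<n}" "i < m" "j < n"
  shows "(X * monomial_mat n t \<pi>) $$ (i, j) = X $$ (i, \<pi> j) * lmonom 1 (t (\<pi> j))"
proof -
  have "(X * monomial_mat n t \<pi>) $$ (i, j) = (\<Sum>l<n. X $$ (i, l) * monomial_mat n t \<pi> $$ (l, j))"
    by (rule mat_mult_index) (use assms in auto)
  also have "\<dots> = (\<Sum>l<n. if l = \<pi> j then X $$ (i, \<pi> j) * lmonom 1 (t (\<pi> j)) else 0)"
    by (rule sum.cong) (use assms in \<open>auto simp: monomial_mat_def\<close>)
  finally show ?thesis using permutes_lessThan(1)[OF assms(2,4)] by simp
qed

lemma monomial_mat_mult_index:
  assumes "X \<in> carrier_mat n m" "\<pi> permutes {..<n}" "i < n" "j < m"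
  shows "(monomial_mat n t \<pi> * X) $$ (i, j) = lmonom 1 (t i) * X $$ (inv_into UNIV \<pi> i, j)"
proof -
  have "(monomial_mat n t \<pi> * X) $$ (i, j) = (\<Sum>l<n. monomial_mat n t \<pi> $$ (i, l) * X $$ (l, j))"
    by (rule mat_mult_index) (use assms in auto)
  also have "\<dots> = (\<Sum>l<n. if l = inv_into UNIV \<pi> i then lmonom 1 (t i) * X $$ (inv_into UNIV \<pi> i, j) else 0)"
    by (rule sum.cong) (use assms permutes_lessThan(5)[OF assms(2,3)] in \<open>auto simp: monomial_mat_def\<close>)
  finally show ?thesis using permutes_lessThan(2)[OF assms(2,3)] by simp
qed

lemma mult_mstar_monomial_mat_index:
  assumes "X \<in> carrier_mat m n" "\<pi> permutes {..<n}" "i < m" "j < n"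
  shows "(X * mstar (monomial_mat n t \<pi>)) $$ (i, j) = X $$ (i, inv_into UNIV \<pi> j) * lmonom 1 (- t j)"
proof -
  have "(X * mstar (monomial_mat n t \<pi>)) $$ (i, j) = (\<Sum>l<n. X $$ (i, l) * mstar (monomial_mat n t \<pi>) $$ (l, j))"
    by (rule mat_mult_index) (use assms in auto)
  also have "\<dots> = (\<Sum>l<n. if l = inv_into UNIV \<pi> j then X $$ (i, inv_into UNIV \<pi> j) * lmonom 1 (- t j) else 0)"
    by (rule sum.cong)
      (use assms permutes_lessThan(5)[OF assms(2,4)] in \<open>auto simp: monomial_mat_def lstar_lmonom\<close>)
  finally show ?thesis using permutes_lessThan(2)[OF assms(2,4)] by simp
qed

lemma mstar_monomial_mat_mult_index:
  assumes "X \<in> carrier_mat n m" "\<pi> permutes {..<n}" "i < n" "j < m"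
  shows "(mstar (monomial_mat n t \<pi>) * X) $$ (i, j) = lmonom 1 (- t (\<pi> i)) * X $$ (\<pi> i, j)"
proof -
  have "(mstar (monomial_mat n t \<pi>) * X) $$ (i, j) = (\<Sum>l<n. mstar (monomial_mat n t \<pi>) $$ (i, l) * X $$ (l, j))"
    by (rule mat_mult_index) (use assms in auto)
  also have "\<dots> = (\<Sum>l<n. if l = \<pi> i then lmonom 1 (- t (\<pi> i)) * X $$ (\<pi> i, j) else 0)"
    by (rule sum.cong) (use assms in \<open>auto simp: monomial_mat_def lstar_lmonom\<close>)
  finally show ?thesis using permutes_lessThan(1)[OF assms(2,3)] by simp
qed

lemma paraunitary_monomial_mat:
  assumes "\<pi> permutes {..<n}"
  shows "paraunitary n (monomial_mat n t \<pi>)"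
  unfolding paraunitary_iff
proof (intro conjI eq_matI)
  fix i j assume "i < dim_row (1\<^sub>m n :: laurent mat)" "j < dim_col (1\<^sub>m n :: laurent mat)"
  then have ij: "i < n" "j < n" by auto
  have "(monomial_mat n t \<pi> * mstar (monomial_mat n t \<pi>)) $$ (i, j)
      = monomial_mat n t \<pi> $$ (i, inv_into UNIV \<pi> j) * lmonom 1 (- t j)"
    by (rule mult_mstar_monomial_mat_index[OF monomial_mat_carrier assms ij])
  also have "\<dots> = 1\<^sub>m n $$ (i, j)"
    using ij permutes_lessThan[OF assms ij(2)] by (auto simp: monomial_mat_def mult_single)
  finally show "(monomial_mat n t \<pi> * mstar (monomial_mat n t \<pi>)) $$ (i, j) = 1\<^sub>m n $$ (i, j)" .
qed auto

lemma (in conj_sqrt_field) coeffs_in_monomial_mat: "coeffs_in F (monomial_mat n t \<pi>)"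
  by (auto simp: coeffs_in_def monomial_mat_def lookup_single when_def)

text \<open>A shift by t changes the exponent of a symmetry by 2 t, so only its parity and the sign
  are invariant. Listing the columns by these four classes gives the permutation.\<close>

lemma symmetry_normalizer_exists:
  assumes S: "S = Matrix.mat 1 n (\<lambda>(_, j). lmonom (\<eta> j) (c j))" and \<eta>: "\<forall>j<n. \<eta> j \<in> {1, -1}"
  obtains t \<pi> where "\<pi> permutes {..<n}" "symmetry_normalizer n S (monomial_mat n t \<pi>)"
    "\<And>j. c j + 2 * t j \<in> {0, -1}"
proof -
  \<comment> \<open>Rounding is chosen such that odd exponents become -1 and not 1.\<close>
  define t where "t j = - ((c j + 1) div 2)" for j
  define cl where "cl j = (if even (c j) then if \<eta> j = 1 then 0 else 1 else if \<eta> j = 1 then 2 else 3 :: nat)" for j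
  define xs where "xs q = filter (\<lambda>j. cl j = q) [0..<n]" for q
  define ys where "ys = xs 0 @ xs 1 @ xs 2 @ xs 3"
  have set_xs: "set (xs q) = {j. j < n \<and> cl j = q}" for q by (auto simp: xs_def)
  have cl4: "cl j = 0 \<or> cl j = 1 \<or> cl j = 2 \<or> cl j = 3" for j by (simp add: cl_def)
  have "j \<in> set ys \<longleftrightarrow> j \<in> {..<n}" for j
    using cl4[of j] by (auto simp: ys_def set_xs)
  then have set_ys: "set ys = {..<n}" by blast
  have dist: "distinct ys" by (auto simp: ys_def set_xs) (auto simp: xs_def)
  then have len: "length ys = n" using distinct_card[OF dist] set_ys by simp
  define \<pi> where "\<pi> j = (if j < n then ys ! j else j)" for j
  have "bij_betw ((!) ys) {..<n} {..<n}"
    by (rule bij_betw_nth[OF dist]) (simp_all only: len set_ys)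
  then have "bij_betw \<pi> {..<n} {..<n}"
    using bij_betw_cong[of "{..<n}" \<pi> "(!) ys" "{..<n}"] by (simp add: \<pi>_def)
  then have perm: "\<pi> permutes {..<n}" by (rule bij_imp_permutes) (auto simp: \<pi>_def)
  have ct: "c j + 2 * t j = (if even (c j) then 0 else -1)" for j
    unfolding t_def by (cases "even (c j)") (auto elim!: evenE oddE)
  have st: "standard_row n (Matrix.mat 1 n (\<lambda>(_, j). S $$ (0, \<pi> j) * lmonom 1 (2 * t (\<pi> j))))"
    unfolding standard_row_def
  proof (intro exI conjI)
    show "n = length (xs 0) + length (xs 1) + length (xs 2) + length (xs 3)"
      using len by (simp add: ys_def)
    show "Matrix.mat 1 n (\<lambda>(_, j). S $$ (0, \<pi> j) * lmonom 1 (2 * t (\<pi> j))) = Matrix.mat 1 n (\<lambda>(_, j).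
       if j < length (xs 0) then 1
       else if j < length (xs 0) + length (xs 1) then - 1
       else if j < length (xs 0) + length (xs 1) + length (xs 2) then lmonom 1 (- 1)
       else lmonom (- 1) (- 1))"
    proof (rule eq_matI, goal_cases)
      case (1 i j)
      then have j: "j < n" "i = 0" by auto
      have \<pi>j: "\<pi> j < n" using permutes_lessThan(1)[OF perm j(1)] .
      have entry: "S $$ (0, \<pi> j) * lmonom 1 (2 * t (\<pi> j)) = lmonom (\<eta> (\<pi> j)) (if even (c (\<pi> j)) then 0 else -1)"
        using \<pi>j ct[of "\<pi> j"] by (simp add: S mult_single)
      have \<eta>j: "\<eta> (\<pi> j) = 1 \<or> \<eta> (\<pi> j) = -1" using \<eta> \<pi>j by auto
      have in_xs: "cl (xs q ! l) = q" if "l < length (xs q)" for q l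
        using nth_mem[OF that] by (auto simp: set_xs)
      have cl: "cl (\<pi> j) = (if j < length (xs 0) then 0 else if j < length (xs 0) + length (xs 1) then 1
        else if j < length (xs 0) + length (xs 1) + length (xs 2) then 2 else 3)"
        using j len in_xs by (auto simp: \<pi>_def ys_def nth_append)
      have m1: "lmonom (-1) 0 = -1" by (simp add: single_uminus)
      have val: "S $$ (0, \<pi> j) * lmonom 1 (2 * t (\<pi> j)) =
        (if cl (\<pi> j) = 0 then 1 else if cl (\<pi> j) = 1 then -1 else if cl (\<pi> j) = 2 then lmonom 1 (-1) else lmonom (-1) (-1))"
        unfolding entry using \<eta>j by (auto simp: cl_def m1)
      show ?case using j(1) unfolding j(2) by (simp add: val) (simp add: cl)
    qed auto
  qed
  show thesis
  proof (rule that[OF perm])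
    show "symmetry_normalizer n S (monomial_mat n t \<pi>)"
      unfolding symmetry_normalizer_def
      by (intro exI conjI) (rule perm, rule monomial_mat_alt[symmetric], rule st)
    show "c j + 2 * t j \<in> {0, -1}" for j using ct by simp
  qed
qed

text \<open>The problem is solved in standard form and transformed back. Monomial matrices permute
  entries and translate their exponents, so support lengths of entries carry over in both
  directions.\<close>

lemma (in conj_sqrt_field) matrix_extension:
  fixes \<epsilon> \<eta> :: "nat \<Rightarrow> complex" and c k :: "nat \<Rightarrow> int"
  assumes P: "P \<in> carrier_mat r s" "P * mstar P = 1\<^sub>m r" "coeffs_in F P" and r: "r \<ge> 1"
    and \<epsilon>: "\<forall>i<r. \<epsilon> i \<in> {1, -1}" and \<eta>: "\<forall>j<s. \<eta> j \<in> {1, -1}"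
    and sym: "symmetric_mat \<epsilon> (\<lambda>i. - k i) \<eta> c P"
    and S: "S = Matrix.mat 1 s (\<lambda>(_, j). lmonom (\<eta> j) (c j))"
  obtains Pe \<epsilon>' k' where
    "extension_algorithm_output F r s P (mstar (monom_col r \<epsilon> k)) S Pe"
    "is_extension F r s P Pe"
    "\<forall>i<s. \<epsilon>' i \<in> {1, -1}" "\<And>i. i < r \<Longrightarrow> \<epsilon>' i = \<epsilon> i \<and> k' i = k i"
    "symmetric_mat \<epsilon>' (\<lambda>i. - k' i) \<eta> c Pe"
proof -
  define S1 where "S1 = mstar (monom_col r \<epsilon> k)"
  have S1: "S1 = Matrix.mat 1 r (\<lambda>(_, i). lmonom (\<epsilon> i) (- k i))"
    unfolding S1_def
  proof (rule eq_matI, goal_cases)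
    case (1 i j)
    then have "cnj (\<epsilon> j) = \<epsilon> j" using \<epsilon> by auto
    then show ?case using 1 by (simp add: monom_col_def lstar_lmonom)
  qed (auto simp: monom_col_def)
  obtain t1 \<pi>1 where \<pi>1: "\<pi>1 permutes {..<r}" and N1: "symmetry_normalizer r S1 (monomial_mat r t1 \<pi>1)"
    and t1: "\<And>i. - k i + 2 * t1 i \<in> {0, -1}"
    by (rule symmetry_normalizer_exists[OF S1 \<epsilon>]) (rule that)
  obtain t2 \<pi>2 where \<pi>2: "\<pi>2 permutes {..<s}" and N2: "symmetry_normalizer s S (monomial_mat s t2 \<pi>2)"
    and t2: "\<And>j. c j + 2 * t2 j \<in> {0, -1}"
    by (rule symmetry_normalizer_exists[OF S \<eta>]) (rule that)
  define U1 where "U1 = monomial_mat r t1 \<pi>1"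
  define U2 where "U2 = monomial_mat s t2 \<pi>2"
  define Q where "Q = mstar U1 * P * U2"
  define \<alpha> where "\<alpha> i = - k (\<pi>1 i) + 2 * t1 (\<pi>1 i)" for i
  define \<beta> where "\<beta> j = c (\<pi>2 j) + 2 * t2 (\<pi>2 j)" for j
  define \<epsilon>n where "\<epsilon>n i = \<epsilon> (\<pi>1 i)" for i
  define \<delta> where "\<delta> j = \<eta> (\<pi>2 j)" for j
  have Uc: "U1 \<in> carrier_mat r r" "U2 \<in> carrier_mat s s" by (auto simp: U1_def U2_def)
  have Up: "paraunitary r U1" "paraunitary s U2"
    using paraunitary_monomial_mat \<pi>1 \<pi>2 by (auto simp: U1_def U2_def)
  have UPc: "mstar U1 * P \<in> carrier_mat r s" using Uc P(1) by (intro mult_carrier_mat[OF mstar_carrier])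
  have Qc: "Q \<in> carrier_mat r s" unfolding Q_def using UPc Uc(2) by (rule mult_carrier_mat)
  have cfQ: "cf (Q $$ (i, j)) x = cf (P $$ (\<pi>1 i, \<pi>2 j)) (x + t1 (\<pi>1 i) - t2 (\<pi>2 j))" if "i < r" "j < s" for i j x
  proof -
    have "Q $$ (i, j) = (mstar U1 * P) $$ (i, \<pi>2 j) * lmonom 1 (t2 (\<pi>2 j))"
      unfolding Q_def U2_def using mult_monomial_mat_index[OF UPc \<pi>2 that] .
    also have "(mstar U1 * P) $$ (i, \<pi>2 j) = lmonom 1 (- t1 (\<pi>1 i)) * P $$ (\<pi>1 i, \<pi>2 j)"
      unfolding U1_def using mstar_monomial_mat_mult_index[OF P(1) \<pi>1 that(1) permutes_lessThan(1)[OF \<pi>2 that(2)]] .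
    finally show ?thesis by (simp add: cf_mult_lmonom cf_lmonom_mult algebra_simps)
  qed
  have "mstar U1 * P * mstar (mstar U1 * P) = mstar U1 * (P * (mstar P * U1))"
    using assoc_mult_mat[OF mstar_carrier[OF Uc(1)] P(1) mult_carrier_mat[OF mstar_carrier[OF P(1)] Uc(1)]]
    by (simp add: mstar_mult[OF mstar_carrier[OF Uc(1)] P(1)])
  also have "P * (mstar P * U1) = U1"
    using assoc_mult_mat[OF P(1) mstar_carrier[OF P(1)] Uc(1)] P(2) Uc(1) by simp
  also have "mstar U1 * U1 = 1\<^sub>m r" using Up(1) by (rule paraunitary_left)
  finally have QQ: "Q * mstar Q = 1\<^sub>m r"
    unfolding Q_def using orthonormal_rows_mult[OF UPc _ Up(2)] by blast
  have "coeffs_in F Q"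
    unfolding Q_def U1_def U2_def
    by (rule coeffs_in_mult[OF coeffs_in_mult[OF coeffs_in_mstar[OF coeffs_in_monomial_mat] P(3) mstar_carrier P(1)]
          coeffs_in_monomial_mat])
      (use UPc in \<open>auto simp: U1_def\<close>)
  moreover have "symmetric_mat \<epsilon>n \<alpha> \<delta> \<beta> Q"
    unfolding symmetric_mat_def
  proof (intro allI impI)
    fix i j x assume "i < dim_row Q" "j < dim_col Q"
    then have ij: "i < r" "j < s" using Qc by auto
    note p = permutes_lessThan(1)[OF \<pi>1 ij(1)] permutes_lessThan(1)[OF \<pi>2 ij(2)]
    show "cf (Q $$ (i, j)) (\<beta> j - \<alpha> i - x) = \<epsilon>n i * \<delta> j * cf (Q $$ (i, j)) x"
      using symmetric_matD[OF sym P(1) p, of "x + t1 (\<pi>1 i) - t2 (\<pi>2 j)"]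
      by (simp add: cfQ[OF ij] \<alpha>_def \<beta>_def \<epsilon>n_def \<delta>_def algebra_simps)
  qed
  ultimately have Q: "Q \<in> carrier_mat r s \<and> Q * mstar Q = 1\<^sub>m r \<and> coeffs_in F Q \<and> symmetric_mat \<epsilon>n \<alpha> \<delta> \<beta> Q"
    using Qc QQ by simp
  interpret offset_rows F r s \<epsilon>n \<delta> \<alpha>
  proof
    show "\<forall>i<r. \<epsilon>n i \<in> {1, -1}" using \<epsilon> permutes_lessThan(1)[OF \<pi>1] by (simp add: \<epsilon>n_def)
    show "\<forall>j<s. \<delta> j \<in> {1, -1}" using \<eta> permutes_lessThan(1)[OF \<pi>2] by (simp add: \<delta>_def)
    show "\<forall>i<r. \<alpha> i \<in> {0, -1}" using t1 by (simp add: \<alpha>_def)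
  qed (rule r)
  have iso: "isometric_at \<beta> Q" using Q by (simp add: isometric_at_def)
  have \<beta>01: "\<forall>j<s. \<beta> j \<in> {0, -1}" using t2 by (simp add: \<beta>_def)
  obtain As V Qe \<epsilon>' \<alpha>' where
    As: "\<forall>i<length As. mclen (foldl (*) Q (take i As)) > 0 \<and>
       paraunitary s (As ! i) \<and> compatible_symmetry (As ! i) \<and> mkeys (As ! i) \<subseteq> {-1..1} \<and>
       mclen (foldl (*) Q (take (Suc i) As)) < mclen (foldl (*) Q (take i As))"
    "mclen (foldl (*) Q As) = 0"
    and V: "paraunitary s V" "mkeys V \<subseteq> {0}" "coeffs_in F V"
    "foldl (*) Q As * V = Matrix.mat r s (\<lambda>(i, j). if i = j then 1 else 0)"
    and fold: "\<And>M k. M \<in> carrier_mat s k \<Longrightarrow> mstar V * foldl (\<lambda>M A. mstar A * M) M As = Qe * M"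
    and Qe: "paraunitary s Qe" "coeffs_in F Qe" "symmetric_mat \<epsilon>' \<alpha>' \<delta> \<beta> Qe" "\<forall>i<s. \<epsilon>' i \<in> {1, -1}"
    "\<And>i. i < r \<Longrightarrow> \<epsilon>' i = \<epsilon>n i \<and> \<alpha>' i = \<alpha> i" and rs: "r \<le> s"
    and Qe_rows: "\<And>i j. i < r \<Longrightarrow> j < s \<Longrightarrow> Qe $$ (i, j) = Q $$ (i, j)"
    and Qe_deg: "\<And>i j k m. i < s \<Longrightarrow> j < s \<Longrightarrow> 0 \<le> m \<Longrightarrow>
      \<forall>i<r. \<forall>k. cf (Q $$ (i, j)) k \<noteq> 0 \<longrightarrow> \<bar>2 * k - \<beta> j + \<alpha> i\<bar> \<le> m \<Longrightarrow>
      cf (Qe $$ (i, j)) k \<noteq> 0 \<Longrightarrow> \<bar>2 * k - \<beta> j + \<alpha>' i\<bar> \<le> m"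
    by (rule normalized_extension[OF iso \<beta>01]) (rule that)
  have Qec: "Qe \<in> carrier_mat s s" using Qe(1) by (rule paraunitary_carrier)
  \<comment> \<open>No shift in the added rows, in accordance with the identity block of
    \<open>G\<close>.\<close>
  define t where "t i = (if i < r then t1 i else 0)" for i
  define G where "G = four_block_mat U1 (0\<^sub>m r (s - r)) (0\<^sub>m (s - r) r) (1\<^sub>m (s - r))"
  have \<pi>1s: "\<pi>1 permutes {..<s}" using \<pi>1 rs by (auto intro: permutes_subset)
  have \<pi>1_fix: "\<pi>1 i = i" "inv_into UNIV \<pi>1 i = i" if "\<not> i < r" for i
    using permutes_not_in[OF \<pi>1, of i] permutes_not_in[OF permutes_inv[OF \<pi>1], of i] that by auto
  have G: "G = monomial_mat s t \<pi>1"
  proof (rule eq_matI, goal_cases)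
    case (1 i j)
    then have ij: "i < s" "j < s" by auto
    have "\<pi>1 j < r \<longleftrightarrow> j < r" using permutes_in_image[OF \<pi>1, of j] by simp
    then show ?case
      using ij rs \<pi>1_fix(1)[of j] by (auto simp: G_def U1_def monomial_mat_def t_def)
  qed (use rs in \<open>auto simp: G_def U1_def\<close>)
  define Pe where "Pe = G * (Qe * mstar U2)"
  have QU: "Qe * mstar U2 \<in> carrier_mat s s" using Qec Uc(2) by (intro mult_carrier_mat mstar_carrier)
  have Pec: "Pe \<in> carrier_mat s s" unfolding Pe_def G by (rule mult_carrier_mat[OF monomial_mat_carrier QU])
  have cfPe: "cf (Pe $$ (i, j)) x = cf (Qe $$ (inv_into UNIV \<pi>1 i, inv_into UNIV \<pi>2 j)) (x - t i + t2 j)" if "i < s" "j < s" for i j x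
  proof -
    note p = permutes_lessThan(2)[OF \<pi>1s that(1)]
    have "Pe $$ (i, j) = lmonom 1 (t i) * (Qe * mstar U2) $$ (inv_into UNIV \<pi>1 i, j)"
      unfolding Pe_def G using monomial_mat_mult_index[OF QU \<pi>1s that] .
    also have "(Qe * mstar U2) $$ (inv_into UNIV \<pi>1 i, j) = Qe $$ (inv_into UNIV \<pi>1 i, inv_into UNIV \<pi>2 j) * lmonom 1 (- t2 j)"
      unfolding U2_def using mult_mstar_monomial_mat_index[OF Qec \<pi>2 p that(2)] .
    finally show ?thesis by (simp add: cf_mult_lmonom cf_lmonom_mult)
  qed
  have rows: "Pe $$ (i, j) = P $$ (i, j)" if "i < r" "j < s" for i j
  proof (rule poly_mapping_eqI)
    fix x
    note p = permutes_lessThan[OF \<pi>1 that(1)] permutes_lessThan[OF \<pi>2 that(2)]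
    have "cf (Pe $$ (i, j)) x = cf (Q $$ (inv_into UNIV \<pi>1 i, inv_into UNIV \<pi>2 j)) (x - t i + t2 j)"
      using cfPe[of i j x] that rs Qe_rows[OF p(2,7)] by simp
    also have "\<dots> = cf (P $$ (i, j)) x"
      using that p by (simp add: cfQ t_def)
    finally show "cf (Pe $$ (i, j)) x = cf (P $$ (i, j)) x" .
  qed
  define e where "e i = \<epsilon>' (inv_into UNIV \<pi>1 i)" for i
  \<comment> \<open>Inverts the passage from k to \<alpha>: the row exponents enter the symmetry
    data through an adjoint, hence negatively, and the shift counts twice.\<close>
  define k' where "k' i = 2 * t i - \<alpha>' (inv_into UNIV \<pi>1 i)" for i
  have e: "\<forall>i<s. e i \<in> {1, -1}" using Qe(4) permutes_lessThan(2)[OF \<pi>1s] by (simp add: e_def)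
  have ek: "e i = \<epsilon> i \<and> k' i = k i" if "i < r" for i
    using Qe(5)[of "inv_into UNIV \<pi>1 i"] permutes_lessThan[OF \<pi>1 that] that
    by (simp add: e_def k'_def \<epsilon>n_def \<alpha>_def t_def)
  have Pesym: "symmetric_mat e (\<lambda>i. - k' i) \<eta> c Pe"
    unfolding symmetric_mat_def
  proof (intro allI impI)
    fix i j x assume "i < dim_row Pe" "j < dim_col Pe"
    then have ij: "i < s" "j < s" using Pec by auto
    note p = permutes_lessThan[OF \<pi>1s ij(1)] permutes_lessThan[OF \<pi>2 ij(2)]
    have "c j = \<beta> (inv_into UNIV \<pi>2 j) - 2 * t2 j" using p by (simp add: \<beta>_def)
    then have "c j - - k' i - x - t i + t2 j = \<beta> (inv_into UNIV \<pi>2 j) - \<alpha>' (inv_into UNIV \<pi>1 i) - (x - t i + t2 j)"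
      by (simp add: k'_def)
    then have "cf (Pe $$ (i, j)) (c j - - k' i - x) = cf (Qe $$ (inv_into UNIV \<pi>1 i, inv_into UNIV \<pi>2 j)) (\<beta> (inv_into UNIV \<pi>2 j) - \<alpha>' (inv_into UNIV \<pi>1 i) - (x - t i + t2 j))"
      unfolding cfPe[OF ij] by (simp only:)
    also have "\<dots> = e i * \<eta> j * cf (Pe $$ (i, j)) x"
      using symmetric_matD[OF Qe(3) Qec p(2,7)] p by (simp add: cfPe[OF ij] e_def \<delta>_def)
    finally show "cf (Pe $$ (i, j)) (c j - - k' i - x) = e i * \<eta> j * cf (Pe $$ (i, j)) x" .
  qed
  have bound: "clen (Pe $$ (i, j)) \<le> max 0 (Max ((\<lambda>n. clen (P $$ (n, j))) ` {..<r}))" if ij: "i < s" "j < s" for i j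
  proof -
    note p = permutes_lessThan[OF \<pi>1s ij(1)] permutes_lessThan[OF \<pi>2 ij(2)]
    define j' where "j' = inv_into UNIV \<pi>2 j"
    have j': "j' < s" "\<pi>2 j' = j" using p by (auto simp: j'_def)
    \<comment> \<open>Including 0 gives m \<ge> 0 also when column j of \<open>P\<close>
      vanishes.\<close>
    define T where "T = insert 0 (\<Union>n<r. (\<lambda>x. \<bar>2 * x - \<beta> j' + \<alpha> n\<bar>) ` Poly_Mapping.keys (Q $$ (n, j')))"
    have fin: "finite T" by (simp add: T_def)
    define m where "m = Max T"
    have "0 \<le> m" unfolding m_def using fin by (intro Max_ge) (auto simp: T_def)
    have mT: "m \<in> T" unfolding m_def using fin by (intro Max_in) (auto simp: T_def)
    have deg: "\<forall>n<r. \<forall>x. cf (Q $$ (n, j')) x \<noteq> 0 \<longrightarrow> \<bar>2 * x - \<beta> j' + \<alpha> n\<bar> \<le> m"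
      unfolding m_def using fin by (intro allI impI Max_ge) (assumption, fastforce simp: T_def in_keys_iff image_iff)
    have "clen (Pe $$ (i, j)) \<le> ereal (real_of_int m)"
    proof (rule support_length_le)
      fix x x' assume "x \<in> Poly_Mapping.keys (Pe $$ (i, j))" "x' \<in> Poly_Mapping.keys (Pe $$ (i, j))"
      then have "cf (Qe $$ (inv_into UNIV \<pi>1 i, j')) (x - t i + t2 j) \<noteq> 0" "cf (Qe $$ (inv_into UNIV \<pi>1 i, j')) (x' - t i + t2 j) \<noteq> 0"
        by (auto simp: in_keys_iff cfPe[OF ij] j'_def)
      then have "\<bar>2 * (x - t i + t2 j) - \<beta> j' + \<alpha>' (inv_into UNIV \<pi>1 i)\<bar> \<le> m" "\<bar>2 * (x' - t i + t2 j) - \<beta> j' + \<alpha>' (inv_into UNIV \<pi>1 i)\<bar> \<le> m"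
        using Qe_deg[OF p(2) j'(1) \<open>0 \<le> m\<close> deg] by blast+
      \<comment> \<open>Both bounds have the same centre, so 2 (x - x') \<le> 2 m.\<close>
      then show "x - x' \<le> m" unfolding abs_le_iff by (elim conjE) presburger
    qed simp
    also have "ereal (real_of_int m) \<le> max 0 (Max ((\<lambda>n. clen (P $$ (n, j))) ` {..<r}))"
    proof (cases "m = 0")
      case False
      \<comment> \<open>If m > 0, an entry of the given rows attains it, and this exponent together
        with its mirror image already forces support length m in \<open>P\<close>.\<close>
      then obtain n x where n: "n < r" and x: "cf (Q $$ (n, j')) x \<noteq> 0" and m: "m = \<bar>2 * x - \<beta> j' + \<alpha> n\<bar>"
        using mT by (auto simp: T_def in_keys_iff)
      have "\<epsilon>n n \<noteq> 0" "\<delta> j' \<noteq> 0" using row_sign col_sign n j'(1) by auto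
      then have x': "cf (Q $$ (n, j')) (\<beta> j' - \<alpha> n - x) \<noteq> 0"
        using symmetric_matD[OF _ Qc n j'(1), of \<epsilon>n \<alpha> \<delta> \<beta> x] Q x by simp
      have "ereal (real_of_int m) \<le> clen (P $$ (\<pi>1 n, j))"
      proof -
        let ?a = "x + t1 (\<pi>1 n) - t2 j" and ?b = "\<beta> j' - \<alpha> n - x + t1 (\<pi>1 n) - t2 j"
        have "?a \<in> Poly_Mapping.keys (P $$ (\<pi>1 n, j))" "?b \<in> Poly_Mapping.keys (P $$ (\<pi>1 n, j))"
          using x x' j' by (auto simp: cfQ[OF n j'(1)] in_keys_iff)
        moreover have "m = ?a - ?b \<or> m = ?b - ?a" using m by auto
        ultimately show ?thesis using support_length_ge[OF finite_keys] by metis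
      qed
      also have "\<dots> \<le> Max ((\<lambda>n. clen (P $$ (n, j))) ` {..<r})"
        using permutes_lessThan(1)[OF \<pi>1 n] by (intro Max_ge) auto
      finally show ?thesis by (simp add: le_max_iff_disj)
    qed (simp add: zero_ereal_def)
    finally show ?thesis .
  qed
  have Pep: "paraunitary s Pe"
    unfolding Pe_def G using Qe(1) Up(2) paraunitary_monomial_mat[OF \<pi>1s] by (intro paraunitary_mult paraunitary_mstar)
  have PeF: "coeffs_in F Pe"
    unfolding Pe_def G U2_def
    by (rule coeffs_in_mult[OF coeffs_in_monomial_mat coeffs_in_mult[OF Qe(2) coeffs_in_mstar[OF coeffs_in_monomial_mat] Qec mstar_carrier]])
      (use QU in \<open>auto simp: U2_def\<close>)
  show thesis
  proof (rule that[of Pe e k'])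
    show "extension_algorithm_output F r s P (mstar (monom_col r \<epsilon> k)) S Pe"
      unfolding extension_algorithm_output_def S1_def[symmetric] Let_def
    proof (intro exI conjI)
      show "symmetry_normalizer r S1 U1" using N1 by (simp add: U1_def)
      show "symmetry_normalizer s S U2" using N2 by (simp add: U2_def)
      show "\<forall>i<length As. mclen (foldl (*) (mstar U1 * P * U2) (take i As)) > 0 \<and>
          paraunitary s (As ! i) \<and> compatible_symmetry (As ! i) \<and> mkeys (As ! i) \<subseteq> {-1..1} \<and>
          mclen (foldl (*) (mstar U1 * P * U2) (take (Suc i) As)) < mclen (foldl (*) (mstar U1 * P * U2) (take i As))"
        using As(1) unfolding Q_def .
      show "mclen (foldl (*) (mstar U1 * P * U2) (take (length As) As)) = 0" using As(2) by (simp add: Q_def)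
      show "foldl (*) (mstar U1 * P * U2) (take (length As) As) * V = Matrix.mat r s (\<lambda>(i, j). if i = j then 1 else 0)"
        using V(4) by (simp add: Q_def)
      show "Pe = four_block_mat U1 (0\<^sub>m r (s - r)) (0\<^sub>m (s - r) r) (1\<^sub>m (s - r)) *
          (mstar V * foldl (\<lambda>M A. mstar A * M) (mstar U2) As)"
        unfolding fold[OF mstar_carrier[OF Uc(2)]] Pe_def G_def ..
    qed (use V in auto)
    show "is_extension F r s P Pe"
      unfolding is_extension_def
    proof (intro conjI allI impI)
      show "compatible_symmetry Pe" using symmetric_mat_compatible[OF Pesym Pec e \<eta>] .
      show "row Pe i = row P i" if "i < r" for i
        by (rule eq_vecI) (use that rows[OF that] Pec P(1) rs in auto)
    qed (use Pec PeF Pep bound in auto)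
  qed (use e ek Pesym in auto)
qed

subsection \<open>Symmetry and orthogonality of filters\<close>

lemma leval_reflect:
  assumes "z \<noteq> 0" "\<And>k. cf q k = x * cf p (n - k)"
  shows "leval q z = x * (z powi n * leval p (1 / z))"
proof -
  define K where "K = (\<lambda>k. n - k) ` Poly_Mapping.keys p"
  have inj: "inj_on (\<lambda>k. n - k) (Poly_Mapping.keys p)" by (auto simp: inj_on_def)
  have "leval q z = (\<Sum>k\<in>K. cf q k * z powi k)"
  proof (rule leval_alt)
    show "Poly_Mapping.keys q \<subseteq> K"
    proof
      fix k assume "k \<in> Poly_Mapping.keys q"
      then have "n - k \<in> Poly_Mapping.keys p" using assms(2) by (auto simp: in_keys_iff)
      then show "k \<in> K" unfolding K_def by (rule rev_image_eqI) simp
    qed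
  qed (simp add: K_def)
  also have "\<dots> = (\<Sum>k\<in>Poly_Mapping.keys p. cf q (n - k) * z powi (n - k))"
    unfolding K_def by (simp add: sum.reindex[OF inj])
  also have "\<dots> = (\<Sum>k\<in>Poly_Mapping.keys p. x * (z powi n * (cf p k * (1 / z) powi k)))"
    using assms by (intro sum.cong) (auto simp: power_int_diff power_int_divide_distrib)
  finally show ?thesis by (simp add: leval_def sum_distrib_left)
qed

text \<open>In each entry the two principal powers use the same logarithm and combine to the
  integral power of z with exponent \<open>N l j\<close>. What remains is an identity of Laurent
  polynomials.\<close>

lemma filter_symmetry_iff:
  assumes a: "a \<in> carrier_mat r r"
    and N: "\<And>l j. l < r \<Longrightarrow> j < r \<Longrightarrow> real d * e l - c j = of_int (N l j)"
  shows "filter_symmetry d r a \<delta> e \<epsilon> c \<longleftrightarrow>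
    (\<forall>l<r. \<forall>j<r. \<forall>k. cf (a $$ (l, j)) k = \<delta> l * \<epsilon> j * cf (a $$ (l, j)) (N l j - k))"
proof -
  have entry: "(mat_diag r (\<lambda>l. \<delta> l * z powr complex_of_real (real d * e l)) * meval a (1 / z) *
       mat_diag r (\<lambda>l. \<epsilon> l * z powr complex_of_real (- c l))) $$ (l, j) =
       \<delta> l * \<epsilon> j * (z powi N l j * leval (a $$ (l, j)) (1 / z))"
    if "l < r" "j < r" "z \<noteq> 0" for l j z
  proof -
    have "z powr complex_of_real (real d * e l) * z powr complex_of_real (- c j)
      = z powr (complex_of_real (real d * e l - c j))"
      by (simp flip: powr_add)
    also have "\<dots> = z powi N l j"
      using that by (simp add: N complex_powr_of_int)
    finally have powr: "z powr complex_of_real (real d * e l) * z powr complex_of_real (- c j) = z powi N l j" .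
    have "(mat_diag r (\<lambda>l. \<delta> l * z powr complex_of_real (real d * e l)) * meval a (1 / z) *
       mat_diag r (\<lambda>l. \<epsilon> l * z powr complex_of_real (- c l))) $$ (l, j) =
      \<delta> l * z powr complex_of_real (real d * e l) * leval (a $$ (l, j)) (1 / z) * (\<epsilon> j * z powr complex_of_real (- c j))"
      by (subst mat_diag_mult_left[OF meval_carrier[OF a]], subst mat_diag_mult_right) (use a that in auto)
    then show ?thesis unfolding powr[symmetric] by (simp only: mult_ac)
  qed
  show ?thesis
  proof
    assume sym: "filter_symmetry d r a \<delta> e \<epsilon> c"
    show "\<forall>l<r. \<forall>j<r. \<forall>k. cf (a $$ (l, j)) k = \<delta> l * \<epsilon> j * cf (a $$ (l, j)) (N l j - k)"
    proof (intro allI impI)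
      fix l j k assume lj: "l < r" "j < r"
      define q where "q = lmonom (\<delta> l * \<epsilon> j) 0 * Poly_Mapping.map_key (\<lambda>k. N l j - k) (a $$ (l, j))"
      have "inj (\<lambda>k. N l j - k)" by (auto simp: inj_def)
      then have q: "cf q k = \<delta> l * \<epsilon> j * cf (a $$ (l, j)) (N l j - k)" for k
        by (simp add: q_def cf_lmonom_mult map_key.rep_eq)
      have "a $$ (l, j) = q"
      proof (rule leval_eqI)
        fix z :: complex assume z: "z \<noteq> 0"
        have "leval (a $$ (l, j)) z = meval a z $$ (l, j)" using a lj by simp
        also have "\<dots> = \<delta> l * \<epsilon> j * (z powi N l j * leval (a $$ (l, j)) (1 / z))"
          by (subst sym[unfolded filter_symmetry_def, rule_format, OF z]) (rule entry[OF lj z])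
        also have "\<dots> = leval q z" using leval_reflect[OF z q] by simp
        finally show "leval (a $$ (l, j)) z = leval q z" .
      qed
      then show "cf (a $$ (l, j)) k = \<delta> l * \<epsilon> j * cf (a $$ (l, j)) (N l j - k)"
        using q by metis
    qed
  next
    assume sym: "\<forall>l<r. \<forall>j<r. \<forall>k. cf (a $$ (l, j)) k = \<delta> l * \<epsilon> j * cf (a $$ (l, j)) (N l j - k)"
    show "filter_symmetry d r a \<delta> e \<epsilon> c"
      unfolding filter_symmetry_def
    proof (intro allI impI eq_matI)
      fix z :: complex and l j
      assume z: "z \<noteq> 0" and "l < dim_row (mat_diag r (\<lambda>l. \<delta> l * z powr complex_of_real (real d * e l)) * meval a (1 / z) *
         mat_diag r (\<lambda>l. \<epsilon> l * z powr complex_of_real (- c l)))"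
       "j < dim_col (mat_diag r (\<lambda>l. \<delta> l * z powr complex_of_real (real d * e l)) * meval a (1 / z) *
         mat_diag r (\<lambda>l. \<epsilon> l * z powr complex_of_real (- c l)))"
      then have lj: "l < r" "j < r" by (auto simp: mat_diag_def)
      show "meval a z $$ (l, j) = (mat_diag r (\<lambda>l. \<delta> l * z powr complex_of_real (real d * e l)) * meval a (1 / z) *
         mat_diag r (\<lambda>l. \<epsilon> l * z powr complex_of_real (- c l))) $$ (l, j)"
      proof -
        have "leval (a $$ (l, j)) z = \<delta> l * \<epsilon> j * (z powi N l j * leval (a $$ (l, j)) (1 / z))"
          by (rule leval_reflect[OF z]) (use sym lj in blast)
        then show ?thesis unfolding entry[OF lj z] using a lj by simp
      qed
    qed (use a in \<open>auto simp: mat_diag_def\<close>)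
  qed
qed

lemma block_index_less:
  fixes \<gamma> d l r :: nat
  assumes "\<gamma> < d" "l < r"
  shows "\<gamma> * r + l < d * r"
proof -
  have "\<gamma> * r + l < Suc \<gamma> * r" using assms by simp
  also have "\<dots> \<le> d * r" using assms by (intro mult_le_mono1) simp
  finally show ?thesis .
qed

lemma band_orthogonal_iff:
  assumes a: "a \<in> carrier_mat r r"
  shows "band_orthogonal d r a \<longleftrightarrow> polyphase_row d r a * mstar (polyphase_row d r a) = 1\<^sub>m r"
proof -
  let ?P = "polyphase_row d r a"
  let ?x = "\<lambda>\<gamma>. msubsymbol d (int \<gamma>) a"
  have Pc: "?P \<in> carrier_mat r (d * r)" by (simp add: polyphase_row_def block_row_def)
  have xc: "?x \<gamma> \<in> carrier_mat r r" for \<gamma> using a by (simp add: msubsymbol_def)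
  have entry: "(\<Sum>\<gamma><d. (meval (?x \<gamma>) z * meval (mstar (?x \<gamma>)) z) $$ (i, j)) = leval ((?P * mstar ?P) $$ (i, j)) z"
    if ij: "i < r" "j < r" and z: "z \<noteq> 0" for i j z
  proof -
    have "(?P * mstar ?P) $$ (i, j) = (\<Sum>q<d * r. ?P $$ (i, q) * lstar (?P $$ (j, q)))"
      using ij Pc by (subst mat_mult_index[of _ _ _ _ "d * r"]) auto
    also have "\<dots> = (\<Sum>q<d * r. ?x (q div r) $$ (i, q mod r) * lstar (?x (q div r) $$ (j, q mod r)))"
      using ij by (intro sum.cong) (auto simp: polyphase_row_def block_row_def)
    also have "\<dots> = (\<Sum>\<gamma><d. \<Sum>l<r. ?x \<gamma> $$ (i, l) * lstar (?x \<gamma> $$ (j, l)))"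
    proof -
      have "(\<Sum>\<gamma><d. \<Sum>l<r. ?x \<gamma> $$ (i, l) * lstar (?x \<gamma> $$ (j, l))) =
        (\<Sum>(\<gamma>, l)\<in>{..<d} \<times> {..<r}. ?x \<gamma> $$ (i, l) * lstar (?x \<gamma> $$ (j, l)))"
        by (simp add: sum.cartesian_product)
      also have "\<dots> = (\<Sum>q<d * r. ?x (q div r) $$ (i, q mod r) * lstar (?x (q div r) $$ (j, q mod r)))"
        by (rule sum.reindex_bij_witness[where i = "\<lambda>q. (q div r, q mod r)" and j = "\<lambda>(\<gamma>, l). \<gamma> * r + l"])
          (use ij in \<open>auto simp: less_mult_imp_div_less intro: block_index_less\<close>)
      finally show ?thesis by simp
    qed
    also have "\<dots> = (\<Sum>\<gamma><d. (?x \<gamma> * mstar (?x \<gamma>)) $$ (i, j))"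
    proof (rule sum.cong[OF refl])
      fix \<gamma>
      show "(\<Sum>l<r. ?x \<gamma> $$ (i, l) * lstar (?x \<gamma> $$ (j, l))) = (?x \<gamma> * mstar (?x \<gamma>)) $$ (i, j)"
        using ij xc[of \<gamma>] by (subst mat_mult_index[of _ _ _ _ r]) auto
    qed
    finally have "leval ((?P * mstar ?P) $$ (i, j)) z = (\<Sum>\<gamma><d. leval ((?x \<gamma> * mstar (?x \<gamma>)) $$ (i, j)) z)"
      by (simp only: leval_sum)
    also have "\<dots> = (\<Sum>\<gamma><d. (meval (?x \<gamma>) z * meval (mstar (?x \<gamma>)) z) $$ (i, j))"
    proof (rule sum.cong[OF refl])
      fix \<gamma>
      have "(meval (?x \<gamma>) z * meval (mstar (?x \<gamma>)) z) = meval (?x \<gamma> * mstar (?x \<gamma>)) z"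
        using meval_mult[OF xc mstar_carrier[OF xc] z] by simp
      then show "leval ((?x \<gamma> * mstar (?x \<gamma>)) $$ (i, j)) z = (meval (?x \<gamma>) z * meval (mstar (?x \<gamma>)) z) $$ (i, j)"
        using ij xc[of \<gamma>] by simp
    qed
    finally show ?thesis by simp
  qed
  show ?thesis
  proof
    assume bo: "band_orthogonal d r a"
    show "?P * mstar ?P = 1\<^sub>m r"
    proof (rule eq_matI)
      fix i j assume "i < dim_row (1\<^sub>m r :: laurent mat)" "j < dim_col (1\<^sub>m r :: laurent mat)"
      then have ij: "i < r" "j < r" by auto
      show "(?P * mstar ?P) $$ (i, j) = 1\<^sub>m r $$ (i, j)"
      proof (rule leval_eqI)
        fix z :: complex assume "z \<noteq> 0"
        then show "leval ((?P * mstar ?P) $$ (i, j)) z = leval (1\<^sub>m r $$ (i, j)) z"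
          using bo entry[OF ij] ij unfolding band_orthogonal_def by (auto simp: one_mat_def)
      qed
    qed (use Pc in auto)
  next
    assume "?P * mstar ?P = 1\<^sub>m r"
    then show "band_orthogonal d r a"
      unfolding band_orthogonal_def using entry by (auto simp: one_mat_def)
  qed
qed

text \<open>A column with entries \<open>\<epsilon> i z^(k i)\<close> is the adjoint of a row with
  symmetries \<open>\<epsilon> i z^(- k i)\<close>, whence the minus sign.\<close>

lemma mhas_S_monom_iff:
  assumes X: "X \<in> carrier_mat n m" and sgn: "\<forall>i<n. \<epsilon> i \<in> {1, -1}" "\<forall>j<m. \<eta> j \<in> {1, -1}"
  shows "mhas_S X (monom_col n \<epsilon> k * Matrix.mat 1 m (\<lambda>(_, j). lmonom (\<eta> j) (c j))) \<longleftrightarrow>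
    symmetric_mat \<epsilon> (\<lambda>i. - k i) \<eta> c X"
proof -
  let ?S = "monom_col n \<epsilon> k * Matrix.mat 1 m (\<lambda>(_, j). lmonom (\<eta> j) (c j))"
  have Sc: "?S \<in> carrier_mat n m" unfolding monom_col_def by (rule mult_carrier_mat[of _ n 1]) auto
  have "has_S (X $$ (i, j)) (?S $$ (i, j)) \<longleftrightarrow> (\<forall>x. cf (X $$ (i, j)) (c j - - k i - x) = \<epsilon> i * \<eta> j * cf (X $$ (i, j)) x)"
    if ij: "i < n" "j < m" for i j
  proof -
    have "?S $$ (i, j) = (\<Sum>l<1. monom_col n \<epsilon> k $$ (i, l) * Matrix.mat 1 m (\<lambda>(_, j). lmonom (\<eta> j) (c j)) $$ (l, j))"
      by (rule mat_mult_index) (use ij in \<open>auto simp: monom_col_def\<close>)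
    also have "\<dots> = lmonom (\<epsilon> i * \<eta> j) (k i + c j)" using ij by (simp add: monom_col_def mult_single)
    finally have S: "?S $$ (i, j) = lmonom (\<epsilon> i * \<eta> j) (k i + c j)" .
    have "\<epsilon> i = 1 \<or> \<epsilon> i = -1" "\<eta> j = 1 \<or> \<eta> j = -1" using sgn ij by auto
    then have "\<epsilon> i * \<eta> j \<in> {1, -1}" by auto
    then show ?thesis
      unfolding S by (subst has_S_lmonom) (auto simp: algebra_simps)
  qed
  then show ?thesis
    using X Sc unfolding mhas_S_def symmetric_mat_def by auto
qed

subsection \<open>Admissible shifts\<close>

text \<open>The natural number \<open>slen\<close>, with 0 reserved for the empty support, orders
  supports like their extended real lengths; well-foundedness then provides minimizing
  shifts.\<close>

lemma support_length_mono_nat: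
  defines "slen K \<equiv> if K = {} then 0 else Suc (nat (Max K - Min K))"
  assumes "finite K" "finite K'" "slen K \<le> slen K'"
  shows "support_length K \<le> support_length K'"
proof (cases "K = {} \<or> K' = {}")
  case True
  then show ?thesis using assms(4) by (auto simp: support_length_def slen_def split: if_splits)
next
  case False
  then have "Min K \<le> Max K" "Min K' \<le> Max K'" using assms(2,3) by auto
  then have "Max K - Min K \<le> Max K' - Min K'" using False assms(4) by (auto simp: slen_def)
  then show ?thesis using False by (simp add: support_length_def)
qed

lemma support_length_translate:
  assumes "finite K"
  shows "support_length ((\<lambda>k. k + n) ` K) = support_length K"
proof (cases "K = {}")
  case False
  have "mono (\<lambda>k. k + n)" by (auto simp: mono_def)
  then have "Max ((\<lambda>k. k + n) ` K) = Max K + n" "Min ((\<lambda>k. k + n) ` K) = Min K + n"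
    using mono_Max_commute[of "\<lambda>k. k + n" K] mono_Min_commute[of "\<lambda>k. k + n" K] False assms by auto
  then show ?thesis using False by (simp add: support_length_def)
qed (simp add: support_length_def)

lemma mclen_shift: "mclen (lmonom 1 n \<cdot>\<^sub>m A) = mclen A"
proof -
  have "mkeys (lmonom 1 n \<cdot>\<^sub>m A) = (\<lambda>k. k + n) ` mkeys A"
  proof (rule Set.set_eqI)
    fix k
    have "k \<in> mkeys (lmonom 1 n \<cdot>\<^sub>m A) \<longleftrightarrow> k - n \<in> mkeys A"
      by (auto simp: mkeys_def in_keys_iff cf_lmonom_mult)
    also have "\<dots> \<longleftrightarrow> k \<in> (\<lambda>k. k + n) ` mkeys A" by force
    finally show "k \<in> mkeys (lmonom 1 n \<cdot>\<^sub>m A) \<longleftrightarrow> k \<in> (\<lambda>k. k + n) ` mkeys A" .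
  qed
  then show ?thesis by (simp add: support_length_translate finite_mkeys)
qed

lemma mclen_minimiser_exists: "\<exists>n. \<forall>n'. mclen (A + lmonom 1 n \<cdot>\<^sub>m B) \<le> mclen (A + lmonom 1 n' \<cdot>\<^sub>m B)"
proof -
  let ?K = "\<lambda>n. mkeys (A + lmonom 1 n \<cdot>\<^sub>m B)"
  obtain n where "\<And>n'. (if ?K n = {} then 0 else Suc (nat (Max (?K n) - Min (?K n)))) \<le>
      (if ?K n' = {} then 0 else Suc (nat (Max (?K n') - Min (?K n'))))"
    using ex_has_least_nat[of "\<lambda>_. True" _ "\<lambda>n. if ?K n = {} then 0 else Suc (nat (Max (?K n) - Min (?K n)))"]
    by auto
  then show ?thesis using support_length_mono_nat[OF finite_mkeys finite_mkeys] by blast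
qed

text \<open>The two sums differ by a monomial factor. This is why partners have opposite sets of
  minimizing shifts.\<close>

lemma mclen_add_shift_swap:
  assumes "A \<in> carrier_mat n m" "B \<in> carrier_mat n m"
  shows "mclen (B + lmonom 1 (- k) \<cdot>\<^sub>m A) = mclen (A + lmonom 1 k \<cdot>\<^sub>m B)"
proof -
  have "lmonom 1 k \<cdot>\<^sub>m (B + lmonom 1 (- k) \<cdot>\<^sub>m A) = A + lmonom 1 k \<cdot>\<^sub>m B"
  proof (rule eq_matI)
    fix i j assume "i < dim_row (A + lmonom 1 k \<cdot>\<^sub>m B)" "j < dim_col (A + lmonom 1 k \<cdot>\<^sub>m B)"
    then show "(lmonom 1 k \<cdot>\<^sub>m (B + lmonom 1 (- k) \<cdot>\<^sub>m A)) $$ (i, j) = (A + lmonom 1 k \<cdot>\<^sub>m B) $$ (i, j)"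
      using assms by (simp add: distrib_left mult.assoc[symmetric] mult_single)
  qed (use assms in auto)
  then show ?thesis using mclen_shift by metis
qed

subsection \<open>Filter banks\<close>

locale symmetric_filter = conj_sqrt_field F for F +
  fixes d r :: nat and a0 :: "laurent mat" and \<epsilon> :: "nat \<Rightarrow> complex" and c :: "nat \<Rightarrow> real"
  assumes d: "d \<ge> 2" and r: "r \<ge> 1"
    and a0: "a0 \<in> carrier_mat r r" and a0F: "coeffs_in F a0"
    and orth: "band_orthogonal d r a0"
    and \<epsilon>: "\<forall>l<r. \<epsilon> l \<in> {1, -1}"
    and ints: "\<forall>l<r. \<forall>j<r. real d * c l - c j \<in> \<int>"
    and sym: "filter_symmetry d r a0 \<epsilon> c \<epsilon> c"
begin

text \<open>Row 0 is the reference row: d c_l - c_j = \<open>N j + d k l\<close> separates the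
  dependence on row and column. Consequently the quotient for row l is
  \<open>R \<gamma> j + k l\<close>, while the remainder is the same for all rows.\<close>

definition N :: "nat \<Rightarrow> int" where "N j = \<lfloor>real d * c 0 - c j\<rfloor>"
definition k :: "nat \<Rightarrow> int" where "k l = \<lfloor>c l - c 0\<rfloor>"
definition R :: "nat \<Rightarrow> nat \<Rightarrow> int" where "R \<gamma> j = (N j - int \<gamma>) div int d"
abbreviation q :: "nat \<Rightarrow> nat \<Rightarrow> nat" where "q \<equiv> Qcol d c"
abbreviation x :: "nat \<Rightarrow> laurent mat" where "x \<gamma> \<equiv> msubsymbol d (int \<gamma>) a0"

lemma of_int_N: "j < r \<Longrightarrow> real_of_int (N j) = real d * c 0 - c j"
  using ints r by (auto simp: N_def elim!: Ints_cases)

lemma of_int_k: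
  assumes "l < r"
  shows "real_of_int (k l) = c l - c 0"
proof -
  have "real d * c l - c 0 \<in> \<int>" "real d * c l - c l \<in> \<int>" using ints r assms by auto
  then have "(real d * c l - c 0) - (real d * c l - c l) \<in> \<int>" by (rule Ints_diff)
  also have "(real d * c l - c 0) - (real d * c l - c l) = c l - c 0" by simp
  finally show ?thesis by (auto simp: k_def elim!: Ints_cases)
qed

lemma offset: "l < r \<Longrightarrow> j < r \<Longrightarrow> real d * c l - c j = of_int (N j + int d * k l)"
  by (simp add: of_int_N of_int_k algebra_simps)

lemma q_less: "q \<gamma> j < d"
  using d by (simp add: Qcol_def Qidx_def nat_less_iff)

lemma int_q: "int (q \<gamma> j) = (N j - int \<gamma>) mod int d"
  using d by (simp add: Qcol_def Qidx_def N_def)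

lemma N_eq: "N j = int \<gamma> + int (q \<gamma> j) + int d * R \<gamma> j"
  unfolding int_q R_def using mult_div_mod_eq[of "int d" "N j - int \<gamma>"] by linarith

text \<open>The partner is determined by \<gamma> + \<open>q \<gamma> j\<close> \<equiv> N j modulo
  d, a relation symmetric in the two.\<close>

lemma q_q: assumes "\<gamma> < d" shows "q (q \<gamma> j) j = \<gamma>"
proof -
  have "N j - int (q \<gamma> j) = int \<gamma> + int d * R \<gamma> j" using N_eq[of j \<gamma>] by simp
  then have "int (q (q \<gamma> j) j) = int \<gamma>" using assms unfolding int_q by simp
  then show ?thesis by simp
qed

lemma R_q: assumes "\<gamma> < d" shows "R (q \<gamma> j) j = R \<gamma> j"
  using N_eq[of j \<gamma>] N_eq[of j "q \<gamma> j"] q_q[OF assms, of j] d by simp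

lemma a0_sym: "l < r \<Longrightarrow> j < r \<Longrightarrow> cf (a0 $$ (l, j)) t = \<epsilon> l * \<epsilon> j * cf (a0 $$ (l, j)) (N j + int d * k l - t)"
  using sym filter_symmetry_iff[OF a0, of d c c "\<lambda>l j. N j + int d * k l" \<epsilon> \<epsilon>] offset by blast

lemma cf_x: "l < r \<Longrightarrow> j < r \<Longrightarrow> cf (x \<gamma> $$ (l, j)) t = complex_of_real (sqrt (real d)) * cf (a0 $$ (l, j)) (int \<gamma> + int d * t)"
  using a0 d by (simp add: msubsymbol_def lookup_subsymbol)

text \<open>The symmetry of \<open>a0\<close> reflects exponents, hence sends the residue class of
  \<gamma> modulo d to that of \<open>q \<gamma> j\<close>.\<close>

lemma x_sym:
  assumes "l < r" "j < r"
  shows "cf (x \<gamma> $$ (l, j)) (R \<gamma> j + k l - t) = \<epsilon> l * \<epsilon> j * cf (x (q \<gamma> j) $$ (l, j)) t"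
proof -
  have "N j + int d * k l - (int \<gamma> + int d * (R \<gamma> j + k l - t)) = int (q \<gamma> j) + int d * t"
    using N_eq[of j \<gamma>] by (simp add: algebra_simps)
  then show ?thesis
    unfolding cf_x[OF assms] by (subst a0_sym[OF assms]) simp
qed

lemma polyphase_row_carrier: "polyphase_row d r a0 \<in> carrier_mat r (d * r)"
  by (simp add: polyphase_row_def block_row_def)

lemma block_div_mod: "\<gamma> < d \<Longrightarrow> j < r \<Longrightarrow> (\<gamma> * r + j) div r = \<gamma>" "j < r \<Longrightarrow> (\<gamma> * r + j) mod r = j"
  by auto

lemma block_cases:
  assumes "p < d * r"
  obtains \<gamma> i where "\<gamma> < d" "i < r" "p = \<gamma> * r + i"
proof (rule that)
  show "p div r < d" using assms by (simp add: less_mult_imp_div_less)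
  show "p mod r < r" using r by simp
  show "p = p div r * r + p mod r" by simp
qed

text \<open>A minimizing shift is chosen for the smaller member of each pair; its negative is
  minimizing for the larger one.\<close>

lemma admissible_shift_exists: "\<exists>\<kappa>. admissible_shift d r c a0 \<kappa>"
proof -
  let ?x = "\<lambda>\<gamma> j. poly_col d r a0 \<gamma> j"
  have xc: "?x \<gamma> j \<in> carrier_mat r 1" for \<gamma> j by (simp add: poly_col_def)
  define n0 where "n0 \<gamma> j = (SOME n. \<forall>n'. mclen (?x \<gamma> j + lmonom 1 n \<cdot>\<^sub>m ?x (q \<gamma> j) j) \<le>
      mclen (?x \<gamma> j + lmonom 1 n' \<cdot>\<^sub>m ?x (q \<gamma> j) j))" for \<gamma> j
  have n0: "mclen (?x \<gamma> j + lmonom 1 (n0 \<gamma> j) \<cdot>\<^sub>m ?x (q \<gamma> j) j) \<le> mclen (?x \<gamma> j + lmonom 1 n' \<cdot>\<^sub>m ?x (q \<gamma> j) j)"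
    for \<gamma> j n'
    unfolding n0_def by (rule someI_ex[OF mclen_minimiser_exists, THEN spec])
  define \<kappa> where "\<kappa> j \<gamma> = (if \<gamma> \<le> q \<gamma> j then n0 \<gamma> j else - n0 (q \<gamma> j) j)" for j \<gamma>
  have "mclen (?x \<gamma> j + lmonom 1 (\<kappa> j \<gamma>) \<cdot>\<^sub>m ?x (q \<gamma> j) j) \<le> mclen (?x \<gamma> j + lmonom 1 n \<cdot>\<^sub>m ?x (q \<gamma> j) j)"
    if \<gamma>: "\<gamma> < d" for \<gamma> j n
  proof (cases "\<gamma> \<le> q \<gamma> j")
    case False
    have "mclen (?x \<gamma> j + lmonom 1 (- n0 (q \<gamma> j) j) \<cdot>\<^sub>m ?x (q \<gamma> j) j)
      = mclen (?x (q \<gamma> j) j + lmonom 1 (n0 (q \<gamma> j) j) \<cdot>\<^sub>m ?x \<gamma> j)"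
      by (rule mclen_add_shift_swap[OF xc xc])
    also have "\<dots> \<le> mclen (?x (q \<gamma> j) j + lmonom 1 (- n) \<cdot>\<^sub>m ?x \<gamma> j)"
      using n0[of "q \<gamma> j" j "- n"] by (simp only: q_q[OF \<gamma>])
    also have "\<dots> = mclen (?x \<gamma> j + lmonom 1 n \<cdot>\<^sub>m ?x (q \<gamma> j) j)"
      by (rule mclen_add_shift_swap[OF xc xc])
    finally show ?thesis using False by (simp add: \<kappa>_def)
  qed (simp add: \<kappa>_def n0)
  moreover have "\<kappa> j (q \<gamma> j) = - \<kappa> j \<gamma>" if "\<gamma> < d" "\<gamma> \<noteq> q \<gamma> j" for \<gamma> j
    using that q_q[of \<gamma> j] by (auto simp: \<kappa>_def)
  ultimately have "admissible_shift d r c a0 \<kappa>"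
    unfolding admissible_shift_def by blast
  then show ?thesis by blast
qed

end

section \<open>The transform matrix and the symmetry it creates\<close>

locale shifted_filter = symmetric_filter F d r a0 \<epsilon> c for F d r a0 \<epsilon> c +
  fixes \<kappa> :: "nat \<Rightarrow> nat \<Rightarrow> int"
  assumes \<kappa>: "\<And>j \<gamma>. j < r \<Longrightarrow> \<gamma> < d \<Longrightarrow> \<gamma> \<noteq> Qcol d c \<gamma> j \<Longrightarrow> \<kappa> j (Qcol d c \<gamma> j) = - \<kappa> j \<gamma>"
begin

abbreviation U :: "laurent mat" where "U \<equiv> transform_matrix d r c \<kappa>"
abbreviation h :: complex where "h \<equiv> 1 / complex_of_real (sqrt 2)"

lemma h_h: "h * h = 1 / 2"
  by (simp flip: of_real_mult)

lemma U_carrier [simp]: "U \<in> carrier_mat (d * r) (d * r)"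
  and dim_U [simp]: "dim_row U = d * r" "dim_col U = d * r"
  by (auto simp: transform_matrix_def)

lemma U_entry:
  assumes "\<gamma>' < d" "\<gamma> < d" "i < r" "j < r"
  shows "U $$ (\<gamma>' * r + i, \<gamma> * r + j) =
    (if i \<noteq> j then 0
     else if \<gamma> = q \<gamma> j then (if \<gamma>' = \<gamma> then 1 else 0)
     else if \<gamma>' = \<gamma> then lmonom h 0
     else if \<gamma>' = q \<gamma> j then lmonom (if \<gamma> < q \<gamma> j then h else - h) (\<kappa> j \<gamma>)
     else 0)"
  using assms block_index_less[of \<gamma>' d i r] block_index_less[of \<gamma> d j r]
  by (simp add: transform_matrix_def Let_def)

lemma U_F: "coeffs_in F U"
proof -
  have "h \<in> F" using sqrt_of_nat_closed[of 2] by (auto intro: divide_closed)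
  moreover then have "- h \<in> F" by (rule uminus_closed)
  ultimately show ?thesis
    by (auto simp: coeffs_in_def transform_matrix_def Let_def lookup_single when_def lookup_one)
qed

lemma sum_block_pair:
  fixes f :: "nat \<Rightarrow> laurent"
  assumes "\<gamma> < d" "j < r" and f: "\<And>\<gamma>' i. \<gamma>' < d \<Longrightarrow> i < r \<Longrightarrow> i \<noteq> j \<or> (\<gamma>' \<noteq> \<gamma> \<and> \<gamma>' \<noteq> q \<gamma> j) \<Longrightarrow> f (\<gamma>' * r + i) = 0"
  shows "(\<Sum>p<d * r. f p) = (if \<gamma> = q \<gamma> j then f (\<gamma> * r + j) else f (\<gamma> * r + j) + f (q \<gamma> j * r + j))"
proof -
  have "(\<Sum>p<d * r. f p) = (\<Sum>p\<in>{\<gamma> * r + j, q \<gamma> j * r + j}. f p)"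
  proof (rule sum.mono_neutral_right)
    show "{\<gamma> * r + j, q \<gamma> j * r + j} \<subseteq> {..<d * r}"
      using block_index_less[OF assms(1,2)] block_index_less[OF q_less[of \<gamma> j] assms(2)] by simp
    show "\<forall>p\<in>{..<d * r} - {\<gamma> * r + j, q \<gamma> j * r + j}. f p = 0"
    proof
      fix p assume p: "p \<in> {..<d * r} - {\<gamma> * r + j, q \<gamma> j * r + j}"
      then obtain \<gamma>' i where "\<gamma>' < d" "i < r" "p = \<gamma>' * r + i" using block_cases by blast
      then show "f p = 0" using f p by blast
    qed
  qed simp
  moreover have "\<gamma> * r + j = q \<gamma> j * r + j \<longleftrightarrow> \<gamma> = q \<gamma> j" using r by simp
  ultimately show ?thesis by auto
qed

lemma mult_U_index:
  assumes X: "X \<in> carrier_mat m (d * r)" and ij: "i < m" "\<gamma> < d" "j < r"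
  shows "(X * U) $$ (i, \<gamma> * r + j) = (if \<gamma> = q \<gamma> j then X $$ (i, \<gamma> * r + j)
    else lmonom h 0 * X $$ (i, \<gamma> * r + j) +
      lmonom (if \<gamma> < q \<gamma> j then h else - h) (\<kappa> j \<gamma>) * X $$ (i, q \<gamma> j * r + j))"
proof -
  have "(X * U) $$ (i, \<gamma> * r + j) = (\<Sum>p<d * r. X $$ (i, p) * U $$ (p, \<gamma> * r + j))"
    by (rule mat_mult_index) (use X ij block_index_less in auto)
  also have "\<dots> = (if \<gamma> = q \<gamma> j then X $$ (i, \<gamma> * r + j) * U $$ (\<gamma> * r + j, \<gamma> * r + j)
    else X $$ (i, \<gamma> * r + j) * U $$ (\<gamma> * r + j, \<gamma> * r + j) + X $$ (i, q \<gamma> j * r + j) * U $$ (q \<gamma> j * r + j, \<gamma> * r + j))"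
    by (rule sum_block_pair) (use ij in \<open>auto simp: U_entry\<close>)
  also have "U $$ (\<gamma> * r + j, \<gamma> * r + j) = (if \<gamma> = q \<gamma> j then 1 else lmonom h 0)"
    using ij by (simp add: U_entry)
  finally show ?thesis
    using ij q_less[of \<gamma> j]
    by (cases "\<gamma> = q \<gamma> j") (simp_all add: U_entry[OF q_less ij(2,3,3)] mult.commute[of "X $$ _"])
qed

text \<open>Because the shifts of partners are opposite, the adjoint combines columns with the same
  exponents as \<open>U\<close> itself; only the signs are exchanged between the partners.\<close>

lemma mult_mstar_U_index:
  assumes X: "X \<in> carrier_mat m (d * r)" and ij: "i < m" "\<gamma> < d" "j < r"
  shows "(X * mstar U) $$ (i, \<gamma> * r + j) = (if \<gamma> = q \<gamma> j then X $$ (i, \<gamma> * r + j)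
    else lmonom h 0 * X $$ (i, \<gamma> * r + j) +
      lmonom (if q \<gamma> j < \<gamma> then h else - h) (\<kappa> j \<gamma>) * X $$ (i, q \<gamma> j * r + j))"
proof -
  have b: "\<gamma> * r + j < d * r" using ij block_index_less by auto
  have "(X * mstar U) $$ (i, \<gamma> * r + j) = (\<Sum>p<d * r. X $$ (i, p) * mstar U $$ (p, \<gamma> * r + j))"
    by (rule mat_mult_index) (use X ij b in auto)
  also have "\<dots> = (\<Sum>p<d * r. X $$ (i, p) * lstar (U $$ (\<gamma> * r + j, p)))"
    using b by (intro sum.cong) auto
  also have "\<dots> = (if \<gamma> = q \<gamma> j then X $$ (i, \<gamma> * r + j) * lstar (U $$ (\<gamma> * r + j, \<gamma> * r + j))
    else X $$ (i, \<gamma> * r + j) * lstar (U $$ (\<gamma> * r + j, \<gamma> * r + j)) + X $$ (i, q \<gamma> j * r + j) * lstar (U $$ (\<gamma> * r + j, q \<gamma> j * r + j)))"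
  proof (rule sum_block_pair[OF ij(2,3)])
    fix \<gamma>' i' assume "\<gamma>' < d" "i' < r" "i' \<noteq> j \<or> (\<gamma>' \<noteq> \<gamma> \<and> \<gamma>' \<noteq> q \<gamma> j)"
    then show "X $$ (i, \<gamma>' * r + i') * lstar (U $$ (\<gamma> * r + j, \<gamma>' * r + i')) = 0"
      using ij q_q[of \<gamma>' j] by (auto simp: U_entry)
  qed
  also have "U $$ (\<gamma> * r + j, \<gamma> * r + j) = (if \<gamma> = q \<gamma> j then 1 else lmonom h 0)"
    using ij by (simp add: U_entry)
  finally show ?thesis
    using ij q_less[of \<gamma> j] q_q[OF ij(2), of j] \<kappa>[OF ij(3,2)]
    by (cases "\<gamma> = q \<gamma> j") (simp_all add: U_entry[OF ij(2) q_less ij(3,3)] lstar_lmonom mult.commute[of "X $$ _"])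
qed

text \<open>On a pair with \<gamma> < \<open>q \<gamma> j\<close> and shift n the matrix is the
  block with rows (h, -h z^(-n)) and (h z^n, h), where h^2 = 1/2; on a fixed point of the involution
  it is 1.\<close>

lemma paraunitary_U: "paraunitary (d * r) U"
  unfolding paraunitary_iff
proof (intro conjI eq_matI)
  fix p p' assume "p < dim_row (1\<^sub>m (d * r) :: laurent mat)" "p' < dim_col (1\<^sub>m (d * r) :: laurent mat)"
  then have pp: "p < d * r" "p' < d * r" by auto
  then obtain \<gamma>' i \<gamma> j where p: "\<gamma>' < d" "i < r" "p = \<gamma>' * r + i" and p': "\<gamma> < d" "j < r" "p' = \<gamma> * r + j"
    by (metis block_cases)
  have eq: "p = p' \<longleftrightarrow> \<gamma>' = \<gamma> \<and> i = j"
    unfolding p(3) p'(3) using block_div_mod p p' by metis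
  have "(U * mstar U) $$ (p, p') = (if \<gamma> = q \<gamma> j then U $$ (p, \<gamma> * r + j)
    else lmonom h 0 * U $$ (p, \<gamma> * r + j) +
      lmonom (if q \<gamma> j < \<gamma> then h else - h) (\<kappa> j \<gamma>) * U $$ (p, q \<gamma> j * r + j))"
    unfolding p'(3) by (rule mult_mstar_U_index[OF U_carrier pp(1) p'(1,2)])
  also have "\<dots> = (if p = p' then 1 else 0)"
  proof (cases "\<gamma> = q \<gamma> j \<or> i \<noteq> j")
    case True
    then show ?thesis
      unfolding eq unfolding p(3) using p p' q_less[of \<gamma> j] by (auto simp: U_entry)
  next
    case False
    have "lmonom (1/2) 0 + lmonom (1/2) 0 = lmonom (1 :: complex) 0"
      unfolding single_add[symmetric] by simp
    then have half: "lmonom (1/2) 0 + lmonom (1/2) 0 = (1 :: laurent)" by simp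
    have cancel: "lmonom (1/2) n + lmonom (- (1/2)) n = (0 :: laurent)" "lmonom (- (1/2)) n + lmonom (1/2) n = (0 :: laurent)" for n
      unfolding single_add[symmetric] by simp_all
    show ?thesis
      unfolding eq unfolding p(3)
      using False p p' q_less[of \<gamma> j] q_q[OF p'(1), of j] \<kappa>[OF p'(2,1)]
      by (auto simp: U_entry mult_single h_h half cancel simp del: times_divide_eq_left times_divide_eq_right)
  qed
  also have "\<dots> = 1\<^sub>m (d * r) $$ (p, p')" using pp by (simp add: one_mat_def)
  finally show "(U * mstar U) $$ (p, p') = 1\<^sub>m (d * r) $$ (p, p')" .
qed auto

definition P :: "laurent mat" where "P = polyphase_row d r a0 * U"

lemma P_carrier [simp]: "P \<in> carrier_mat r (d * r)"
  unfolding P_def by (rule mult_carrier_mat[OF polyphase_row_carrier U_carrier])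

lemma P_entry:
  assumes "l < r" "\<gamma> < d" "j < r"
  shows "P $$ (l, \<gamma> * r + j) = (if \<gamma> = q \<gamma> j then x \<gamma> $$ (l, j)
    else lmonom h 0 * x \<gamma> $$ (l, j) + lmonom (if \<gamma> < q \<gamma> j then h else - h) (\<kappa> j \<gamma>) * x (q \<gamma> j) $$ (l, j))"
proof -
  have "polyphase_row d r a0 $$ (l, \<gamma>' * r + j) = x \<gamma>' $$ (l, j)" if "\<gamma>' < d" for \<gamma>'
    using assms that block_index_less by (simp add: polyphase_row_def block_row_def)
  then show ?thesis
    unfolding P_def mult_U_index[OF polyphase_row_carrier assms] using assms q_less by simp
qed

lemma P_eq_blocks: "P = block_row d r (b_block d r c a0 \<kappa>)"
proof (rule eq_matI)
  fix l p assume "l < dim_row (block_row d r (b_block d r c a0 \<kappa>))" "p < dim_col (block_row d r (b_block d r c a0 \<kappa>))"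
  then have l: "l < r" and p: "p < d * r" by (auto simp: block_row_def)
  obtain \<gamma> j where j: "\<gamma> < d" "j < r" "p = \<gamma> * r + j" using block_cases[OF p] .
  have plus: "lmonom g 0 * (u + lmonom 1 n * v) = lmonom g 0 * u + lmonom g n * v"
    and minus: "lmonom g 0 * (u - lmonom 1 n * v) = lmonom g 0 * u + lmonom (- g) n * v" for g n u v
    by (simp_all add: distrib_left right_diff_distrib mult.assoc[symmetric] mult_single single_uminus)
  have "block_row d r (b_block d r c a0 \<kappa>) $$ (l, p) = b_block d r c a0 \<kappa> \<gamma> $$ (l, j)"
    using l p j by (simp add: block_row_def)
  also have "\<dots> = P $$ (l, p)"
    unfolding j(3) P_entry[OF l j(1,2)]
    using l j by (simp add: b_block_def Let_def plus minus)
  finally show "P $$ (l, p) = block_row d r (b_block d r c a0 \<kappa>) $$ (l, p)" by simp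
qed (auto simp: block_row_def P_def polyphase_row_def)

definition \<eta> :: "nat \<Rightarrow> complex" where
  "\<eta> p = (let \<gamma> = p div r; j = p mod r in if q \<gamma> j < \<gamma> then - \<epsilon> j else \<epsilon> j)"

text \<open>Reflection turns one partner into the other. Moving the summands back to their places in
  the sum or difference costs the extra shift \<kappa>; the row contributes \<open>k l\<close>
  separately.\<close>

definition cc :: "nat \<Rightarrow> int" where
  "cc p = (let \<gamma> = p div r; j = p mod r in R \<gamma> j + (if \<gamma> = q \<gamma> j then 0 else \<kappa> j \<gamma>))"

lemma \<eta>_block: "j < r \<Longrightarrow> \<eta> (\<gamma> * r + j) = (if q \<gamma> j < \<gamma> then - \<epsilon> j else \<epsilon> j)"
  and cc_block: "j < r \<Longrightarrow> cc (\<gamma> * r + j) = R \<gamma> j + (if \<gamma> = q \<gamma> j then 0 else \<kappa> j \<gamma>)"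
  by (auto simp: \<eta>_def cc_def Let_def)

lemma \<eta>_sign: "\<forall>p<d * r. \<eta> p \<in> {1, -1}"
proof (intro allI impI)
  fix p assume "p < d * r"
  then obtain \<gamma> j where "\<gamma> < d" "j < r" "p = \<gamma> * r + j" by (rule block_cases)
  then show "\<eta> p \<in> {1, -1}" using \<epsilon> by (auto simp: \<eta>_block)
qed

lemma P_symmetric: "symmetric_mat \<epsilon> (\<lambda>l. - k l) \<eta> cc P"
  unfolding symmetric_mat_def
proof (intro allI impI)
  fix l p t assume "l < dim_row P" "p < dim_col P"
  then have l: "l < r" and "p < d * r" using P_carrier by auto
  then obtain \<gamma> j where j: "\<gamma> < d" "j < r" and p: "p = \<gamma> * r + j" using block_cases by metis
  note xs = x_sym[OF l j(2), of \<gamma>] x_sym[OF l j(2), of "q \<gamma> j", unfolded q_q[OF j(1)] R_q[OF j(1)]]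
  show "cf (P $$ (l, p)) (cc p - - k l - t) = \<epsilon> l * \<eta> p * cf (P $$ (l, p)) t"
  proof (cases "\<gamma> = q \<gamma> j")
    case True
    then show ?thesis
      unfolding p P_entry[OF l j] using j xs(1)[of t] by (simp add: \<eta>_block cc_block)
  next
    case False
    define g where "g = (if \<gamma> < q \<gamma> j then h else - h)"
    have cfP: "cf (P $$ (l, p)) t = h * cf (x \<gamma> $$ (l, j)) t + g * cf (x (q \<gamma> j) $$ (l, j)) (t - \<kappa> j \<gamma>)" for t
      unfolding p P_entry[OF l j] using False by (simp add: lookup_add cf_lmonom_mult g_def)
    have "cc p - - k l - t = R \<gamma> j + k l - (t - \<kappa> j \<gamma>)" "cc p - - k l - t - \<kappa> j \<gamma> = R \<gamma> j + k l - t"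
      unfolding p cc_block[OF j(2)] using False by simp_all
    then have "cf (P $$ (l, p)) (cc p - - k l - t) =
      h * (\<epsilon> l * \<epsilon> j * cf (x (q \<gamma> j) $$ (l, j)) (t - \<kappa> j \<gamma>)) + g * (\<epsilon> l * \<epsilon> j * cf (x \<gamma> $$ (l, j)) t)"
      unfolding cfP by (simp only: xs)
    also have "\<dots> = \<epsilon> l * \<eta> p * cf (P $$ (l, p)) t"
    proof -
      have "\<eta> p = (if q \<gamma> j < \<gamma> then - \<epsilon> j else \<epsilon> j)" by (simp add: p \<eta>_block[OF j(2)])
      then show ?thesis unfolding cfP[of t] g_def using False by (auto simp: algebra_simps)
    qed
    finally show ?thesis .
  qed
qed

text \<open>The converse of \<open>P_symmetric\<close>, one row at a time: symmetric columns
  recombined by the adjoint of \<open>U\<close> are interchanged by reflection. It also covers the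
  rows added by the extension, about which only the symmetry of \<open>Pe\<close> is known.\<close>

lemma polyphase_symmetric:
  assumes Pe: "Pe \<in> carrier_mat m (d * r)" and sym: "symmetric_mat e (\<lambda>i. - k' i) \<eta> cc Pe"
    and ij: "i < m" "\<gamma> < d" "j < r"
  shows "cf ((Pe * mstar U) $$ (i, \<gamma> * r + j)) (R \<gamma> j + k' i - t) =
    e i * \<epsilon> j * cf ((Pe * mstar U) $$ (i, q \<gamma> j * r + j)) t"
proof -
  let ?p = "\<gamma> * r + j" and ?p' = "q \<gamma> j * r + j"
  have b: "?p < d * r" "?p' < d * r" using block_index_less ij q_less by auto
  have qq: "q (q \<gamma> j) j = \<gamma>" using q_q[OF ij(2)] .
  note s1 = symmetric_matD[OF sym Pe ij(1) b(1)] and s2 = symmetric_matD[OF sym Pe ij(1) b(2)]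
  show ?thesis
  proof (cases "\<gamma> = q \<gamma> j")
    case True
    then have "cc ?p - - k' i - t = R \<gamma> j + k' i - t" "\<eta> ?p = \<epsilon> j" using ij by (simp_all add: cc_block \<eta>_block)
    then show ?thesis
      using s1[of t] True mult_mstar_U_index[OF Pe ij] by simp
  next
    case False
    \<comment> \<open>The sign with which the adjoint of \<open>U\<close> adds the partner column;
      the symmetry signs of the two columns are -g and g times \<epsilon> j.\<close>
    define g where "g = (if q \<gamma> j < \<gamma> then 1 else - 1 :: complex)"
    have g: "g * g = 1" by (simp add: g_def)
    have PP1: "cf ((Pe * mstar U) $$ (i, ?p)) u = h * cf (Pe $$ (i, ?p)) u + g * h * cf (Pe $$ (i, ?p')) (u - \<kappa> j \<gamma>)" for u
      unfolding mult_mstar_U_index[OF Pe ij] using False by (simp add: lookup_add cf_lmonom_mult g_def)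
    have PP2: "cf ((Pe * mstar U) $$ (i, ?p')) u = h * cf (Pe $$ (i, ?p')) u - g * h * cf (Pe $$ (i, ?p)) (u + \<kappa> j \<gamma>)" for u
      unfolding mult_mstar_U_index[OF Pe ij(1) q_less ij(3)] qq using False \<kappa>[OF ij(3,2) False]
      by (auto simp: lookup_add cf_lmonom_mult g_def)
    have e1: "R \<gamma> j + k' i - t = cc ?p - - k' i - (t + \<kappa> j \<gamma>)"
      and e2: "R \<gamma> j + k' i - t - \<kappa> j \<gamma> = cc ?p' - - k' i - t"
      using ij False \<kappa>[OF ij(3,2) False] by (simp_all add: cc_block qq R_q)
    have \<eta>: "\<eta> ?p = - g * \<epsilon> j" "\<eta> ?p' = g * \<epsilon> j"
      using ij False by (auto simp: \<eta>_block qq g_def)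
    have "cf ((Pe * mstar U) $$ (i, ?p)) (R \<gamma> j + k' i - t) =
      h * (e i * \<eta> ?p * cf (Pe $$ (i, ?p)) (t + \<kappa> j \<gamma>)) + g * h * (e i * \<eta> ?p' * cf (Pe $$ (i, ?p')) t)"
      unfolding PP1[of "R \<gamma> j + k' i - t"] e2 unfolding e1 s1 s2 ..
    also have "\<dots> = e i * \<epsilon> j * (g * g * h * cf (Pe $$ (i, ?p')) t - g * h * cf (Pe $$ (i, ?p)) (t + \<kappa> j \<gamma>))"
      unfolding \<eta> by (simp only: ring_distribs mult_ac minus_mult_left minus_mult_right) simp
    finally show ?thesis unfolding PP2 g by simp
  qed
qed

lemma cf_filter_of_polyphase:
  assumes "l < r" "j < r" "\<gamma> < d"
  shows "cf (filter_of_polyphase d r PP m $$ (l, j)) (int \<gamma> + int d * t) =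
    1 / complex_of_real (sqrt (real d)) * cf (PP $$ (m * r + l, \<gamma> * r + j)) t"
proof -
  have "cf (dilate d (PP $$ (m * r + l, \<gamma>' * r + j)) * lmonom 1 (int \<gamma>')) (int \<gamma> + int d * t)
    = (if \<gamma>' = \<gamma> then cf (PP $$ (m * r + l, \<gamma> * r + j)) t else 0)" if "\<gamma>' < d" for \<gamma>'
  proof (cases "\<gamma>' = \<gamma>")
    case False
    have "\<not> int d dvd int \<gamma> + int d * t - int \<gamma>'"
    proof
      assume "int d dvd int \<gamma> + int d * t - int \<gamma>'"
      then have "int d dvd int \<gamma> + int d * t - int \<gamma>' - int d * t" by (rule dvd_diff) simp
      then have "int d dvd int \<gamma> - int \<gamma>'" by simp
      then have "int \<gamma> mod int d = int \<gamma>' mod int d" by (simp add: mod_eq_dvd_iff)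
      then show False using False that assms by simp
    qed
    then show ?thesis using False d by (simp add: cf_mult_lmonom cf_dilate)
  qed (use d in \<open>simp add: cf_mult_lmonom cf_dilate\<close>)
  then have "(\<Sum>\<gamma>'<d. cf (dilate d (PP $$ (m * r + l, \<gamma>' * r + j)) * lmonom 1 (int \<gamma>')) (int \<gamma> + int d * t))
    = cf (PP $$ (m * r + l, \<gamma> * r + j)) t"
    using assms by simp
  then show ?thesis
    using assms by (simp add: filter_of_polyphase_def cf_lmonom_mult lookup_sum)
qed

text \<open>The adjoint of \<open>U\<close> undoes \<open>U\<close> in the first block row, which
  returns the subsymbols of \<open>a0\<close>; the other block rows are read as filters. Their
  symmetry is \<open>polyphase_symmetric\<close> collected over the residue classes of exponents
  modulo d.\<close>

lemma filter_bank:
  fixes Pe :: "laurent mat"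
  defines "PP \<equiv> Pe * mstar U"
  defines "a \<equiv> (\<lambda>m. if m = 0 then a0 else filter_of_polyphase d r PP m)"
  assumes ext: "is_extension F r (d * r) P Pe"
    and e: "\<forall>i<d * r. e i \<in> {1, -1}"
    and sym: "symmetric_mat e (\<lambda>i. - k' i) \<eta> cc Pe"
  shows "polyphase_matrix d r a = PP" "paraunitary (d * r) PP"
    and "m \<in> {1..<d} \<Longrightarrow> coeffs_in F (a m)"
    and "m \<in> {1..<d} \<Longrightarrow>
      filter_symmetry d r (a m) (\<lambda>l. e (m * r + l)) (\<lambda>l. real_of_int (k' (m * r + l) - k l) + c l) \<epsilon> c"
proof -
  have Pec: "Pe \<in> carrier_mat (d * r) (d * r)" and PeF: "coeffs_in F Pe" and Pep: "paraunitary (d * r) Pe"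
    and rows: "\<And>i. i < r \<Longrightarrow> row Pe i = row P i"
    using ext by (auto simp: is_extension_def)
  have PPc: "PP \<in> carrier_mat (d * r) (d * r)"
    unfolding PP_def by (rule mult_carrier_mat[OF Pec mstar_carrier[OF U_carrier]])
  show "paraunitary (d * r) PP"
    unfolding PP_def by (intro paraunitary_mult paraunitary_mstar Pep paraunitary_U)
  have PPF: "coeffs_in F PP"
    unfolding PP_def by (rule coeffs_in_mult[OF PeF coeffs_in_mstar[OF U_F] Pec mstar_carrier[OF U_carrier]])
  have sqd: "complex_of_real (sqrt (real d)) \<noteq> 0" using d by simp
  have sqdF: "1 / complex_of_real (sqrt (real d)) \<in> F" using sqrt_of_nat_closed by (intro divide_closed) auto
  have split: "int (nat (y mod int d)) + int d * (y div int d) = y" "nat (y mod int d) < d" for y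
    using d by (auto simp: nat_less_iff)
  have a_carrier: "m \<noteq> 0 \<Longrightarrow> a m \<in> carrier_mat r r" for m by (simp add: a_def filter_of_polyphase_def)
  have cfa: "cf (a m $$ (l, j)) (int \<gamma> + int d * t) =
    1 / complex_of_real (sqrt (real d)) * cf (PP $$ (m * r + l, \<gamma> * r + j)) t"
    if "m \<noteq> 0" "l < r" "j < r" "\<gamma> < d" for m l j \<gamma> t
    using that cf_filter_of_polyphase by (simp add: a_def)
  show "polyphase_matrix d r a = PP"
  proof (rule eq_matI)
    fix p p' assume "p < dim_row PP" "p' < dim_col PP"
    then have pp: "p < d * r" "p' < d * r" using PPc by auto
    obtain m l where m: "m < d" "l < r" "p = m * r + l" using block_cases[OF pp(1)] .
    obtain \<gamma> j where \<gamma>: "\<gamma> < d" "j < r" "p' = \<gamma> * r + j" using block_cases[OF pp(2)] .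
    have "polyphase_matrix d r a $$ (p, p') = msubsymbol d (int \<gamma>) (a m) $$ (l, j)"
      using pp m \<gamma> by (simp add: polyphase_matrix_def)
    also have "\<dots> = PP $$ (p, p')"
    proof (cases "m = 0")
      case True
      have "PP $$ (p, p') = (P * mstar U) $$ (l, p')"
        using True m pp rows[OF m(2)] Pec carrier_matD[OF P_carrier] by (simp add: PP_def)
      also have "P * mstar U = polyphase_row d r a0"
        unfolding P_def by (rule mult_mstar_cancel[OF polyphase_row_carrier paraunitary_U])
      finally show ?thesis
        using True m \<gamma> pp by (simp add: polyphase_row_def block_row_def a_def)
    next
      case False
      show ?thesis
      proof (rule poly_mapping_eqI)
        fix t
        have "cf (msubsymbol d (int \<gamma>) (a m) $$ (l, j)) t = complex_of_real (sqrt (real d)) * cf (a m $$ (l, j)) (int \<gamma> + int d * t)"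
          using a_carrier[OF False] m \<gamma> d by (simp add: msubsymbol_def lookup_subsymbol)
        then show "cf (msubsymbol d (int \<gamma>) (a m) $$ (l, j)) t = cf (PP $$ (p, p')) t"
          using cfa[OF False m(2) \<gamma>(2,1)] sqd by (simp add: m \<gamma>)
      qed
    qed
    finally show "polyphase_matrix d r a $$ (p, p') = PP $$ (p, p')" .
  qed (use PPc in \<open>auto simp: polyphase_matrix_def\<close>)
  assume m: "m \<in> {1..<d}"
  then have m0: "m \<noteq> 0" "m < d" by auto
  show "coeffs_in F (a m)"
    unfolding coeffs_in_def
  proof (intro allI impI)
    fix l j y assume "l < dim_row (a m)" "j < dim_col (a m)"
    then have lj: "l < r" "j < r" using a_carrier[OF m0(1)] by auto
    have "cf (a m $$ (l, j)) y = 1 / complex_of_real (sqrt (real d)) * cf (PP $$ (m * r + l, nat (y mod int d) * r + j)) (y div int d)"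
      using cfa[OF m0(1) lj split(2), of y "y div int d"] unfolding split(1) .
    also have "\<dots> \<in> F"
      using PPF PPc block_index_less[OF m0(2) lj(1)] block_index_less[OF split(2) lj(2)] sqdF
      by (intro mult_closed) (auto simp: coeffs_in_def)
    finally show "cf (a m $$ (l, j)) y \<in> F" .
  qed
  \<comment> \<open>\<open>c l - k l\<close> is \<open>c 0\<close> for every l. Adding it to the
    integer \<open>k'\<close> produces the new centres, and the fractional parts cancel against
    \<open>c j\<close> just as for \<open>a0\<close>.\<close>
  let ?N = "\<lambda>l j. int d * k' (m * r + l) + N j"
  have N': "real d * (real_of_int (k' (m * r + l) - k l) + c l) - c j = of_int (?N l j)" if "l < r" "j < r" for l j
    using that by (simp add: of_int_N of_int_k algebra_simps)
  have "cf (a m $$ (l, j)) y = e (m * r + l) * \<epsilon> j * cf (a m $$ (l, j)) (?N l j - y)" if lj: "l < r" "j < r" for l j y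
  proof -
    define \<gamma> where "\<gamma> = nat (y mod int d)"
    define t where "t = y div int d"
    have y: "y = int \<gamma> + int d * t" and \<gamma>: "\<gamma> < d" using split by (auto simp: \<gamma>_def t_def)
    let ?i = "m * r + l"
    have i: "?i < d * r" using block_index_less[OF m0(2) lj(1)] .
    \<comment> \<open>Reflection moves y from the residue class of \<gamma> to that of its partner,
      and the quotient R is common to both.\<close>
    have "?N l j - y = int (q \<gamma> j) + int d * (R (q \<gamma> j) j + k' ?i - t)"
      using N_eq[of j \<gamma>] R_q[OF \<gamma>, of j] by (simp add: y algebra_simps)
    then have "cf (a m $$ (l, j)) (?N l j - y) = 1 / complex_of_real (sqrt (real d)) * cf (PP $$ (?i, q \<gamma> j * r + j)) (R (q \<gamma> j) j + k' ?i - t)"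
      using cfa[OF m0(1) lj q_less] by simp
    also have "cf (PP $$ (?i, q \<gamma> j * r + j)) (R (q \<gamma> j) j + k' ?i - t) = e ?i * \<epsilon> j * cf (PP $$ (?i, \<gamma> * r + j)) t"
      unfolding PP_def using polyphase_symmetric[OF Pec sym i q_less lj(2), of \<gamma> j t] q_q[OF \<gamma>, of j] by simp
    finally have *: "cf (a m $$ (l, j)) (?N l j - y) = e ?i * \<epsilon> j * cf (a m $$ (l, j)) y"
      unfolding y cfa[OF m0(1) lj \<gamma>] by simp
    have "e ?i * e ?i = 1" "\<epsilon> j * \<epsilon> j = 1" using e i \<epsilon> lj by auto
    then have "(e ?i * \<epsilon> j) * (e ?i * \<epsilon> j) = 1" by (metis (no_types, lifting) mult.assoc mult.commute mult.right_neutral)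
    then show ?thesis unfolding * by (simp add: mult.assoc[symmetric])
  qed
  then show "filter_symmetry d r (a m) (\<lambda>l. e (m * r + l)) (\<lambda>l. real_of_int (k' (m * r + l) - k l) + c l) \<epsilon> c"
    using N' by (subst filter_symmetry_iff[OF a_carrier[OF m0(1)], where N = ?N]) blast+
qed

end

lemma filter_symmetry_cong:
  assumes "\<And>l. l < r \<Longrightarrow> \<delta> l = \<delta>' l \<and> e l = e' l"
  shows "filter_symmetry d r a \<delta> e \<epsilon> c \<longleftrightarrow> filter_symmetry d r a \<delta>' e' \<epsilon> c"
proof -
  have "mat_diag r (\<lambda>l. \<delta> l * z powr complex_of_real (real d * e l)) =
      mat_diag r (\<lambda>l. \<delta>' l * z powr complex_of_real (real d * e' l))" for z
    unfolding mat_diag_def by (rule cong_mat) (use assms in auto)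
  then show ?thesis by (simp add: filter_symmetry_def)
qed

theorem mainTheorem3:
  fixes F :: "complex set" and d r :: nat and a0 :: "laurent mat"
    and \<epsilon> :: "nat \<Rightarrow> complex" and c :: "nat \<Rightarrow> real"
  assumes "is_complex_subfield F"
    and "\<forall>x\<in>F. cnj x \<in> F"
    and "\<forall>y::real. y > 0 \<and> complex_of_real y \<in> F \<longrightarrow> complex_of_real (sqrt y) \<in> F"
    and "d \<ge> 2" and "r \<ge> 1"
    and "a0 \<in> carrier_mat r r" and "coeffs_in F a0"
    and "band_orthogonal d r a0"
    and "\<forall>l<r. \<epsilon> l \<in> {1, -1}"
    and "\<forall>l<r. \<forall>j<r. real d * c l - c j \<in> \<int>"
    and "filter_symmetry d r a0 \<epsilon> c \<epsilon> c"
  shows "(\<exists>\<kappa>. admissible_shift d r c a0 \<kappa>) \<and>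
    (\<forall>\<kappa>. admissible_shift d r c a0 \<kappa> \<longrightarrow>
      (let s = d * r; U = transform_matrix d r c \<kappa>; P = polyphase_row d r a0 * U in
        P = block_row d r (b_block d r c a0 \<kappa>) \<and>
        paraunitary s U \<and>
        compatible_symmetry P \<and>
        (\<exists>k \<theta> S.
          \<theta> \<in> carrier_mat 1 s \<and> mhas_S \<theta> S \<and>
          mhas_S P (monom_col r \<epsilon> k * S) \<and>
          (\<exists>Pe \<epsilon>' k'.
            extension_algorithm_output F r s P (mstar (monom_col r \<epsilon> k)) S Pe \<and>
            is_extension F r s P Pe \<and>
            (\<forall>m\<in>{1..<d}. \<forall>l<r. \<epsilon>' m l \<in> {1, -1}) \<and>
            mhas_S Pe
              (monom_col s (\<lambda>i. if i < r then \<epsilon> i else \<epsilon>' (i div r) (i mod r))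
                           (\<lambda>i. if i < r then k i else k' (i div r) (i mod r)) * S)) \<and>
          (\<forall>Pe \<epsilon>' k'.
            is_extension F r s P Pe \<and>
            (\<forall>m\<in>{1..<d}. \<forall>l<r. \<epsilon>' m l \<in> {1, -1}) \<and>
            mhas_S Pe
              (monom_col s (\<lambda>i. if i < r then \<epsilon> i else \<epsilon>' (i div r) (i mod r))
                           (\<lambda>i. if i < r then k i else k' (i div r) (i mod r)) * S) \<longrightarrow>
            (let PP = Pe * mstar U;
                 a = (\<lambda>m. if m = 0 then a0 else filter_of_polyphase d r PP m)
             in polyphase_matrix d r a = PP \<and>
                paraunitary s PP \<and>
                (\<forall>m\<in>{1..<d}. coeffs_in F (a m) \<and>
                   filter_symmetry d r (a m)
                     (\<epsilon>' m) (\<lambda>l. real_of_int (k' m l - k l) + c l) \<epsilon> c))))))"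
proof -
  interpret symmetric_filter F d r a0 \<epsilon> c
    by unfold_locales (use assms in auto)
  show ?thesis
  proof (rule conjI[OF admissible_shift_exists], intro allI impI, goal_cases)
    case (1 \<kappa>)
    then interpret shifted_filter F d r a0 \<epsilon> c \<kappa>
      by unfold_locales (auto simp: admissible_shift_def)
    define S where "S = Matrix.mat 1 (d * r) (\<lambda>(_, j). lmonom (\<eta> j) (cc j))"
    have S: "mhas_S X (monom_col n e f * S) \<longleftrightarrow> symmetric_mat e (\<lambda>i. - f i) \<eta> cc X"
      if "X \<in> carrier_mat n (d * r)" "\<forall>i<n. e i \<in> {1, -1}" for X n e f
      unfolding S_def using mhas_S_monom_iff[OF that \<eta>_sign] .
    have PP: "P * mstar P = 1\<^sub>m r"
      unfolding P_def using orthonormal_rows_mult[OF polyphase_row_carrier _ paraunitary_U] orth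
      by (simp add: band_orthogonal_iff[OF a0])
    have "coeffs_in F (polyphase_row d r a0)"
      using a0F a0 block_div_mod r sqrt_of_nat_closed
      by (auto simp: coeffs_in_def polyphase_row_def block_row_def cf_x intro!: mult_closed)
    then have PF: "coeffs_in F P"
      unfolding P_def by (rule coeffs_in_mult[OF _ U_F polyphase_row_carrier U_carrier])
    obtain Pe e k' where
      Pe: "extension_algorithm_output F r (d * r) P (mstar (monom_col r \<epsilon> k)) S Pe"
        "is_extension F r (d * r) P Pe" "\<forall>i<d * r. e i \<in> {1, -1}"
        "\<And>i. i < r \<Longrightarrow> e i = \<epsilon> i \<and> k' i = k i" "symmetric_mat e (\<lambda>i. - k' i) \<eta> cc Pe"
      by (rule matrix_extension[OF P_carrier PP PF r \<epsilon> \<eta>_sign P_symmetric S_def]) (rule that)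
    \<comment> \<open>The statement indexes the new data by block and row within the block; on the
      first r rows they agree with those of \<open>P\<close>.\<close>
    have e_eq: "(\<lambda>i. if i < r then \<epsilon> i else e (i div r * r + i mod r)) = e"
      and k_eq: "(\<lambda>i. if i < r then k i else k' (i div r * r + i mod r)) = k'"
      using Pe(4) by auto
    show ?case
      unfolding Let_def P_def[symmetric]
    \<comment> \<open>The zero row serves as \<theta>; it admits the signed monomials of
      \<open>S\<close>, which carry the actual data.\<close>
    proof (rule conjI[OF P_eq_blocks], rule conjI[OF paraunitary_U],
        rule conjI[OF symmetric_mat_compatible[OF P_symmetric P_carrier \<epsilon> \<eta>_sign]],
        rule exI[of _ k], rule exI[of _ "0\<^sub>m 1 (d * r)"], rule exI[of _ S], intro conjI, goal_cases)
      case 1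
      show ?case by simp
    next
      case 2
      have "has_S 0 (lmonom (\<eta> j) (cc j))" if "j < d * r" for j
        using \<eta>_sign that by (subst has_S_lmonom) auto
      then show ?case by (auto simp: mhas_S_def S_def)
    next
      case 3
      show ?case using S[OF P_carrier \<epsilon>] P_symmetric by blast
    next
      case 4
      have "\<forall>m\<in>{1..<d}. \<forall>l<r. e (m * r + l) \<in> {1, -1}"
        using Pe(3) block_index_less by (metis atLeastLessThan_iff)
      moreover have "mhas_S Pe (monom_col (d * r) e k' * S)"
        using S Pe(2,3,5) unfolding is_extension_def by blast
      ultimately show ?case
        by (intro exI[of _ Pe] exI[of _ "\<lambda>m l. e (m * r + l)"] exI[of _ "\<lambda>m l. k' (m * r + l)"] conjI)
          (use Pe(1,2) in \<open>auto simp only: e_eq k_eq\<close>)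
    next
      case 5
      show ?case
      proof (intro allI impI, elim conjE, goal_cases)
        case (1 Pe \<epsilon>' k')
        note ext = 1(1) and sgn = 1(2)
        \<comment> \<open>The data given by blocks are reassembled into one sequence over the rows
          of \<open>Pe\<close>, the form used by \<open>filter_bank\<close>.\<close>
        define e where "e = (\<lambda>i. if i < r then \<epsilon> i else \<epsilon>' (i div r) (i mod r))"
        define f where "f = (\<lambda>i. if i < r then k i else k' (i div r) (i mod r) :: int)"
        from 1(3) have has: "mhas_S Pe (monom_col (d * r) e f * S)" by (simp only: e_def f_def)
        have e: "\<forall>i<d * r. e i \<in> {1, -1}"
        proof (intro allI impI)
          fix i assume i: "i < d * r"
          show "e i \<in> {1, -1}"
          proof (cases "i < r")
            case False
            then have "i div r \<noteq> 0" using r by (simp add: div_eq_0_iff)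
            moreover have "i div r < d" using i by (simp add: less_mult_imp_div_less)
            ultimately have "i div r \<in> {1..<d}" by simp
            then show ?thesis using sgn False r by (auto simp: e_def)
          qed (use \<epsilon> in \<open>auto simp: e_def\<close>)
        qed
        have "Pe \<in> carrier_mat (d * r) (d * r)" using ext by (simp add: is_extension_def)
        then have sym': "symmetric_mat e (\<lambda>i. - f i) \<eta> cc Pe" using S e has by blast
        note fb = filter_bank[OF ext e sym']
        have "e (m * r + l) = \<epsilon>' m l \<and> real_of_int (f (m * r + l) - k l) + c l = real_of_int (k' m l - k l) + c l"
          if "m \<in> {1..<d}" "l < r" for m l
        proof -
          have "r \<le> m * r" using that by simp
          then have "\<not> m * r + l < r" by linarith
          then show ?thesis using that by (simp add: e_def f_def)
        qed
        then have "filter_symmetry d r a (\<lambda>l. e (m * r + l)) (\<lambda>l. real_of_int (f (m * r + l) - k l) + c l) \<epsilon> c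
            \<longleftrightarrow> filter_symmetry d r a (\<epsilon>' m) (\<lambda>l. real_of_int (k' m l - k l) + c l) \<epsilon> c"
          if "m \<in> {1..<d}" for m a
          using that by (intro filter_symmetry_cong) blast
        then show ?case
          using fb by blast
      qed
    qed
  qed
qed

end
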